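(* There exist a locally finite graph $G=(V,E)$ and a sign function $s\colon E\to\{-1,1\}$ such that the signed voter model on $(G,s)$ has more than one equilibrium, but there is no subset $W\subset V$ having both of the following properties: (i) the subgraph of $G$ induced on $W$ (that is, $W$ with its inherited edge set) contains no unsatisfied cycle; (ii) for some starting site $x\in W$, the random walk on $G$ started at $x$ never leaves $W$ with strictly positive probability.
   Context: All graphs are simple, with countable vertex set and with every vertex $x$ of finite degree $d(x)\ge1$. Given $G=(V,E)$ and $s\colon E\to\{-1,1\}$ (write $s(x,y)=s(\{x,y\})$), the signed voter model $(\eta_t)_{t\ge0}$ is the spin system on $\{-1,1\}^V$ with generator $$\Omega f(\eta)=\sum_{x\in V}\big(f(\eta^x)-f(\eta)\big)\frac1{d(x)}\sum_{y\colon\{x,y\}\in E}1\{\eta(x)\eta(y)\ne s(x,y)\},$$ where $\eta^x$ is $\eta$ with the spin at $x$ flipped. An equilibrium is an invariant probability measure of this process. The random walk on $G$ is the continuous-time walk which jumps from $x$ to each neighbour of $x$ at rate $1/d(x)$. An unsatisfied cycle is a nearest neighbour cycle (closed nearest neighbour path) along which the number of steps crossing an edge of sign $-1$ is odd. *)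

theory Defs
  imports "HOL-Probability.Probability"
begin

(* A graph is a pair of a vertex set and a set of two-element edges. *)

definition nbrs :: "'a set set \<Rightarrow> 'a \<Rightarrow> 'a set" where
  "nbrs E x = {y. {x, y} \<in> E}"

definition deg :: "'a set set \<Rightarrow> 'a \<Rightarrow> nat" where
  "deg E x = card (nbrs E x)"

definition locally_finite_graph :: "'a set \<Rightarrow> 'a set set \<Rightarrow> bool" where
  "locally_finite_graph V E \<longleftrightarrow>
     countable V \<and> (\<forall>e\<in>E. e \<subseteq> V \<and> card e = 2) \<and>
     (\<forall>x\<in>V. finite (nbrs E x) \<and> deg E x \<ge> 1)"

definition induced_edges :: "'a set set \<Rightarrow> 'a set \<Rightarrow> 'a set set" where
  "induced_edges E W = {e \<in> E. e \<subseteq> W}"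

(* The list p = [x0, ..., xn] with x0 = xn has the n steps (p ! i, p ! Suc i);
   vertices and edges may be repeated, and repeated edges count with multiplicity. *)

definition unsatisfied_cycle :: "'a set set \<Rightarrow> ('a set \<Rightarrow> int) \<Rightarrow> 'a list \<Rightarrow> bool" where
  "unsatisfied_cycle E s p \<longleftrightarrow>
     p \<noteq> [] \<and> hd p = last p \<and>
     (\<forall>i. Suc i < length p \<longrightarrow> {p ! i, p ! Suc i} \<in> E) \<and>
     odd (card {i. Suc i < length p \<and> s {p ! i, p ! Suc i} = - 1})"

definition config_topology :: "'a set \<Rightarrow> ('a \<Rightarrow> int) topology" where
  "config_topology V = product_topology (\<lambda>_. discrete_topology {- 1, 1}) V"

abbreviation configs :: "'a set \<Rightarrow> ('a \<Rightarrow> int) set" where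
  "configs V \<equiv> V \<rightarrow>\<^sub>E {- 1, 1}"

lemma topspace_config_topology [simp]: "topspace (config_topology V) = configs V"
  by (simp add: config_topology_def)

(* For countable V this carries the Borel sigma-algebra of config_topology V. *)

definition config_algebra :: "'a set \<Rightarrow> ('a \<Rightarrow> int) measure" where
  "config_algebra V = PiM V (\<lambda>_. count_space {- 1, 1})"

(* Elements of C(configs V) are represented by total functions, of which only the
   values on configs V matter; all notions below depend on these values only. *)

definition conts :: "'a set \<Rightarrow> (('a \<Rightarrow> int) \<Rightarrow> real) set" where
  "conts V = {f. continuous_map (config_topology V) euclideanreal f}"

definition cylinder_funs :: "'a set \<Rightarrow> (('a \<Rightarrow> int) \<Rightarrow> real) set" where
  "cylinder_funs V = {f. \<exists>A. finite A \<and> A \<subseteq> V \<and>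
     (\<forall>\<eta>\<in>configs V. \<forall>\<zeta>\<in>configs V. (\<forall>x\<in>A. \<eta> x = \<zeta> x) \<longrightarrow> f \<eta> = f \<zeta>)}"

(* For a cylinder function only finitely many summands are nonzero. *)

definition voter_op ::
  "'a set \<Rightarrow> 'a set set \<Rightarrow> ('a set \<Rightarrow> int) \<Rightarrow> (('a \<Rightarrow> int) \<Rightarrow> real) \<Rightarrow> ('a \<Rightarrow> int) \<Rightarrow> real" where
  "voter_op V E s f \<eta> =
     (\<Sum>\<^sub>\<infinity>x\<in>V. (f (\<eta>(x := - \<eta> x)) - f \<eta>) *
        (1 / real (deg E x) * (\<Sum>y\<in>nbrs E x. of_bool (\<eta> x * \<eta> y \<noteq> s {x, y}))))"

(* Markov (Feller) semigroups on C(configs V) and their generators as in Liggett,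
   Interacting Particle Systems, Chapter I; operators are identified with their graphs,
   and limits are in the supremum norm. *)

definition markov_semigroup ::
  "'a set \<Rightarrow> (real \<Rightarrow> (('a \<Rightarrow> int) \<Rightarrow> real) \<Rightarrow> ('a \<Rightarrow> int) \<Rightarrow> real) \<Rightarrow> bool" where
  "markov_semigroup V S \<longleftrightarrow>
     (\<forall>t\<ge>0. \<forall>f\<in>conts V. S t f \<in> conts V) \<and>
     (\<forall>t\<ge>0. \<forall>f\<in>conts V. \<forall>g\<in>conts V. \<forall>a b. \<forall>\<eta>\<in>configs V.
        S t (\<lambda>\<zeta>. a * f \<zeta> + b * g \<zeta>) \<eta> = a * S t f \<eta> + b * S t g \<eta>) \<and>
     (\<forall>f\<in>conts V. \<forall>\<eta>\<in>configs V. S 0 f \<eta> = f \<eta>) \<and>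
     (\<forall>f\<in>conts V. \<forall>t\<ge>0. uniform_limit (configs V) (\<lambda>u. S u f) (S t f) (at_right t)) \<and>
     (\<forall>t\<ge>0. \<forall>u\<ge>0. \<forall>f\<in>conts V. \<forall>\<eta>\<in>configs V. S (t + u) f \<eta> = S t (S u f) \<eta>) \<and>
     (\<forall>t\<ge>0. \<forall>\<eta>\<in>configs V. S t (\<lambda>_. 1) \<eta> = 1) \<and>
     (\<forall>t\<ge>0. \<forall>f\<in>conts V. (\<forall>\<eta>\<in>configs V. f \<eta> \<ge> 0) \<longrightarrow> (\<forall>\<eta>\<in>configs V. S t f \<eta> \<ge> 0))"

definition generator ::
  "'a set \<Rightarrow> (real \<Rightarrow> (('a \<Rightarrow> int) \<Rightarrow> real) \<Rightarrow> ('a \<Rightarrow> int) \<Rightarrow> real) \<Rightarrow>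
   ((('a \<Rightarrow> int) \<Rightarrow> real) \<times> (('a \<Rightarrow> int) \<Rightarrow> real)) set" where
  "generator V S = {(f, g). f \<in> conts V \<and> g \<in> conts V \<and>
     uniform_limit (configs V) (\<lambda>t \<eta>. (S t f \<eta> - f \<eta>) / t) g (at_right 0)}"

definition voter_op_closure ::
  "'a set \<Rightarrow> 'a set set \<Rightarrow> ('a set \<Rightarrow> int) \<Rightarrow>
   ((('a \<Rightarrow> int) \<Rightarrow> real) \<times> (('a \<Rightarrow> int) \<Rightarrow> real)) set" where
  "voter_op_closure V E s = {(f, g). f \<in> conts V \<and> g \<in> conts V \<and>
     (\<forall>\<epsilon>>0. \<exists>h\<in>cylinder_funs V. \<forall>\<eta>\<in>configs V.
        \<bar>h \<eta> - f \<eta>\<bar> < \<epsilon> \<and> \<bar>voter_op V E s h \<eta> - g \<eta>\<bar> < \<epsilon>)}"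

(* The rates are bounded by 1 and changing the spins of the neighbours of a site changes
   its rate by at most 1 in total, so by Liggett's Theorem I.3.9 the closure generates a
   Markov semigroup; by Hille-Yosida that semigroup is unique. *)

definition signed_voter_model ::
  "'a set \<Rightarrow> 'a set set \<Rightarrow> ('a set \<Rightarrow> int) \<Rightarrow>
   (real \<Rightarrow> (('a \<Rightarrow> int) \<Rightarrow> real) \<Rightarrow> ('a \<Rightarrow> int) \<Rightarrow> real) \<Rightarrow> bool" where
  "signed_voter_model V E s S \<longleftrightarrow>
     markov_semigroup V S \<and> generator V S = voter_op_closure V E s"

definition equilibrium ::
  "'a set \<Rightarrow> (real \<Rightarrow> (('a \<Rightarrow> int) \<Rightarrow> real) \<Rightarrow> ('a \<Rightarrow> int) \<Rightarrow> real) \<Rightarrow>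
   ('a \<Rightarrow> int) measure \<Rightarrow> bool" where
  "equilibrium V S \<mu> \<longleftrightarrow>
     prob_space \<mu> \<and> sets \<mu> = sets (config_algebra V) \<and>
     (\<forall>t\<ge>0. \<forall>f\<in>conts V. (\<integral>\<eta>. S t f \<eta> \<partial>\<mu>) = (\<integral>\<eta>. f \<eta> \<partial>\<mu>))"

(* The total jump rate is deg E x * (1 / deg E x) = 1 at every vertex x, so the walk waits an
   exponential time of parameter 1 and then moves to a uniform neighbour. In a sample point
   (\<tau>, \<xi>), \<tau> n is the waiting time before the (n+1)-st jump, and \<xi> (n, v) is the target of
   that jump if it starts from v; all these variables are independent. *)

definition walk_space :: "'a set \<Rightarrow> 'a set set \<Rightarrow> ((nat \<Rightarrow> real) \<times> (nat \<times> 'a \<Rightarrow> 'a)) measure" where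
  "walk_space V E =
     PiM UNIV (\<lambda>_. density lborel (exponential_density 1)) \<Otimes>\<^sub>M
     PiM (UNIV \<times> V) (\<lambda>(n, v). measure_pmf (pmf_of_set (nbrs E v)))"

primrec jump_chain :: "'a \<Rightarrow> (nat \<times> 'a \<Rightarrow> 'a) \<Rightarrow> nat \<Rightarrow> 'a" where
  "jump_chain x \<xi> 0 = x"
| "jump_chain x \<xi> (Suc n) = \<xi> (n, jump_chain x \<xi> n)"

(* Almost surely the sum of the waiting times diverges, so the LEAST is well-defined. *)

definition random_walk :: "'a \<Rightarrow> real \<Rightarrow> (nat \<Rightarrow> real) \<times> (nat \<times> 'a \<Rightarrow> 'a) \<Rightarrow> 'a" where
  "random_walk x t \<omega> = jump_chain x (snd \<omega>) (LEAST n. t < (\<Sum>i\<le>n. fst \<omega> i))"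

definition stays_forever_prob :: "'a set \<Rightarrow> 'a set set \<Rightarrow> 'a \<Rightarrow> 'a set \<Rightarrow> real" where
  "stays_forever_prob V E x W =
     \<P>(\<omega> in walk_space V E. \<forall>t\<ge>0. random_walk x t \<omega> \<in> W)"

lemma prob_space_walk_space: "prob_space (walk_space V E)"
proof -
  interpret A: product_prob_space "\<lambda>_::nat. density lborel (exponential_density 1)" UNIV
    by (intro product_prob_spaceI prob_space_exponential_density) simp
  interpret B: product_prob_space
    "\<lambda>(n::nat, v). measure_pmf (pmf_of_set (nbrs E v))" "UNIV \<times> V"
    by (intro product_prob_spaceI) (auto simp: prob_space_measure_pmf split: prod.split)
  interpret pair_prob_space
    "PiM UNIV (\<lambda>_::nat. density lborel (exponential_density 1))"
    "PiM (UNIV \<times> V) (\<lambda>(n::nat, v). measure_pmf (pmf_of_set (nbrs E v)))" ..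
  show ?thesis
    unfolding walk_space_def by unfold_locales
qed

lemma measurable_jump_chain:
  fixes x :: "'a::countable"
  shows "(\<lambda>\<omega>. jump_chain x (snd \<omega>) n) \<in> measurable (walk_space V E) (count_space UNIV)"
proof (induction n)
  case (Suc n)
  have "(\<lambda>\<omega>. snd \<omega> (n, v)) \<in> measurable (walk_space V E) (count_space UNIV)" for v
  proof (cases "v \<in> V")
    case True
    have "(\<lambda>\<xi>. \<xi> (n, v)) \<in> measurable
        (PiM (UNIV \<times> V) (\<lambda>(n, v). measure_pmf (pmf_of_set (nbrs E v))))
        (measure_pmf (pmf_of_set (nbrs E v)))"
      using measurable_component_singleton
        [of "(n, v)" "UNIV \<times> V" "\<lambda>(n, v). measure_pmf (pmf_of_set (nbrs E v))"] True
      by simp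
    then have "(\<lambda>\<xi>. \<xi> (n, v)) \<in> measurable
        (PiM (UNIV \<times> V) (\<lambda>(n, v). measure_pmf (pmf_of_set (nbrs E v)))) (count_space UNIV)"
      by simp
    then show ?thesis
      unfolding walk_space_def by measurable
  next
    case False
    then have "snd \<omega> (n, v) = undefined" if "\<omega> \<in> space (walk_space V E)" for \<omega>
      using that by (auto simp: walk_space_def space_pair_measure space_PiM PiE_def extensional_def)
    then have "(\<lambda>\<omega>. snd \<omega> (n, v)) \<in> measurable (walk_space V E) (count_space UNIV)
      \<longleftrightarrow> (\<lambda>\<omega>. undefined :: 'a) \<in> measurable (walk_space V E) (count_space UNIV)"
      by (rule measurable_cong)
    then show ?thesis by simp
  qed
  from measurable_compose_countable[OF this Suc.IH] show ?case by simp
qed simp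

(* So stays_forever_prob is never 0 merely because the event is not measurable. *)

lemma measurable_stays_forever:
  fixes x :: "'a::countable"
  shows "{\<omega> \<in> space (walk_space V E). \<forall>t\<ge>0. random_walk x t \<omega> \<in> W} \<in> sets (walk_space V E)"
proof -
  let ?M = "walk_space V E"
  have rational: "(\<forall>t\<ge>0. random_walk x t \<omega> \<in> W) \<longleftrightarrow>
      (\<forall>q::rat. real_of_rat q \<ge> 0 \<longrightarrow> random_walk x (real_of_rat q) \<omega> \<in> W)" for \<omega>
  proof (intro iffI allI impI)
    fix t :: real
    assume Q: "\<forall>q. 0 \<le> real_of_rat q \<longrightarrow> random_walk x (real_of_rat q) \<omega> \<in> W" and t: "0 \<le> t"
    let ?S = "\<lambda>n. \<Sum>i\<le>n. fst \<omega> i"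
    have "\<exists>u>t. \<forall>v. t \<le> v \<and> v < u \<longrightarrow> (LEAST n. v < ?S n) = (LEAST n. t < ?S n)"
    proof (cases "\<exists>n. t < ?S n")
      case True
      define k where "k = (LEAST n. t < ?S n)"
      have k: "t < ?S k" and less: "\<And>j. t < ?S j \<Longrightarrow> k \<le> j"
        using LeastI_ex[OF True] by (auto simp: k_def intro: Least_le)
      have "(LEAST n. v < ?S n) = k" if "t \<le> v" "v < ?S k" for v
        using that less by (intro Least_equality) (auto intro: le_less_trans)
      with k have "\<exists>u>t. \<forall>v. t \<le> v \<and> v < u \<longrightarrow> (LEAST n. v < ?S n) = k"
        by blast
      then show ?thesis by (simp only: k_def)
    next
      case False
      have "(LEAST n. v < ?S n) = (LEAST n. t < ?S n)" if "t \<le> v" for v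
      proof -
        have "?S n \<le> t" for n
          using False by (simp add: not_less)
        then have "\<not> v < ?S n" and "\<not> t < ?S n" for n
          using that by (simp_all only: not_less) (rule order_trans)
        then show ?thesis by simp
      qed
      moreover have "t < t + 1" by simp
      ultimately show ?thesis by blast
    qed
    then obtain u where u: "u > t"
      "\<And>v. t \<le> v \<Longrightarrow> v < u \<Longrightarrow> (LEAST n. v < ?S n) = (LEAST n. t < ?S n)" by blast
    obtain q where q: "t < real_of_rat q" "real_of_rat q < u"
      using of_rat_dense[OF u(1)] by blast
    have "random_walk x (real_of_rat q) \<omega> = random_walk x t \<omega>"
      using q u(2)[of "real_of_rat q"] by (simp add: random_walk_def)
    moreover have "0 \<le> real_of_rat q" using q t by linarith
    ultimately show "random_walk x t \<omega> \<in> W" using Q by metis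
  qed auto
  have comp: "(\<lambda>\<omega>. fst \<omega> i) \<in> borel_measurable ?M" for i
  proof -
    have "(\<lambda>\<tau>. \<tau> i) \<in> borel_measurable
        (PiM UNIV (\<lambda>_. density lborel (exponential_density 1)))"
      using measurable_component_singleton
        [of i UNIV "\<lambda>_. density lborel (exponential_density 1)"] by simp
    then show ?thesis unfolding walk_space_def by measurable
  qed
  have "(\<lambda>\<omega>. LEAST n. t < (\<Sum>i\<le>n. fst \<omega> i)) \<in> measurable ?M (count_space UNIV)" for t
    using comp by measurable
  from measurable_compose_countable[OF measurable_jump_chain this]
  have walk: "random_walk x t \<in> measurable ?M (count_space UNIV)" for t
    by (simp add: random_walk_def[abs_def])
  have "{\<omega> \<in> space ?M. random_walk x t \<omega> \<in> W} \<in> sets ?M" for t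
    using measurable_sets[OF walk, of W t] by (simp add: vimage_def Int_def conj_commute)
  then show ?thesis
    unfolding rational by measurable
qed

end

theory Submission
  imports Defs
begin

text \<open>Under the signed voter model a site copies \<open>s\<close> times the spin of a uniform neighbour at rate
one, so the mean spin at a site evolves by a random walk that changes sign along negative edges. A
bounded function \<open>h\<close> that is harmonic for this signed walk is therefore a conserved
profile of mean spins: the model started from independent spins with means \<open>h\<close> keeps
these means for ever, and any limit point of its time averages is an equilibrium with means
\<open>h\<close>. The profile \<open>- h\<close> gives another equilibrium, so a bounded nonzero
signed harmonic function refutes uniqueness (\<open>harmonic_two_equilibria\<close>).

The graph is a ladder of hubs \<open>hub 0, hub 1, ...\<close>. Consecutive hubs are joined by one
negative edge and by \<open>width n\<close> positive paths of length two. The widths grow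
exponentially; hence the walk escapes to infinity and crosses negative edges only finitely often on
average, which is why a bounded signed harmonic function exists (\<open>ladder_harm_harmonic\<close>).
A set \<open>W\<close> without unsatisfied cycles contains no triangle made of two consecutive hubs
and a midpoint between them. Hubs are cut vertices: if \<open>W\<close> lacks a hub beyond the
starting point, the walk can stay in \<open>W\<close> only within finitely many vertices, which it
leaves almost surely. Otherwise \<open>W\<close> lacks all later midpoints, although nearly every
step from a hub leads to a midpoint. So the walk leaves every such \<open>W\<close> almost surely
(\<open>ladder_no_harmonic\<close> and \<open>stays_forever_prob_eq_0\<close>). The point is that the
negative edges are rarely crossed, but no vertex can be spared in order to avoid them.

The model itself has to be constructed. Duality does this almost without analysis. Every cylinder
function is a linear combination of the products \<open>spin_prod \<eta> B\<close> of the spins over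
finite sets \<open>B\<close>, and on them the generator acts by \<open>dual_gen\<close>, the
generator of annihilating random walks with signs. This operator does not increase the number of
walks, so it is bounded on sets of bounded size, and its exponential \<open>flow\<close> is a plain
power series. That the flow maps moments of probability measures to such moments follows from a
minimum principle (\<open>flow_positive\<close>); \<open>moment_measure_exists\<close> then
turns moments into measures, which are the transition probabilities of the process. Finally, the
cylinder functions form a core because the resolvent equation can be solved approximately inside
them by a Neumann series (\<open>resolvent_range_dense\<close>). Compactness of the set of moment
functions produces the equilibria (\<open>stationary_moments_exist\<close>).\<close>

section \<open>Exponential generating series\<close>

text \<open>With \<open>a k = \<phi> (A\<^sup>k v)\<close> this is \<open>\<phi> (exp (t A) v)\<close>. Scalar
sequences suffice because the exponentials below are evaluated by functionals \<open>\<phi>\<close>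
for which the sequence grows at most geometrically, although the operator is unbounded.\<close>

definition exp_series :: "(nat \<Rightarrow> real) \<Rightarrow> real \<Rightarrow> real" where
  "exp_series a t = (\<Sum>k. a k / fact k * t ^ k)"

definition geom_bounded :: "real \<Rightarrow> real \<Rightarrow> (nat \<Rightarrow> real) \<Rightarrow> bool" where
  "geom_bounded C R a \<longleftrightarrow> 0 \<le> R \<and> (\<forall>k. \<bar>a k\<bar> \<le> C * R ^ k)"

lemma exp_sums: "(\<lambda>k. C * (x ^ k / fact k)) sums (C * exp (x::real))"
  using exp_converges[of x] by (intro sums_mult) (simp add: field_simps)

lemma geom_boundedD: "geom_bounded C R a \<Longrightarrow> \<bar>a k\<bar> \<le> C * R ^ k" "geom_bounded C R a \<Longrightarrow> 0 \<le> R"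
  by (auto simp: geom_bounded_def)

lemma geom_bounded_nonneg: "geom_bounded C R a \<Longrightarrow> 0 \<le> C"
  using geom_boundedD(1)[of C R a 0] by simp

lemma geom_bounded_term:
  assumes "geom_bounded C R a"
  shows "\<bar>a k / fact k * t ^ k\<bar> \<le> C * ((R * \<bar>t\<bar>) ^ k / fact k)"
proof -
  have "\<bar>a k / fact k * t ^ k\<bar> = \<bar>a k\<bar> * (\<bar>t\<bar> ^ k / fact k)"
    by (simp add: abs_mult power_abs)
  also have "\<dots> \<le> (C * R ^ k) * (\<bar>t\<bar> ^ k / fact k)"
    by (intro mult_right_mono geom_boundedD[OF assms]) auto
  finally show ?thesis by (simp add: power_mult_distrib)
qed

lemma exp_series_abs_summable:
  assumes "geom_bounded C R a"
  shows "summable (\<lambda>k. \<bar>a k / fact k * t ^ k\<bar>)"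
  by (rule summable_comparison_test'[OF sums_summable[OF exp_sums[of C "R * \<bar>t\<bar>"]]])
    (simp only: real_norm_def abs_idempotent geom_bounded_term[OF assms])

lemma exp_series_sums:
  assumes "geom_bounded C R a"
  shows "(\<lambda>k. a k / fact k * t ^ k) sums exp_series a t"
  unfolding exp_series_def
  by (rule summable_sums[OF summable_rabs_cancel[OF exp_series_abs_summable[OF assms]]])

lemma exp_series_bound:
  assumes "geom_bounded C R a"
  shows "\<bar>exp_series a t\<bar> \<le> C * exp (R * \<bar>t\<bar>)"
proof -
  have "\<bar>exp_series a t\<bar> \<le> (\<Sum>k. \<bar>a k / fact k * t ^ k\<bar>)"
    unfolding exp_series_def by (rule summable_rabs[OF exp_series_abs_summable[OF assms]])
  also have "\<dots> \<le> (\<Sum>k. C * ((R * \<bar>t\<bar>) ^ k / fact k))"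
    by (rule suminf_le[OF geom_bounded_term[OF assms] exp_series_abs_summable[OF assms]
          sums_summable[OF exp_sums]])
  also have "\<dots> = C * exp (R * \<bar>t\<bar>)"
    using exp_sums by (rule sums_unique[symmetric])
  finally show ?thesis .
qed

lemma geom_bounded_shift:
  assumes "geom_bounded C R a"
  shows "geom_bounded (C * R ^ m) R (\<lambda>k. a (m + k))"
  using assms unfolding geom_bounded_def by (metis mult.assoc power_add)

lemma exp_series_deriv:
  assumes "geom_bounded C R a"
  shows "(exp_series a has_real_derivative exp_series (\<lambda>k. a (Suc k)) t) (at t)"
proof -
  have "((\<lambda>t. \<Sum>k. a k / fact k * t ^ k) has_real_derivative
          (\<Sum>k. diffs (\<lambda>k. a k / fact k) k * t ^ k)) (at t)"
    using sums_summable[OF exp_series_sums[OF assms]]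
    by (intro termdiffs_strong_converges_everywhere)
  moreover have "diffs (\<lambda>k. a k / fact k) k = a (Suc k) / fact k" for k
    by (simp add: diffs_def field_simps del: of_nat_Suc)
  ultimately show ?thesis
    by (simp add: exp_series_def[abs_def])
qed

lemma exp_series_0 [simp]: "exp_series a 0 = a 0"
  unfolding exp_series_def using powser_zero[of "\<lambda>k. a k / fact k"] by simp

lemma exp_series_const:
  assumes "\<And>k. a (Suc k) = 0"
  shows "exp_series a t = a 0"
proof -
  have "a k = 0" if "k \<notin> {0}" for k using assms that by (cases k) auto
  then have "exp_series a t = (\<Sum>k\<in>{0}. a k / fact k * t ^ k)"
    unfolding exp_series_def by (intro suminf_finite) simp_all
  then show ?thesis by simp
qed

lemma exp_series_shift_bound:
  assumes "geom_bounded C R a" "\<bar>t\<bar> \<le> T"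
  shows "\<bar>exp_series (\<lambda>k. a (m + k)) t\<bar> \<le> C * R ^ m * exp (R * T)"
proof -
  have "\<bar>exp_series (\<lambda>k. a (m + k)) t\<bar> \<le> C * R ^ m * exp (R * \<bar>t\<bar>)"
    by (rule exp_series_bound[OF geom_bounded_shift[OF assms(1)]])
  also have "\<dots> \<le> C * R ^ m * exp (R * T)"
    using assms geom_bounded_nonneg[OF assms(1)] geom_boundedD(2)[OF assms(1)]
    by (intro mult_left_mono) (auto intro: mult_left_mono)
  finally show ?thesis .
qed

text \<open>The semigroup law \<open>exp ((t + u) A) = exp (u A) exp (t A)\<close>. It is the Taylor expansion
of the series around \<open>t\<close>, whose derivatives are the series of the shifted sequences.\<close>

lemma exp_series_add:
  assumes a: "geom_bounded C R a"
  shows "exp_series a (t + u) = exp_series (\<lambda>m. exp_series (\<lambda>k. a (m + k)) t) u"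
proof -
  define D where "D m x = exp_series (\<lambda>k. a (m + k)) (t + x)" for m x
  have der: "(D m has_real_derivative D (Suc m) x) (at x)" for m x
  proof -
    have "(exp_series (\<lambda>k. a (m + k)) has_real_derivative exp_series (\<lambda>k. a (m + Suc k)) (t + x))
        (at (t + x))"
      by (rule exp_series_deriv[OF geom_bounded_shift[OF a]])
    then show ?thesis
      unfolding D_def by (simp add: add.commute[of t] DERIV_shift)
  qed
  let ?T = "\<bar>t\<bar> + \<bar>u\<bar>"
  have "(\<lambda>n. exp_series a (t + u) - (\<Sum>m<n. D m 0 / fact m * u ^ m)) \<longlonglongrightarrow> 0"
  proof (rule Lim_null_comparison[OF always_eventually])
    show "\<forall>n. norm (exp_series a (t + u) - (\<Sum>m<n. D m 0 / fact m * u ^ m)) \<le>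
        C * exp (R * ?T) * ((R * \<bar>u\<bar>) ^ n / fact n)"
    proof
      fix n
      obtain x where x: "\<bar>x\<bar> \<le> \<bar>u\<bar>"
        and eq: "D 0 u = (\<Sum>m<n. D m 0 / fact m * u ^ m) + D n x / fact n * u ^ n"
        using Maclaurin_all_le[of D "D 0" u n, OF refl] der by auto
      have "\<bar>D n x\<bar> \<le> C * R ^ n * exp (R * ?T)"
        unfolding D_def by (rule exp_series_shift_bound[OF a]) (use x in auto)
      then have "\<bar>D n x\<bar> * (\<bar>u\<bar> ^ n / fact n) \<le> C * R ^ n * exp (R * ?T) * (\<bar>u\<bar> ^ n / fact n)"
        by (rule mult_right_mono) simp
      then show "norm (exp_series a (t + u) - (\<Sum>m<n. D m 0 / fact m * u ^ m)) \<le>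
        C * exp (R * ?T) * ((R * \<bar>u\<bar>) ^ n / fact n)"
        using eq by (simp add: D_def abs_mult power_abs power_mult_distrib mult_ac)
    qed
    have "(\<lambda>n. (R * \<bar>u\<bar>) ^ n / fact n) \<longlonglongrightarrow> 0"
      using summable_exp[of "R * \<bar>u\<bar>"] by (auto dest!: summable_LIMSEQ_zero simp: divide_inverse mult_ac)
    then show "(\<lambda>n. C * exp (R * ?T) * ((R * \<bar>u\<bar>) ^ n / fact n)) \<longlonglongrightarrow> 0"
      by (intro tendsto_mult_right_zero)
  qed
  from tendsto_diff[OF tendsto_const[of "exp_series a (t + u)"] this]
  have "(\<lambda>n. \<Sum>m<n. D m 0 / fact m * u ^ m) \<longlonglongrightarrow> exp_series a (t + u)"
    by simp
  then have "(\<lambda>m. D m 0 / fact m * u ^ m) sums exp_series a (t + u)"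
    by (simp only: sums_def)
  from sums_unique[OF this] show ?thesis
    by (simp add: exp_series_def[of "\<lambda>m. exp_series (\<lambda>k. a (m + k)) t"] D_def)
qed

text \<open>The local error of the backward Euler step. The backward form is the one to which a minimum
principle for the generator applies.\<close>

lemma exp_series_taylor2:
  assumes a: "geom_bounded C R a" and "0 \<le> t" "0 \<le> h" "t + h \<le> T"
  shows "\<bar>exp_series a t - exp_series a (t + h) + h * exp_series (\<lambda>k. a (Suc k)) (t + h)\<bar>
    \<le> C * R ^ 2 * exp (R * T) * h ^ 2"
proof (cases "h = 0")
  case False
  then have "h > 0" using assms by simp
  have d1: "(exp_series a has_real_derivative exp_series (\<lambda>k. a (Suc k)) x) (at x)" for x
    by (rule exp_series_deriv[OF a])
  have d2: "(exp_series (\<lambda>k. a (Suc k)) has_real_derivative exp_series (\<lambda>k. a (2 + k)) x) (at x)" for x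
    using exp_series_deriv[OF geom_bounded_shift[OF a, of 1]] by (simp add: numeral_2_eq_2)
  obtain x where x: "t < x" "x < t + h"
    and eq1: "exp_series a (t + h) - exp_series a t = h * exp_series (\<lambda>k. a (Suc k)) x"
    using MVT2[of t "t + h" "exp_series a"] d1 \<open>h > 0\<close> by auto
  obtain y where y: "x < y" "y < t + h"
    and eq2: "exp_series (\<lambda>k. a (Suc k)) (t + h) - exp_series (\<lambda>k. a (Suc k)) x
      = (t + h - x) * exp_series (\<lambda>k. a (2 + k)) y"
    using MVT2[of x "t + h" "exp_series (\<lambda>k. a (Suc k))"] d2 x by blast
  have B: "\<bar>exp_series (\<lambda>k. a (2 + k)) y\<bar> \<le> C * R ^ 2 * exp (R * T)"
    by (rule exp_series_shift_bound[OF a]) (use x y assms in auto)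
  have "exp_series a t - exp_series a (t + h) + h * exp_series (\<lambda>k. a (Suc k)) (t + h)
      = h * ((t + h - x) * exp_series (\<lambda>k. a (2 + k)) y)"
    unfolding eq2[symmetric] using eq1 by (simp add: algebra_simps)
  also have "\<bar>\<dots>\<bar> = h * (t + h - x) * \<bar>exp_series (\<lambda>k. a (2 + k)) y\<bar>"
    using x \<open>h > 0\<close> by (simp add: abs_mult)
  also have "\<dots> \<le> h * h * (C * R ^ 2 * exp (R * T))"
    by (intro mult_mono B mult_left_mono) (use x \<open>h > 0\<close> in auto)
  finally show ?thesis by (simp add: power2_eq_square mult_ac)
qed simp

text \<open>The bound depends on the sequence only through \<open>C\<close> and \<open>R\<close>; later it is
uniform over all configurations.\<close>

lemma exp_series_partial_sum:
  assumes a: "geom_bounded C R a" and t: "\<bar>t\<bar> \<le> T"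
  shows "\<bar>exp_series a t - (\<Sum>k<n. a k / fact k * t ^ k)\<bar>
    \<le> C * (exp (R * T) - (\<Sum>k<n. (R * T) ^ k / fact k))"
proof -
  let ?f = "\<lambda>k. a k / fact k * t ^ k" and ?g = "\<lambda>k. C * ((R * T) ^ k / fact k)"
  have le: "\<bar>?f k\<bar> \<le> ?g k" for k
  proof -
    have "(R * \<bar>t\<bar>) ^ k \<le> (R * T) ^ k"
      using t geom_boundedD(2)[OF a] by (intro power_mono mult_left_mono) auto
    then have "C * ((R * \<bar>t\<bar>) ^ k / fact k) \<le> ?g k"
      by (intro mult_left_mono divide_right_mono) (auto intro: geom_bounded_nonneg[OF a])
    then show ?thesis using geom_bounded_term[OF a, of k t] by linarith
  qed
  have f: "?f sums exp_series a t" by (rule exp_series_sums[OF a])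
  have g: "?g sums (C * exp (R * T))" by (rule exp_sums)
  have f': "(\<lambda>k. ?f (k + n)) sums (exp_series a t - (\<Sum>k<n. ?f k))"
    using sums_iff_shift[of ?f n "exp_series a t - (\<Sum>k<n. ?f k)"] f by simp
  have g': "(\<lambda>k. ?g (k + n)) sums (C * exp (R * T) - (\<Sum>k<n. ?g k))"
    using sums_iff_shift[of ?g n "C * exp (R * T) - (\<Sum>k<n. ?g k)"] g by simp
  have s: "summable (\<lambda>k. \<bar>?f (k + n)\<bar>)"
    using exp_series_abs_summable[OF a, of t] by (subst summable_iff_shift)
  have "\<bar>exp_series a t - (\<Sum>k<n. ?f k)\<bar> = \<bar>\<Sum>k. ?f (k + n)\<bar>"
    by (simp only: sums_unique[OF f'])
  also have "\<dots> \<le> (\<Sum>k. \<bar>?f (k + n)\<bar>)"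
    by (rule summable_rabs[OF s])
  also have "\<dots> \<le> (\<Sum>k. ?g (k + n))"
    by (rule suminf_le[OF le s sums_summable[OF g']])
  also have "\<dots> = C * exp (R * T) - (\<Sum>k<n. ?g k)"
    by (rule sums_unique[OF g', symmetric])
  finally show ?thesis
    by (simp add: sum_distrib_left right_diff_distrib)
qed

lemma exp_partial_sum_tendsto:
  "(\<lambda>n. C * (exp x - (\<Sum>k<n. x ^ k / fact k))) \<longlonglongrightarrow> (0::real)"
proof -
  have "(\<lambda>n. \<Sum>k<n. x ^ k / fact k) \<longlonglongrightarrow> exp x"
    using exp_converges[of x] by (simp add: sums_def divide_inverse mult_ac)
  then have "(\<lambda>n. exp x - (\<Sum>k<n. x ^ k / fact k)) \<longlonglongrightarrow> exp x - exp x"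
    by (intro tendsto_diff tendsto_const)
  then show ?thesis by (intro tendsto_mult_right_zero) simp
qed

text \<open>The summation of local errors in Euler's method: an error of order \<open>h\<^sup>2\<close> in a
step of length \<open>h\<close> is negligible over \<open>T / h\<close> steps. Here
\<open>P t a\<close> reads "at time \<open>t\<close> the error is at most \<open>a\<close>".\<close>

lemma quadratic_error_accumulates:
  fixes P :: "real \<Rightarrow> real \<Rightarrow> bool"
  assumes "P 0 0" and "0 \<le> T"
    and step: "\<And>t h a. 0 \<le> t \<Longrightarrow> 0 \<le> h \<Longrightarrow> t + h \<le> T \<Longrightarrow> P t a \<Longrightarrow> P (t + h) (a + K * h ^ 2)"
  shows "\<exists>a. a \<longlonglongrightarrow> 0 \<and> (\<forall>n. P T (a n))"
proof (intro exI conjI allI)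
  define a where "a n = K * T ^ 2 / real (Suc n)" for n
  have "(\<lambda>n. K * T ^ 2 * inverse (real (Suc n))) \<longlonglongrightarrow> 0"
    by (intro tendsto_mult_right_zero LIMSEQ_inverse_real_of_nat)
  then show "a \<longlonglongrightarrow> 0" by (simp add: a_def[abs_def] divide_inverse)
  fix n
  define h where "h = T / real (Suc n)"
  have h: "0 \<le> h" "real (Suc n) * h = T"
    using \<open>0 \<le> T\<close> by (simp_all add: h_def del: of_nat_Suc)
  have "P (real m * h) (real m * (K * h ^ 2))" if "m \<le> Suc n" for m
    using that
  proof (induction m)
    case (Suc m)
    have eq: "real (Suc m) * x = real m * x + x" for x
      by (simp add: algebra_simps)
    have "real (Suc m) * h \<le> real (Suc n) * h"
      using Suc.prems h by (intro mult_right_mono) auto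
    then have "P (real m * h + h) (real m * (K * h ^ 2) + K * h ^ 2)"
      using Suc h by (intro step) (simp_all only: eq, simp_all)
    then show ?case by (simp only: eq)
  qed (use \<open>P 0 0\<close> in simp)
  from this[of "Suc n"] h have "P T (real (Suc n) * (K * h ^ 2))"
    by simp
  also have "real (Suc n) * (K * h ^ 2) = K * (real (Suc n) * h) * h"
    by (simp only: power2_eq_square mult_ac)
  also have "\<dots> = a n"
    unfolding h by (simp add: a_def h_def power2_eq_square)
  finally show "P T (a n)" .
qed

section \<open>Spin products and cylinder functions\<close>

definition spin_prod :: "('a \<Rightarrow> int) \<Rightarrow> 'a set \<Rightarrow> real" where
  "spin_prod \<eta> B = real_of_int (\<Prod>x\<in>B. \<eta> x)"

lemma spin_prod_empty [simp]: "spin_prod \<eta> {} = 1"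
  by (simp add: spin_prod_def)

lemma spin_prod_cong: "(\<And>x. x \<in> B \<Longrightarrow> \<eta> x = \<zeta> x) \<Longrightarrow> spin_prod \<eta> B = spin_prod \<zeta> B"
  by (simp add: spin_prod_def)

lemma configs_cases: "\<eta> \<in> configs V \<Longrightarrow> x \<in> V \<Longrightarrow> \<eta> x = -1 \<or> \<eta> x = 1"
  by (auto simp: PiE_def Pi_def)

lemma configs_square: "\<eta> \<in> configs V \<Longrightarrow> x \<in> V \<Longrightarrow> \<eta> x * \<eta> x = 1"
  using configs_cases by fastforce

lemma configs_flip: "\<eta> \<in> configs V \<Longrightarrow> x \<in> V \<Longrightarrow> \<eta>(x := - \<eta> x) \<in> configs V"
  using configs_cases[of \<eta> V x] by (auto simp: PiE_def Pi_def extensional_def)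

lemma configs_upd: "\<eta> \<in> configs V \<Longrightarrow> x \<in> V \<Longrightarrow> c \<in> {-1, 1} \<Longrightarrow> \<eta>(x := c) \<in> configs V"
  by (auto simp: PiE_def Pi_def extensional_def)

lemma spin_prod_abs:
  assumes "\<eta> \<in> configs V" "B \<in> Fpow V"
  shows "\<bar>spin_prod \<eta> B\<bar> = 1"
proof -
  have "\<bar>\<eta> x\<bar> = 1" if "x \<in> B" for x
  proof -
    have "x \<in> V" using assms(2) that by (auto simp: Fpow_def)
    then show ?thesis using configs_cases[OF assms(1), of x] by auto
  qed
  then have "\<bar>\<Prod>x\<in>B. \<eta> x\<bar> = 1" by (simp add: abs_prod)
  then show ?thesis unfolding spin_prod_def by (metis of_int_1 of_int_abs)
qed

text \<open>The finite linear combinations of evaluations \<open>M \<mapsto> M B\<close>, as functionals on all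
functions of finite sets. Applied to \<open>spin_prod \<eta>\<close> they give exactly the cylinder
functions of \<open>\<eta>\<close>, applied to the moments of a measure the expectations of these
functions, and applied to the dual flow their evolution; one functional serves for all three.\<close>

inductive moment_comb :: "'a set \<Rightarrow> (('a set \<Rightarrow> real) \<Rightarrow> real) \<Rightarrow> bool" for V where
  zero: "moment_comb V (\<lambda>M. 0)"
| add_term: "B \<in> Fpow V \<Longrightarrow> moment_comb V \<phi> \<Longrightarrow> moment_comb V (\<lambda>M. c * M B + \<phi> M)"

lemma moment_comb_eval: "B \<in> Fpow V \<Longrightarrow> moment_comb V (\<lambda>M. M B)"
  using moment_comb.add_term[OF _ moment_comb.zero, of B V 1] by simp

lemma moment_comb_add:
  "moment_comb V \<phi> \<Longrightarrow> moment_comb V \<psi> \<Longrightarrow> moment_comb V (\<lambda>M. \<phi> M + \<psi> M)"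
proof (induction rule: moment_comb.induct)
  case (add_term B \<phi> c)
  from moment_comb.add_term[OF add_term.hyps(1) add_term.IH[OF add_term.prems], of c]
  show ?case by (simp add: add.assoc)
qed simp

lemma moment_comb_cmult: "moment_comb V \<phi> \<Longrightarrow> moment_comb V (\<lambda>M. a * \<phi> M)"
proof (induction rule: moment_comb.induct)
  case (add_term B \<phi> c)
  from moment_comb.add_term[OF add_term.hyps(1) add_term.IH, of "a * c"]
  show ?case by (simp add: algebra_simps)
qed (simp add: moment_comb.zero)

lemma moment_comb_diff:
  "moment_comb V \<phi> \<Longrightarrow> moment_comb V \<psi> \<Longrightarrow> moment_comb V (\<lambda>M. \<phi> M - \<psi> M)"
  using moment_comb_add[OF _ moment_comb_cmult[of V \<psi> "-1"], of \<phi>] by simp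

lemma moment_comb_const: "moment_comb V (\<lambda>M. a * M {})"
  by (intro moment_comb_cmult moment_comb_eval) (simp add: Fpow_def)

lemma moment_comb_sum:
  "(\<And>i. i \<in> I \<Longrightarrow> moment_comb V (\<phi> i)) \<Longrightarrow> moment_comb V (\<lambda>M. \<Sum>i\<in>I. \<phi> i M)"
proof (induction I rule: infinite_finite_induct)
  case (insert i I)
  then show ?case using moment_comb_add[of V "\<phi> i" "\<lambda>M. \<Sum>i\<in>I. \<phi> i M"] by simp
qed (auto intro: moment_comb.zero)

lemma moment_comb_cong:
  "moment_comb V \<phi> \<Longrightarrow> (\<And>B. B \<in> Fpow V \<Longrightarrow> M B = N B) \<Longrightarrow> \<phi> M = \<phi> N"
  by (induction rule: moment_comb.induct) auto

lemma moment_comb_linear: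
  "moment_comb V \<phi> \<Longrightarrow> \<phi> (\<lambda>B. a * M B + b * N B) = a * \<phi> M + b * \<phi> N"
  by (induction rule: moment_comb.induct) (auto simp: algebra_simps)

lemma moment_comb_scale:
  "moment_comb V \<phi> \<Longrightarrow> \<phi> (\<lambda>B. a * M B) = a * \<phi> M"
  using moment_comb_linear[of V \<phi> a M 0 M] by simp

lemma moment_comb_tendsto:
  "moment_comb V \<phi> \<Longrightarrow> (\<And>B. B \<in> Fpow V \<Longrightarrow> ((\<lambda>i. M i B) \<longlongrightarrow> N B) F)
    \<Longrightarrow> ((\<lambda>i. \<phi> (M i)) \<longlongrightarrow> \<phi> N) F"
  by (induction rule: moment_comb.induct) (auto intro!: tendsto_intros)

lemma moment_comb_sums:
  "moment_comb V \<phi> \<Longrightarrow> (\<And>B. B \<in> Fpow V \<Longrightarrow> (\<lambda>i. M i B) sums N B)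
    \<Longrightarrow> (\<lambda>i. \<phi> (M i)) sums \<phi> N"
  by (induction rule: moment_comb.induct) (auto intro!: sums_add sums_mult)

lemma moment_comb_integral:
  assumes "moment_comb V \<phi>" "\<And>B. B \<in> Fpow V \<Longrightarrow> integrable \<mu> (\<lambda>\<omega>. M \<omega> B)"
  shows "integrable \<mu> (\<lambda>\<omega>. \<phi> (M \<omega>)) \<and> (\<integral>\<omega>. \<phi> (M \<omega>) \<partial>\<mu>) = \<phi> (\<lambda>B. \<integral>\<omega>. M \<omega> B \<partial>\<mu>)"
  using assms by (induction rule: moment_comb.induct) auto

text \<open>Powers of the dual generator are bounded only on sets of bounded size, since its norm grows with the
number of walks.\<close>

definition bounded_upto :: "'a set \<Rightarrow> nat \<Rightarrow> real \<Rightarrow> ('a set \<Rightarrow> real) \<Rightarrow> bool" where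
  "bounded_upto V N K M \<longleftrightarrow> (\<forall>B\<in>Fpow V. card B \<le> N \<longrightarrow> \<bar>M B\<bar> \<le> K)"

lemma moment_comb_bounded:
  assumes "moment_comb V \<phi>"
  shows "\<exists>N C. 0 \<le> C \<and> (\<forall>M K. bounded_upto V N K M \<longrightarrow> \<bar>\<phi> M\<bar> \<le> C * K)"
  using assms
proof (induction rule: moment_comb.induct)
  case zero
  show ?case by (rule exI[of _ 0]) (auto intro!: exI[of _ 0])
next
  case (add_term B \<phi> c)
  then obtain N C where C: "0 \<le> C" "\<And>M K. bounded_upto V N K M \<Longrightarrow> \<bar>\<phi> M\<bar> \<le> C * K" by blast
  show ?case
  proof (intro exI conjI allI impI)
    show "0 \<le> C + \<bar>c\<bar>" using C by simp
    fix M K assume "bounded_upto V (max N (card B)) K M"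
    then have "bounded_upto V N K M" "\<bar>M B\<bar> \<le> K"
      using add_term.hyps(1) by (auto simp: bounded_upto_def)
    then have "\<bar>\<phi> M\<bar> \<le> C * K" "\<bar>c * M B\<bar> \<le> \<bar>c\<bar> * K"
      using C by (auto simp: abs_mult mult_left_mono)
    then show "\<bar>c * M B + \<phi> M\<bar> \<le> (C + \<bar>c\<bar>) * K" by (simp add: algebra_simps)
  qed
qed

lemma moment_comb_finite_support:
  assumes "moment_comb V \<phi>"
  shows "\<exists>A\<in>Fpow V. \<forall>M N. (\<forall>B\<in>Fpow A. M B = N B) \<longrightarrow> \<phi> M = \<phi> N"
  using assms
proof (induction rule: moment_comb.induct)
  case zero
  show ?case by (auto simp: Fpow_def)
next
  case (add_term B \<phi> c)
  then obtain A where A: "A \<in> Fpow V"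
    "\<And>M N. (\<forall>B\<in>Fpow A. M B = N B) \<Longrightarrow> \<phi> M = \<phi> N" by blast
  have "A \<union> B \<in> Fpow V" using A(1) add_term.hyps(1) by (auto simp: Fpow_def)
  moreover have "c * M B + \<phi> M = c * N B + \<phi> N" if "\<forall>D\<in>Fpow (A \<union> B). M D = N D" for M N
  proof -
    have "B \<in> Fpow (A \<union> B)" using add_term.hyps(1) by (auto simp: Fpow_def)
    then have "M B = N B" using that by blast
    moreover have "\<phi> M = \<phi> N"
      by (rule A(2)) (use that in \<open>auto simp: Fpow_def\<close>)
    ultimately show ?thesis by simp
  qed
  ultimately show ?case by blast
qed

lemma moment_comb_support:
  assumes "moment_comb V \<phi>"
  shows "\<exists>A\<in>Fpow V. \<forall>\<eta> \<zeta>. (\<forall>x\<in>A. \<eta> x = \<zeta> x) \<longrightarrow> \<phi> (spin_prod \<eta>) = \<phi> (spin_prod \<zeta>)"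
proof -
  obtain A where A: "A \<in> Fpow V" "\<forall>M N. (\<forall>B\<in>Fpow A. M B = N B) \<longrightarrow> \<phi> M = \<phi> N"
    using moment_comb_finite_support[OF assms] by blast
  have "\<phi> (spin_prod \<eta>) = \<phi> (spin_prod \<zeta>)" if "\<forall>x\<in>A. \<eta> x = \<zeta> x" for \<eta> \<zeta>
    by (intro A(2)[rule_format] spin_prod_cong) (use that in \<open>auto simp: Fpow_def\<close>)
  with A(1) show ?thesis by blast
qed

lemma finite_spin_patterns:
  assumes "A \<in> Fpow V"
  shows "finite ((\<lambda>\<eta>. restrict \<eta> A) ` configs V)"
  by (rule finite_subset[of _ "A \<rightarrow>\<^sub>E {-1, 1}"])
    (use assms in \<open>auto simp: Fpow_def intro!: finite_PiE\<close>)

lemma moment_comb_finite_range: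
  assumes "moment_comb V \<phi>"
  shows "finite ((\<lambda>\<eta>. \<phi> (spin_prod \<eta>)) ` configs V)"
proof -
  obtain A where A: "A \<in> Fpow V"
    "\<And>\<eta> \<zeta>. (\<forall>x\<in>A. \<eta> x = \<zeta> x) \<longrightarrow> \<phi> (spin_prod \<eta>) = \<phi> (spin_prod \<zeta>)"
    using moment_comb_support[OF assms] by blast
  have "\<phi> (spin_prod \<eta>) = \<phi> (spin_prod (restrict \<eta> A))" for \<eta>
    using A(2)[of \<eta> "restrict \<eta> A"] by simp
  then have "(\<lambda>\<eta>. \<phi> (spin_prod \<eta>)) ` configs V =
      (\<lambda>\<zeta>. \<phi> (spin_prod \<zeta>)) ` (\<lambda>\<eta>. restrict \<eta> A) ` configs V"
    by (simp add: image_image)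
  with finite_spin_patterns[OF A(1)] show ?thesis by simp
qed

lemma configs_nonempty: "configs V \<noteq> {}"
  by (auto simp: PiE_eq_empty_iff)

text \<open>A cylinder function attains its minimum since it takes finitely many values.\<close>

lemma moment_comb_argmin:
  assumes "moment_comb V \<phi>"
  obtains \<eta> where "\<eta> \<in> configs V" "\<And>\<zeta>. \<zeta> \<in> configs V \<Longrightarrow> \<phi> (spin_prod \<eta>) \<le> \<phi> (spin_prod \<zeta>)"
proof -
  let ?R = "(\<lambda>\<eta>. \<phi> (spin_prod \<eta>)) ` configs V"
  have fin: "finite ?R" and ne: "?R \<noteq> {}"
    using moment_comb_finite_range[OF assms] configs_nonempty by auto
  from Min_in[OF fin ne] obtain \<eta> where "\<eta> \<in> configs V" "Min ?R = \<phi> (spin_prod \<eta>)" by auto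
  moreover have "Min ?R \<le> \<phi> (spin_prod \<zeta>)" if "\<zeta> \<in> configs V" for \<zeta>
    using fin that by (intro Min_le) auto
  ultimately show ?thesis using that by simp
qed

lemma spin_prod_sym_diff:
  assumes "\<eta> \<in> configs V" "B \<in> Fpow V" "x \<in> V"
  shows "spin_prod \<eta> (if x \<in> B then B - {x} else insert x B) = of_int (\<eta> x) * spin_prod \<eta> B"
proof (cases "x \<in> B")
  case True
  then have "spin_prod \<eta> B = of_int (\<eta> x) * spin_prod \<eta> (B - {x})"
    using assms by (auto simp: spin_prod_def Fpow_def prod.remove)
  then show ?thesis
    using True configs_square[OF assms(1,3)]
    by (simp flip: mult.assoc of_int_mult)
qed (use assms in \<open>auto simp: spin_prod_def Fpow_def\<close>)

text \<open>Multiplication by a spin maps \<open>spin_prod \<eta> B\<close> to the product over the symmetric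
difference of \<open>B\<close> and the site, because squares of spins are one.\<close>

lemma moment_comb_mult_spin:
  assumes "moment_comb V \<phi>" "x \<in> V"
  shows "\<exists>\<psi>. moment_comb V \<psi> \<and> (\<forall>\<eta>\<in>configs V. \<psi> (spin_prod \<eta>) = of_int (\<eta> x) * \<phi> (spin_prod \<eta>))"
  using assms(1)
proof (induction rule: moment_comb.induct)
  case zero
  show ?case using moment_comb.zero by fastforce
next
  case (add_term B \<phi> c)
  then obtain \<psi> where \<psi>: "moment_comb V \<psi>"
    "\<forall>\<eta>\<in>configs V. \<psi> (spin_prod \<eta>) = of_int (\<eta> x) * \<phi> (spin_prod \<eta>)" by blast
  let ?B = "if x \<in> B then B - {x} else insert x B"
  have "?B \<in> Fpow V" using add_term.hyps(1) assms(2) by (auto simp: Fpow_def)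
  from moment_comb.add_term[OF this \<psi>(1), of c] spin_prod_sym_diff[OF _ add_term.hyps(1) assms(2)] \<psi>(2)
  show ?case by (intro exI[of _ "\<lambda>M. c * M ?B + \<psi> M"]) (auto simp: algebra_simps)
qed

text \<open>The Fourier--Walsh expansion, one site at a time: a function of the spin at \<open>x\<close> is half
the sum of its two values plus half their difference times the spin.\<close>

lemma cylinder_fun_moment_comb:
  assumes "f \<in> cylinder_funs V"
  shows "\<exists>\<phi>. moment_comb V \<phi> \<and> (\<forall>\<eta>\<in>configs V. f \<eta> = \<phi> (spin_prod \<eta>))"
proof -
  obtain A where A: "finite A" "A \<subseteq> V"
    "\<forall>\<eta>\<in>configs V. \<forall>\<zeta>\<in>configs V. (\<forall>x\<in>A. \<eta> x = \<zeta> x) \<longrightarrow> f \<eta> = f \<zeta>"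
    using assms by (auto simp: cylinder_funs_def)
  have "\<exists>\<phi>. moment_comb V \<phi> \<and> (\<forall>\<eta>\<in>configs V. f \<eta> = \<phi> (spin_prod \<eta>))"
    using A
  proof (induction A arbitrary: f rule: finite_induct)
    case empty
    obtain \<zeta> where "\<zeta> \<in> configs V" using configs_nonempty[of V] by (meson ex_in_conv)
    then have "f \<eta> = f \<zeta> * spin_prod \<eta> {}" if "\<eta> \<in> configs V" for \<eta>
      using empty.prems(2)[rule_format, OF that, of \<zeta>] by simp
    then show ?case by (intro exI[of _ "\<lambda>M. f \<zeta> * M {}"]) (simp add: moment_comb_const)
  next
    case (insert x A)
    let ?p = "\<lambda>\<eta>. f (\<eta>(x := 1))" and ?m = "\<lambda>\<eta>. f (\<eta>(x := -1))"
    have x: "x \<in> V" and "A \<subseteq> V" using insert.prems(1) by auto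
    note IH = insert.IH[OF \<open>A \<subseteq> V\<close>]
    have "\<forall>\<eta>\<in>configs V. \<forall>\<zeta>\<in>configs V. (\<forall>y\<in>A. \<eta> y = \<zeta> y) \<longrightarrow> ?p \<eta> = ?p \<zeta>"
      using configs_upd[OF _ x, of _ 1] by (intro ballI impI insert.prems(2)[rule_format]) auto
    from IH[OF this] obtain \<phi> where \<phi>: "moment_comb V \<phi>" "\<forall>\<eta>\<in>configs V. ?p \<eta> = \<phi> (spin_prod \<eta>)"
      by blast
    have "\<forall>\<eta>\<in>configs V. \<forall>\<zeta>\<in>configs V. (\<forall>y\<in>A. \<eta> y = \<zeta> y) \<longrightarrow> ?m \<eta> = ?m \<zeta>"
      using configs_upd[OF _ x, of _ "-1"] by (intro ballI impI insert.prems(2)[rule_format]) auto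
    from IH[OF this] obtain \<psi> where \<psi>: "moment_comb V \<psi>" "\<forall>\<eta>\<in>configs V. ?m \<eta> = \<psi> (spin_prod \<eta>)"
      by blast
    obtain \<theta> where \<theta>: "moment_comb V \<theta>"
      "\<forall>\<eta>\<in>configs V. \<theta> (spin_prod \<eta>) = of_int (\<eta> x) * (\<phi> (spin_prod \<eta>) - \<psi> (spin_prod \<eta>))"
      using moment_comb_mult_spin[OF moment_comb_diff[OF \<phi>(1) \<psi>(1)] x] by blast
    have "f \<eta> = (1/2) * ((\<phi> (spin_prod \<eta>) + \<psi> (spin_prod \<eta>)) + \<theta> (spin_prod \<eta>))"
      if \<eta>: "\<eta> \<in> configs V" for \<eta>
    proof -
      have "f \<eta> = (if \<eta> x = 1 then ?p \<eta> else ?m \<eta>)"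
        using configs_cases[OF \<eta> x] by (auto simp: fun_upd_idem)
      then show ?thesis
        using configs_cases[OF \<eta> x] \<phi>(2) \<psi>(2) \<theta>(2) \<eta> by (auto simp: field_simps)
    qed
    moreover have "moment_comb V (\<lambda>M. (1/2) * ((\<phi> M + \<psi> M) + \<theta> M))"
      by (intro moment_comb_cmult moment_comb_add \<phi>(1) \<psi>(1) \<theta>(1))
    ultimately show ?case by (intro exI conjI) auto
  qed
  then show ?thesis by blast
qed

section \<open>Duality with annihilating signed walks\<close>

locale loc_finite_graph =
  fixes V :: "'a set" and E :: "'a set set"
  assumes graph: "locally_finite_graph V E"
begin

lemma finite_nbrs: "x \<in> V \<Longrightarrow> finite (nbrs E x)"
  and deg_pos: "x \<in> V \<Longrightarrow> 0 < deg E x"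
  and nbrs_subset: "nbrs E x \<subseteq> V"
  using graph by (auto simp: locally_finite_graph_def nbrs_def dest!: bspec[of V _ x])

end

locale signed_graph = loc_finite_graph V E
  for V :: "'a set" and E :: "'a set set" +
  fixes s :: "'a set \<Rightarrow> int"
  assumes signs: "\<forall>e\<in>E. s e \<in> {-1, 1}"
begin

lemma nbrs_D:
  assumes "y \<in> nbrs E x"
  shows "x \<in> V" "y \<in> V" "y \<noteq> x" "\<bar>s {x, y}\<bar> = 1"
proof -
  have e: "{x, y} \<in> E" using assms by (simp add: nbrs_def)
  then have "{x, y} \<subseteq> V \<and> card {x, y} = 2"
    using graph by (auto simp: locally_finite_graph_def)
  then show "x \<in> V" "y \<in> V" "y \<noteq> x" by (auto simp: card_insert_if split: if_splits)
  show "\<bar>s {x, y}\<bar> = 1" using signs e by fastforce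
qed

text \<open>A walk at \<open>x\<close> jumps to a uniform neighbour \<open>y\<close>, the sign of the edge is
collected, and two walks at the same site annihilate each other: this is the symmetric difference.\<close>

definition dual_gen :: "('a set \<Rightarrow> real) \<Rightarrow> 'a set \<Rightarrow> real" where
  "dual_gen M B =
     (\<Sum>x\<in>B. (\<Sum>y\<in>nbrs E x. of_int (s {x, y}) * M (sym_diff B {x, y})) / real (deg E x))
     - real (card B) * M B"

text \<open>Annihilation makes the number of walks nonincreasing, which is what bounds the generator.\<close>

lemma fin_subset_step:
  assumes "B \<in> Fpow V" "x \<in> B" "y \<in> nbrs E x"
  shows "sym_diff B {x, y} \<in> Fpow V" "card (sym_diff B {x, y}) \<le> card B"
proof -
  have fin: "finite B" "B \<subseteq> V" using assms by (auto simp: Fpow_def)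
  have y: "y \<in> V" "y \<noteq> x" using nbrs_D[OF assms(3)] by auto
  show "sym_diff B {x, y} \<in> Fpow V"
    using fin y assms(2) by (auto simp: Fpow_def)
  show "card (sym_diff B {x, y}) \<le> card B"
  proof (cases "y \<in> B")
    case True
    then have "sym_diff B {x, y} \<subseteq> B" using assms by auto
    then show ?thesis using fin by (simp add: card_mono)
  next
    case False
    then have "sym_diff B {x, y} = insert y (B - {x})" using assms y by auto
    then have "card (sym_diff B {x, y}) = Suc (card (B - {x}))" using fin False by simp
    also have "\<dots> = card B" by (rule card_Suc_Diff1[OF fin(1) assms(2)])
    finally show ?thesis by simp
  qed
qed

text \<open>After adding \<open>N\<close> times the identity, only averages of moments over jumps of at most
\<open>N\<close> walks and a nonnegative multiple of the identity are left. This sharp bound, and not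
only the cruder \<open>2 * N\<close>, makes the Neumann series of the resolvent converge.\<close>

lemma dual_gen_plus_bound:
  assumes M: "bounded_upto V N K M" and B: "B \<in> Fpow V" "card B \<le> N"
  shows "\<bar>dual_gen M B + real N * M B\<bar> \<le> real N * K"
proof -
  have fin: "finite B" "B \<subseteq> V" using B by (auto simp: Fpow_def)
  have K: "\<bar>M B\<bar> \<le> K" using M B by (simp add: bounded_upto_def)
  have avg: "\<bar>(\<Sum>y\<in>nbrs E x. of_int (s {x, y}) * M (sym_diff B {x, y})) / real (deg E x)\<bar> \<le> K"
    if x: "x \<in> B" for x
  proof -
    have "x \<in> V" using x fin by auto
    have "\<bar>of_int (s {x, y}) * M (sym_diff B {x, y})\<bar> \<le> K" if y: "y \<in> nbrs E x" for y
    proof -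
      have "\<bar>M (sym_diff B {x, y})\<bar> \<le> K"
        using M fin_subset_step[OF B(1) x y] B(2) by (auto simp: bounded_upto_def)
      moreover have "\<bar>real_of_int (s {x, y})\<bar> = 1"
        using nbrs_D(4)[OF y] by (metis of_int_1 of_int_abs)
      ultimately show ?thesis by (simp add: abs_mult)
    qed
    then have "\<bar>\<Sum>y\<in>nbrs E x. of_int (s {x, y}) * M (sym_diff B {x, y})\<bar> \<le> real (card (nbrs E x)) * K"
      by (intro order_trans[OF sum_abs] sum_bounded_above) auto
    then show ?thesis
      using deg_pos[OF \<open>x \<in> V\<close>] by (simp add: deg_def pos_divide_le_eq mult.commute[of K])
  qed
  let ?S = "\<Sum>x\<in>B. (\<Sum>y\<in>nbrs E x. of_int (s {x, y}) * M (sym_diff B {x, y})) / real (deg E x)"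
  have "\<bar>?S\<bar> \<le> real (card B) * K"
    using avg by (intro order_trans[OF sum_abs] sum_bounded_above) auto
  moreover have "\<bar>(real N - real (card B)) * M B\<bar> \<le> (real N - real (card B)) * K"
    using K B(2) by (simp add: abs_mult mult_left_mono)
  moreover have "dual_gen M B + real N * M B = ?S + (real N - real (card B)) * M B"
    by (simp add: dual_gen_def algebra_simps)
  ultimately show ?thesis by (simp add: algebra_simps)
qed

lemma dual_gen_bounded:
  assumes M: "bounded_upto V N K M"
  shows "bounded_upto V N (2 * real N * K) (dual_gen M)"
  unfolding bounded_upto_def
proof (intro ballI impI)
  fix B assume B: "B \<in> Fpow V" "card B \<le> N"
  have "\<bar>M B\<bar> \<le> K" using M B by (simp add: bounded_upto_def)
  then have "\<bar>real N * M B\<bar> \<le> real N * K" by (simp add: abs_mult mult_left_mono)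
  then show "\<bar>dual_gen M B\<bar> \<le> 2 * real N * K"
    using dual_gen_plus_bound[OF M B] by linarith
qed

lemma dual_gen_power_bounded:
  assumes "bounded_upto V N K M"
  shows "bounded_upto V N ((2 * real N) ^ k * K) ((dual_gen ^^ k) M)"
proof (induction k)
  case (Suc k)
  from dual_gen_bounded[OF Suc] show ?case by (simp add: mult.assoc)
qed (use assms in simp)

lemma moment_comb_dual_gen_eval:
  assumes B: "B \<in> Fpow V"
  shows "moment_comb V (\<lambda>M. dual_gen M B)"
  unfolding dual_gen_def divide_inverse mult.commute[of _ "inverse _"]
  by (intro moment_comb_diff moment_comb_sum moment_comb_cmult moment_comb_eval fin_subset_step B)

lemma moment_comb_dual_gen:
  "moment_comb V \<phi> \<Longrightarrow> moment_comb V (\<lambda>M. \<phi> (dual_gen M))"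
  by (induction rule: moment_comb.induct)
    (intro moment_comb.zero moment_comb_add moment_comb_cmult moment_comb_dual_gen_eval; assumption)+

lemma moment_comb_dual_gen_power:
  assumes "moment_comb V \<phi>"
  shows "moment_comb V (\<lambda>M. \<phi> ((dual_gen ^^ k) M))"
proof (induction k)
  case (Suc k)
  from moment_comb_dual_gen[OF this] show ?case by (simp add: funpow_swap1)
qed (use assms in simp)

definition unit_bounded :: "('a set \<Rightarrow> real) \<Rightarrow> bool" where
  "unit_bounded M \<longleftrightarrow> (\<forall>B\<in>Fpow V. \<bar>M B\<bar> \<le> 1)"

lemma unit_bounded_spin_prod: "\<eta> \<in> configs V \<Longrightarrow> unit_bounded (spin_prod \<eta>)"
  by (simp add: unit_bounded_def spin_prod_abs)

lemma moment_comb_geom_bounded: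
  assumes "moment_comb V \<phi>"
  shows "\<exists>C R. \<forall>M. unit_bounded M \<longrightarrow> geom_bounded C R (\<lambda>k. \<phi> ((dual_gen ^^ k) M))"
proof -
  obtain N C where C: "\<And>M K. bounded_upto V N K M \<Longrightarrow> \<bar>\<phi> M\<bar> \<le> C * K"
    using moment_comb_bounded[OF assms] by blast
  have "geom_bounded C (2 * real N) (\<lambda>k. \<phi> ((dual_gen ^^ k) M))" if "unit_bounded M" for M
  proof -
    have "bounded_upto V N 1 M" using that by (simp add: unit_bounded_def bounded_upto_def)
    from C[OF dual_gen_power_bounded[OF this]] show ?thesis by (simp add: geom_bounded_def)
  qed
  then show ?thesis by blast
qed

text \<open>The exponential of \<open>t\<close> times the dual generator. On \<open>spin_prod \<eta>\<close> it
yields the moments at time \<open>t\<close> of the process started in \<open>\<eta>\<close>.\<close>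

definition flow :: "real \<Rightarrow> ('a set \<Rightarrow> real) \<Rightarrow> 'a set \<Rightarrow> real" where
  "flow t M B = exp_series (\<lambda>k. (dual_gen ^^ k) M B) t"

text \<open>Functionals in \<open>moment_comb\<close> see finitely many coordinates, so they commute with the
power series.\<close>

lemma moment_comb_flow:
  assumes "moment_comb V \<phi>" "unit_bounded M"
  shows "\<phi> (flow t M) = exp_series (\<lambda>k. \<phi> ((dual_gen ^^ k) M)) t"
proof -
  have "(\<lambda>k. \<phi> (\<lambda>B. (dual_gen ^^ k) M B / fact k * t ^ k)) sums \<phi> (flow t M)"
  proof (rule moment_comb_sums[OF assms(1)])
    fix B assume "B \<in> Fpow V"
    then obtain C R where "geom_bounded C R (\<lambda>k. (dual_gen ^^ k) M B)"
      using moment_comb_geom_bounded[OF moment_comb_eval] assms(2) by blast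
    from exp_series_sums[OF this] show "(\<lambda>k. (dual_gen ^^ k) M B / fact k * t ^ k) sums flow t M B"
      by (simp add: flow_def)
  qed
  moreover have "\<phi> (\<lambda>B. (dual_gen ^^ k) M B / fact k * t ^ k) = \<phi> ((dual_gen ^^ k) M) / fact k * t ^ k" for k
    using moment_comb_scale[OF assms(1), of "t ^ k / fact k" "(dual_gen ^^ k) M"] by (simp add: mult_ac)
  ultimately show ?thesis by (simp add: exp_series_def sums_iff)
qed

lemma flow_zero [simp]: "flow 0 M = M"
  by (simp add: flow_def fun_eq_iff)

lemma flow_add:
  assumes "unit_bounded M" "B \<in> Fpow V"
  shows "flow t (flow u M) B = flow (u + t) M B"
proof -
  have ev: "moment_comb V (\<lambda>M. M B)" by (rule moment_comb_eval[OF assms(2)])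
  obtain C R where a: "geom_bounded C R (\<lambda>k. (dual_gen ^^ k) M B)"
    using moment_comb_geom_bounded[OF ev] assms(1) by blast
  have "(dual_gen ^^ m) (flow u M) B = exp_series (\<lambda>k. (dual_gen ^^ (m + k)) M B) u" for m
    using moment_comb_flow[OF moment_comb_dual_gen_power[OF ev, of m] assms(1), of u]
    by (simp add: funpow_add)
  then show ?thesis
    unfolding exp_series_add[OF a] flow_def[of "u + t"] flow_def[of t] by simp
qed

lemma flow_stationary:
  assumes "moment_comb V \<phi>" "unit_bounded M" "\<And>B. B \<in> Fpow V \<Longrightarrow> dual_gen M B = 0"
  shows "\<phi> (flow t M) = \<phi> M"
proof -
  have "\<phi> ((dual_gen ^^ Suc k) M) = 0" for k
  proof -
    have "\<phi> ((dual_gen ^^ Suc k) M) = \<phi> ((dual_gen ^^ k) (dual_gen M))"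
      by (simp add: funpow_swap1)
    also have "\<dots> = \<phi> ((dual_gen ^^ k) (\<lambda>B. 0 * M B))"
      by (rule moment_comb_cong[OF moment_comb_dual_gen_power[OF assms(1)]]) (use assms(3) in simp)
    also have "\<dots> = 0"
      using moment_comb_scale[OF moment_comb_dual_gen_power[OF assms(1), of k], of 0 M] by simp
    finally show ?thesis .
  qed
  then show ?thesis
    unfolding moment_comb_flow[OF assms(1,2)] by (subst exp_series_const) simp_all
qed

definition flip_rate :: "'a \<Rightarrow> ('a \<Rightarrow> int) \<Rightarrow> real" where
  "flip_rate x \<eta> = 1 / real (deg E x) * (\<Sum>y\<in>nbrs E x. of_bool (\<eta> x * \<eta> y \<noteq> s {x, y}))"

lemma voter_op_flip_rate:
  "voter_op V E s f \<eta> = (\<Sum>\<^sub>\<infinity>x\<in>V. (f (\<eta>(x := - \<eta> x)) - f \<eta>) * flip_rate x \<eta>)"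
  by (simp add: voter_op_def flip_rate_def)

lemma flip_rate_nonneg: "0 \<le> flip_rate x \<eta>"
  unfolding flip_rate_def by (intro mult_nonneg_nonneg sum_nonneg) auto

text \<open>Duality for one site: a flip changes the sign of the product, and \<open>-2\<close> times the
indicator of a disagreement equals the signed product of the two spins minus one.\<close>

lemma flip_rate_dual:
  assumes \<eta>: "\<eta> \<in> configs V" and x: "x \<in> B" and B: "B \<in> Fpow V"
  shows "(spin_prod (\<eta>(x := - \<eta> x)) B - spin_prod \<eta> B) * flip_rate x \<eta> =
    (\<Sum>y\<in>nbrs E x. of_int (s {x, y}) * spin_prod \<eta> (sym_diff B {x, y})) / real (deg E x)
    - spin_prod \<eta> B"
proof -
  have fin: "finite B" "x \<in> V" using B x by (auto simp: Fpow_def)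
  have flip: "spin_prod (\<eta>(x := - \<eta> x)) B = - spin_prod \<eta> B"
    using fin x by (simp add: spin_prod_def prod.remove[of B x])
  have "- 2 * spin_prod \<eta> B * of_bool (\<eta> x * \<eta> y \<noteq> s {x, y}) =
      of_int (s {x, y}) * spin_prod \<eta> (sym_diff B {x, y}) - spin_prod \<eta> B"
    if y: "y \<in> nbrs E x" for y
  proof -
    have yV: "y \<in> V" "y \<noteq> x" using nbrs_D[OF y] by auto
    have B': "B - {x} \<in> Fpow V" using B by (auto simp: Fpow_def)
    have "sym_diff B {x, y} = (if y \<in> B - {x} then B - {x} - {y} else insert y (B - {x}))"
      using x yV by auto
    then have "spin_prod \<eta> (sym_diff B {x, y}) = of_int (\<eta> y) * (of_int (\<eta> x) * spin_prod \<eta> B)"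
      using spin_prod_sym_diff[OF \<eta> B' yV(1)] spin_prod_sym_diff[OF \<eta> B fin(2)] x by simp
    then show ?thesis
      using configs_cases[OF \<eta> yV(1)] configs_cases[OF \<eta> fin(2)] nbrs_D(4)[OF y]
      by (auto simp: abs_if split: if_splits)
  qed
  then have "(\<Sum>y\<in>nbrs E x. - 2 * spin_prod \<eta> B * of_bool (\<eta> x * \<eta> y \<noteq> s {x, y})) =
     (\<Sum>y\<in>nbrs E x. of_int (s {x, y}) * spin_prod \<eta> (sym_diff B {x, y})) - deg E x * spin_prod \<eta> B"
    by (simp add: sum_subtractf deg_def)
  then show ?thesis
    unfolding flip flip_rate_def using deg_pos[OF fin(2)]
    by (simp add: field_simps sum_distrib_left)
qed

lemma spin_prod_flip_outside: "x \<notin> B \<Longrightarrow> spin_prod (\<eta>(x := c)) B = spin_prod \<eta> B"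
  by (intro spin_prod_cong) auto

lemma finite_voter_op:
  assumes "moment_comb V \<phi>" "\<eta> \<in> configs V"
  shows "\<exists>A\<in>Fpow V. \<forall>D. finite D \<longrightarrow> A \<subseteq> D \<longrightarrow>
    (\<Sum>x\<in>D. (\<phi> (spin_prod (\<eta>(x := - \<eta> x))) - \<phi> (spin_prod \<eta>)) * flip_rate x \<eta>) = \<phi> (dual_gen (spin_prod \<eta>))"
  using assms(1)
proof (induction rule: moment_comb.induct)
  case zero
  show ?case by (auto simp: Fpow_def)
next
  case (add_term B \<phi> c)
  then obtain A where A: "A \<in> Fpow V"
    "\<And>D. finite D \<Longrightarrow> A \<subseteq> D \<Longrightarrow> (\<Sum>x\<in>D. (\<phi> (spin_prod (\<eta>(x := - \<eta> x))) - \<phi> (spin_prod \<eta>)) * flip_rate x \<eta>)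
        = \<phi> (dual_gen (spin_prod \<eta>))" by blast
  show ?case
  proof (intro bexI allI impI)
    show "A \<union> B \<in> Fpow V" using A(1) add_term.hyps(1) by (auto simp: Fpow_def)
    fix D assume D: "finite D" "A \<union> B \<subseteq> D"
    have "(\<Sum>x\<in>D. (spin_prod (\<eta>(x := - \<eta> x)) B - spin_prod \<eta> B) * flip_rate x \<eta>) =
        (\<Sum>x\<in>B. (spin_prod (\<eta>(x := - \<eta> x)) B - spin_prod \<eta> B) * flip_rate x \<eta>)"
      using D by (intro sum.mono_neutral_right) (auto simp: spin_prod_flip_outside)
    also have "\<dots> = dual_gen (spin_prod \<eta>) B"
      using flip_rate_dual[OF assms(2) _ add_term.hyps(1)]
      by (simp add: dual_gen_def sum_subtractf)
    finally have B: "(\<Sum>x\<in>D. (spin_prod (\<eta>(x := - \<eta> x)) B - spin_prod \<eta> B) * flip_rate x \<eta>) =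
      dual_gen (spin_prod \<eta>) B" .
    have "(c * spin_prod (\<eta>(x := - \<eta> x)) B + \<phi> (spin_prod (\<eta>(x := - \<eta> x))) -
          (c * spin_prod \<eta> B + \<phi> (spin_prod \<eta>))) * flip_rate x \<eta> =
        c * ((spin_prod (\<eta>(x := - \<eta> x)) B - spin_prod \<eta> B) * flip_rate x \<eta>) +
        (\<phi> (spin_prod (\<eta>(x := - \<eta> x))) - \<phi> (spin_prod \<eta>)) * flip_rate x \<eta>" for x
      by (simp add: algebra_simps)
    then show "(\<Sum>x\<in>D. (c * spin_prod (\<eta>(x := - \<eta> x)) B + \<phi> (spin_prod (\<eta>(x := - \<eta> x))) -
          (c * spin_prod \<eta> B + \<phi> (spin_prod \<eta>))) * flip_rate x \<eta>) =
        c * dual_gen (spin_prod \<eta>) B + \<phi> (dual_gen (spin_prod \<eta>))"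
      using A(2)[of D] D B by (simp add: sum.distrib flip: sum_distrib_left)
  qed
qed

text \<open>The duality relation between the voter model and the annihilating signed walks.\<close>

lemma voter_op_moment_comb:
  assumes "moment_comb V \<phi>" "\<eta> \<in> configs V"
  shows "voter_op V E s (\<lambda>\<zeta>. \<phi> (spin_prod \<zeta>)) \<eta> = \<phi> (dual_gen (spin_prod \<eta>))"
proof -
  obtain A where A: "A \<in> Fpow V" and A_eq: "\<And>D. finite D \<Longrightarrow> A \<subseteq> D \<Longrightarrow>
      (\<Sum>x\<in>D. (\<phi> (spin_prod (\<eta>(x := - \<eta> x))) - \<phi> (spin_prod \<eta>)) * flip_rate x \<eta>) = \<phi> (dual_gen (spin_prod \<eta>))"
    using finite_voter_op[OF assms] by blast
  obtain A' where A': "A' \<in> Fpow V"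
    "\<And>\<eta> \<zeta>. (\<forall>x\<in>A'. \<eta> x = \<zeta> x) \<longrightarrow> \<phi> (spin_prod \<eta>) = \<phi> (spin_prod \<zeta>)"
    using moment_comb_support[OF assms(1)] by blast
  have D: "finite (A \<union> A')" "A \<union> A' \<subseteq> V" using A A' by (auto simp: Fpow_def)
  have "\<phi> (spin_prod (\<eta>(x := - \<eta> x))) = \<phi> (spin_prod \<eta>)" if "x \<notin> A'" for x
    by (intro A'(2)[rule_format]) (use that in auto)
  then have "voter_op V E s (\<lambda>\<zeta>. \<phi> (spin_prod \<zeta>)) \<eta> =
    (\<Sum>\<^sub>\<infinity>x\<in>A \<union> A'. (\<phi> (spin_prod (\<eta>(x := - \<eta> x))) - \<phi> (spin_prod \<eta>)) * flip_rate x \<eta>)"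
    unfolding voter_op_flip_rate using D by (intro infsum_cong_neutral) auto
  then show ?thesis using A_eq[of "A \<union> A'"] D by simp
qed

lemma voter_op_cong:
  assumes "\<And>\<zeta>. \<zeta> \<in> configs V \<Longrightarrow> f \<zeta> = g \<zeta>" "\<eta> \<in> configs V"
  shows "voter_op V E s f \<eta> = voter_op V E s g \<eta>"
  unfolding voter_op_flip_rate
  by (rule infsum_cong) (simp add: assms configs_flip[OF assms(2)])

text \<open>The minimum principle: at a minimum every flip increases the function, and flip rates are
nonnegative.\<close>

lemma dual_gen_min_nonneg:
  assumes "moment_comb V \<phi>" "\<eta> \<in> configs V"
    and "\<And>\<zeta>. \<zeta> \<in> configs V \<Longrightarrow> \<phi> (spin_prod \<eta>) \<le> \<phi> (spin_prod \<zeta>)"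
  shows "0 \<le> \<phi> (dual_gen (spin_prod \<eta>))"
  unfolding voter_op_moment_comb[OF assms(1,2), symmetric] voter_op_flip_rate
  by (intro infsum_nonneg mult_nonneg_nonneg flip_rate_nonneg)
    (use assms(3) configs_flip[OF assms(2)] in simp)

end

section \<open>Positivity of the dual flow\<close>

text \<open>\<open>M\<close> passes for the moment function of a measure: the induced linear functional on
cylinder functions is positive. By \<open>moment_measure_exists\<close> there is such a measure.\<close>

definition positive_moments :: "'a set \<Rightarrow> ('a set \<Rightarrow> real) \<Rightarrow> bool" where
  "positive_moments V M \<longleftrightarrow>
    (\<forall>\<phi>. moment_comb V \<phi> \<longrightarrow> (\<forall>\<eta>\<in>configs V. 0 \<le> \<phi> (spin_prod \<eta>)) \<longrightarrow> 0 \<le> \<phi> M)"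

lemma positive_momentsD:
  "positive_moments V M \<Longrightarrow> moment_comb V \<phi> \<Longrightarrow> (\<And>\<eta>. \<eta> \<in> configs V \<Longrightarrow> 0 \<le> \<phi> (spin_prod \<eta>)) \<Longrightarrow> 0 \<le> \<phi> M"
  by (auto simp: positive_moments_def)

text \<open>Test with the nonnegative functions \<open>1 - spin_prod \<eta> B\<close> and
\<open>1 + spin_prod \<eta> B\<close>.\<close>

lemma positive_moments_abs:
  assumes "positive_moments V M" "B \<in> Fpow V"
  shows "\<bar>M B\<bar> \<le> M {}"
proof -
  have b: "spin_prod \<eta> B \<le> 1" "- 1 \<le> spin_prod \<eta> B" if "\<eta> \<in> configs V" for \<eta>
    using spin_prod_abs[OF that assms(2)] by linarith+
  have "0 \<le> 1 * M {} - M B"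
    by (rule positive_momentsD[OF assms(1)])
      (intro moment_comb_diff moment_comb_const moment_comb_eval assms(2), simp add: b)
  moreover have "0 \<le> 1 * M {} + M B"
    by (rule positive_momentsD[OF assms(1)])
      (intro moment_comb_add moment_comb_const moment_comb_eval assms(2), drule b(2), simp)
  ultimately show ?thesis by linarith
qed

context signed_graph
begin

text \<open>Let a nonnegative cylinder function evolve by the flow. The minimum principle shows that a backward
Euler step of length \<open>h\<close> does not lower the infimum over the configurations, and the
true evolution differs from this step by \<open>O(h\<^sup>2)\<close>. The evolved function is no
longer a cylinder function; its power series is truncated so that a minimizer exists.\<close>

lemma flow_positive:
  assumes \<eta>: "\<eta> \<in> configs V" and T: "0 \<le> T"
  shows "positive_moments V (flow T (spin_prod \<eta>))"
  unfolding positive_moments_def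
proof (intro allI impI)
  fix \<phi> assume \<phi>: "moment_comb V \<phi>" and nonneg: "\<forall>\<eta>\<in>configs V. 0 \<le> \<phi> (spin_prod \<eta>)"
  define a where "a \<zeta> = (\<lambda>k. \<phi> ((dual_gen ^^ k) (spin_prod \<zeta>)))" for \<zeta>
  obtain C R where "\<forall>M. unit_bounded M \<longrightarrow> geom_bounded C R (\<lambda>k. \<phi> ((dual_gen ^^ k) M))"
    using moment_comb_geom_bounded[OF \<phi>] by blast
  then have a: "geom_bounded C R (a \<zeta>)" if "\<zeta> \<in> configs V" for \<zeta>
    unfolding a_def using unit_bounded_spin_prod[OF that] by blast
  have a': "geom_bounded (C * R) R (\<lambda>k. a \<zeta> (Suc k))" if "\<zeta> \<in> configs V" for \<zeta>
    using geom_bounded_shift[OF a[OF that], of 1] by simp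
  define P where "P t b \<longleftrightarrow> (\<forall>\<zeta>\<in>configs V. - b \<le> exp_series (a \<zeta>) t)" for t b
  have step: "P (t + h) (b + C * R ^ 2 * exp (R * T) * h ^ 2)"
    if th: "0 \<le> t" "0 \<le> h" "t + h \<le> T" and P: "P t b" for t h b
    unfolding P_def
  proof
    fix \<zeta> assume \<zeta>: "\<zeta> \<in> configs V"
    let ?\<tau> = "t + h"
    define \<epsilon> where "\<epsilon> D n = D * (exp (R * T) - (\<Sum>k<n. (R * T) ^ k / fact k))" for D n
    have \<epsilon>: "\<epsilon> D \<longlonglongrightarrow> 0" for D
      unfolding \<epsilon>_def[abs_def] by (rule exp_partial_sum_tendsto)
    have "- (b + C * R ^ 2 * exp (R * T) * h ^ 2) - (2 * \<epsilon> C n + h * \<epsilon> (C * R) n) \<le> exp_series (a \<zeta>) ?\<tau>" for n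
    proof -
      define \<psi> where "\<psi> M = (\<Sum>k<n. ?\<tau> ^ k / fact k * \<phi> ((dual_gen ^^ k) M))" for M
      have \<psi>: "moment_comb V \<psi>"
        unfolding \<psi>_def[abs_def] by (intro moment_comb_sum moment_comb_cmult moment_comb_dual_gen_power \<phi>)
      obtain \<xi> where \<xi>: "\<xi> \<in> configs V" "\<And>\<zeta>. \<zeta> \<in> configs V \<Longrightarrow> \<psi> (spin_prod \<xi>) \<le> \<psi> (spin_prod \<zeta>)"
        using moment_comb_argmin[OF \<psi>] by blast
      have approx: "\<bar>exp_series (a \<zeta>) ?\<tau> - \<psi> (spin_prod \<zeta>)\<bar> \<le> \<epsilon> C n" if "\<zeta> \<in> configs V" for \<zeta>
        using exp_series_partial_sum[OF a[OF that], of ?\<tau> T n] th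
        by (simp add: \<psi>_def a_def \<epsilon>_def mult_ac)
      have approx': "\<bar>exp_series (\<lambda>k. a \<xi> (Suc k)) ?\<tau> - \<psi> (dual_gen (spin_prod \<xi>))\<bar> \<le> \<epsilon> (C * R) n"
        using exp_series_partial_sum[OF a'[OF \<xi>(1)], of ?\<tau> T n] th
        by (simp add: \<psi>_def a_def \<epsilon>_def mult_ac funpow_swap1)
      \<comment> \<open>At the minimizer of the truncated series its generator is nonnegative, so a backward
        Euler step does not lead below the minimum.\<close>
      have "0 \<le> h * \<psi> (dual_gen (spin_prod \<xi>))"
        using dual_gen_min_nonneg[OF \<psi> \<xi>] th by simp
      moreover have "h * \<psi> (dual_gen (spin_prod \<xi>)) \<le> h * (exp_series (\<lambda>k. a \<xi> (Suc k)) ?\<tau> + \<epsilon> (C * R) n)"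
        using approx' th by (intro mult_left_mono) auto
      moreover have "- b \<le> exp_series (a \<xi>) t"
        using P \<xi>(1) by (simp add: P_def)
      moreover have "\<bar>exp_series (a \<xi>) t - exp_series (a \<xi>) ?\<tau> + h * exp_series (\<lambda>k. a \<xi> (Suc k)) ?\<tau>\<bar>
          \<le> C * R ^ 2 * exp (R * T) * h ^ 2"
        by (rule exp_series_taylor2[OF a[OF \<xi>(1)] th])
      ultimately show ?thesis
        using approx[OF \<zeta>] approx[OF \<xi>(1)] \<xi>(2)[OF \<zeta>] by (simp add: distrib_left)
    qed
    moreover have "(\<lambda>n. - (b + C * R ^ 2 * exp (R * T) * h ^ 2) - (2 * \<epsilon> C n + h * \<epsilon> (C * R) n)) \<longlonglongrightarrow>
        - (b + C * R ^ 2 * exp (R * T) * h ^ 2) - (2 * 0 + h * 0)"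
      by (intro tendsto_intros \<epsilon>)
    ultimately show "- (b + C * R ^ 2 * exp (R * T) * h ^ 2) \<le> exp_series (a \<zeta>) ?\<tau>"
      by (intro LIMSEQ_le_const2[where a = "exp_series (a \<zeta>) ?\<tau>"]) auto
  qed
  have "P 0 0" using nonneg by (simp add: P_def a_def)
  then obtain b where b: "b \<longlonglongrightarrow> 0" "\<And>n. P T (b n)"
    using quadratic_error_accumulates[of P T "C * R ^ 2 * exp (R * T)"] T step by blast
  from b(1) have "(\<lambda>n. - b n) \<longlonglongrightarrow> - 0" by (rule tendsto_minus)
  then have "- 0 \<le> exp_series (a \<eta>) T"
    using b(2) \<eta> by (intro LIMSEQ_le_const2[where a = "exp_series (a \<eta>) T"]) (auto simp: P_def)
  then show "0 \<le> \<phi> (flow T (spin_prod \<eta>))"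
    by (simp add: moment_comb_flow[OF \<phi> unit_bounded_spin_prod[OF \<eta>]] a_def)
qed

lemma flow_empty: "flow t M {} = M {}"
  unfolding flow_def by (subst exp_series_const) (simp_all add: dual_gen_def)

end

section \<open>Cylinder functions are dense\<close>

lemma cylinder_open:
  assumes "\<eta> \<in> configs V" "finite A" "A \<subseteq> V"
  shows "openin (config_topology V) {\<zeta>\<in>configs V. \<forall>x\<in>A. \<zeta> x = \<eta> x}"
proof -
  let ?S = "\<lambda>x. if x \<in> A then {\<eta> x} else {-1, 1}"
  have "{\<zeta>\<in>configs V. \<forall>x\<in>A. \<zeta> x = \<eta> x} = PiE V ?S"
  proof (intro set_eqI iffI)
    fix \<zeta> assume "\<zeta> \<in> PiE V ?S"
    then have 1: "\<zeta> \<in> extensional V" "\<And>x. x \<in> V \<Longrightarrow> \<zeta> x \<in> ?S x" by (auto simp: PiE_def Pi_def)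
    have "\<zeta> x \<in> {-1, 1}" if "x \<in> V" for x
      using 1(2)[OF that] configs_cases[OF assms(1) that] by (auto split: if_splits)
    moreover have "\<zeta> x = \<eta> x" if "x \<in> A" for x
      using 1(2)[of x] that assms(3) by auto
    ultimately show "\<zeta> \<in> {\<zeta>\<in>configs V. \<forall>x\<in>A. \<zeta> x = \<eta> x}" using 1(1) by (simp add: PiE_def Pi_def)
  qed (auto simp: PiE_def Pi_def)
  moreover have "openin (config_topology V) (PiE V ?S)"
    unfolding config_topology_def openin_PiE_gen
  proof (intro disjI2 conjI ballI)
    show "finite {i \<in> V. ?S i \<noteq> topspace (discrete_topology {- 1, 1})}"
      by (rule finite_subset[OF _ assms(2)]) auto
    show "openin (discrete_topology {- 1, 1}) (?S x)" if "x \<in> V" for x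
      using configs_cases[OF assms(1) that] by auto
  qed
  ultimately show ?thesis by simp
qed

lemma compact_configs: "compact_space (config_topology V)"
  unfolding config_topology_def compact_space_product_topology
  by (simp add: compact_space_discrete_topology)

text \<open>The uniform limits of cylinder functions are continuous; together with \<open>conts_approx\<close>
they are all continuous functions.\<close>

lemma conts_if_approx:
  assumes "\<And>\<epsilon>. 0 < \<epsilon> \<Longrightarrow> \<exists>\<phi>. moment_comb V \<phi> \<and> (\<forall>\<eta>\<in>configs V. \<bar>f \<eta> - \<phi> (spin_prod \<eta>)\<bar> < \<epsilon>)"
  shows "f \<in> conts V"
proof -
  have "openin (config_topology V) {\<eta>\<in>configs V. f \<eta> \<in> U}" if "open U" for U
  proof (subst openin_subopen, intro ballI)
    fix \<eta> assume "\<eta> \<in> {\<eta>\<in>configs V. f \<eta> \<in> U}"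
    then have \<eta>: "\<eta> \<in> configs V" "f \<eta> \<in> U" by auto
    obtain e where e: "0 < e" "\<And>y. \<bar>y - f \<eta>\<bar> < e \<Longrightarrow> y \<in> U"
      using \<open>open U\<close> \<eta>(2) unfolding open_dist dist_real_def by blast
    obtain \<phi> where \<phi>: "moment_comb V \<phi>" "\<forall>\<eta>\<in>configs V. \<bar>f \<eta> - \<phi> (spin_prod \<eta>)\<bar> < e / 2"
      using assms[of "e / 2"] e(1) by auto
    obtain A where A: "A \<in> Fpow V"
      "\<forall>\<eta> \<zeta>. (\<forall>x\<in>A. \<eta> x = \<zeta> x) \<longrightarrow> \<phi> (spin_prod \<eta>) = \<phi> (spin_prod \<zeta>)"
      using moment_comb_support[OF \<phi>(1)] by blast
    show "\<exists>T. openin (config_topology V) T \<and> \<eta> \<in> T \<and> T \<subseteq> {\<eta>\<in>configs V. f \<eta> \<in> U}"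
    proof (intro exI conjI)
      show "openin (config_topology V) {\<zeta>\<in>configs V. \<forall>x\<in>A. \<zeta> x = \<eta> x}"
        using A(1) by (intro cylinder_open[OF \<eta>(1)]) (auto simp: Fpow_def)
      show "\<eta> \<in> {\<zeta>\<in>configs V. \<forall>x\<in>A. \<zeta> x = \<eta> x}" using \<eta> by simp
      show "{\<zeta>\<in>configs V. \<forall>x\<in>A. \<zeta> x = \<eta> x} \<subseteq> {\<eta>\<in>configs V. f \<eta> \<in> U}"
      proof
        fix \<zeta> assume "\<zeta> \<in> {\<zeta>\<in>configs V. \<forall>x\<in>A. \<zeta> x = \<eta> x}"
        then have \<zeta>: "\<zeta> \<in> configs V" "\<phi> (spin_prod \<zeta>) = \<phi> (spin_prod \<eta>)"
          using A(2)[rule_format, of \<zeta> \<eta>] by auto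
        have "\<bar>f \<zeta> - f \<eta>\<bar> < e"
          using bspec[OF \<phi>(2) \<zeta>(1)] bspec[OF \<phi>(2) \<eta>(1)] unfolding \<zeta>(2) by linarith
        then show "\<zeta> \<in> {\<eta>\<in>configs V. f \<eta> \<in> U}" using e(2) \<zeta>(1) by simp
      qed
    qed
  qed
  then show ?thesis by (simp add: conts_def continuous_map_def)
qed

lemma cylinder_fun_continuous:
  assumes "f \<in> cylinder_funs V"
  shows "f \<in> conts V"
proof (rule conts_if_approx)
  fix \<epsilon> :: real assume "0 < \<epsilon>"
  then show "\<exists>\<phi>. moment_comb V \<phi> \<and> (\<forall>\<eta>\<in>configs V. \<bar>f \<eta> - \<phi> (spin_prod \<eta>)\<bar> < \<epsilon>)"
    using cylinder_fun_moment_comb[OF assms] by fastforce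
qed

lemma moment_comb_cylinder:
  assumes "moment_comb V \<phi>"
  shows "(\<lambda>\<eta>. \<phi> (spin_prod \<eta>)) \<in> cylinder_funs V"
proof -
  obtain A where "A \<in> Fpow V"
    "\<forall>\<eta> \<zeta>. (\<forall>x\<in>A. \<eta> x = \<zeta> x) \<longrightarrow> \<phi> (spin_prod \<eta>) = \<phi> (spin_prod \<zeta>)"
    using moment_comb_support[OF assms] by blast
  then have "finite A \<and> A \<subseteq> V \<and> (\<forall>\<eta>\<in>configs V. \<forall>\<zeta>\<in>configs V. (\<forall>x\<in>A. \<eta> x = \<zeta> x) \<longrightarrow> \<phi> (spin_prod \<eta>) = \<phi> (spin_prod \<zeta>))"
    unfolding Fpow_def by blast
  then show ?thesis unfolding cylinder_funs_def by blast
qed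

lemma moment_comb_conts: "moment_comb V \<phi> \<Longrightarrow> (\<lambda>\<eta>. \<phi> (spin_prod \<eta>)) \<in> conts V"
  by (intro cylinder_fun_continuous moment_comb_cylinder)

text \<open>By compactness, finitely many cylinders on which \<open>f\<close> oscillates little cover the space.
Let \<open>D\<close> be the finite set of all sites that determine them; fixing the spins outside
\<open>D\<close> changes \<open>f\<close> little and leaves a cylinder function.\<close>

lemma conts_approx:
  assumes f: "f \<in> conts V" and \<epsilon>: "0 < \<epsilon>"
  shows "\<exists>\<phi>. moment_comb V \<phi> \<and> (\<forall>\<eta>\<in>configs V. \<bar>f \<eta> - \<phi> (spin_prod \<eta>)\<bar> < \<epsilon>)"
proof -
  define cyl where "cyl A \<eta> = {\<zeta>\<in>configs V. \<forall>x\<in>A. \<zeta> x = \<eta> x}" for A and \<eta> :: "'a \<Rightarrow> int"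
  define ok where "ok A \<eta> \<longleftrightarrow> finite A \<and> A \<subseteq> V \<and> (\<forall>\<zeta>\<in>cyl A \<eta>. \<bar>f \<zeta> - f \<eta>\<bar> < \<epsilon> / 2)" for A \<eta>
  have ex_ok: "\<exists>A. ok A \<eta>" if \<eta>: "\<eta> \<in> configs V" for \<eta>
  proof -
    let ?U = "{\<zeta>\<in>configs V. f \<zeta> \<in> ball (f \<eta>) (\<epsilon> / 2)}"
    have "\<forall>U. open U \<longrightarrow> openin (config_topology V) {\<zeta>\<in>configs V. f \<zeta> \<in> U}"
      using f unfolding conts_def by (auto simp: continuous_map_def)
    then have "openin (config_topology V) ?U"
      using open_ball by blast
    from this[unfolded config_topology_def openin_product_topology_alt, THEN bspec[of _ _ \<eta>]]
    obtain S where S: "finite {x \<in> V. S x \<noteq> {-1, 1}}" "\<eta> \<in> PiE V S" "PiE V S \<subseteq> ?U"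
      using \<eta> \<epsilon> by auto
    have "cyl {x \<in> V. S x \<noteq> {-1, 1}} \<eta> \<subseteq> PiE V S"
    proof
      fix \<zeta> assume \<zeta>: "\<zeta> \<in> cyl {x \<in> V. S x \<noteq> {-1, 1}} \<eta>"
      have "\<zeta> x \<in> S x" if "x \<in> V" for x
      proof (cases "S x = {-1, 1}")
        case True
        then show ?thesis using \<zeta> that configs_cases[of \<zeta> V x] by (auto simp: cyl_def)
      next
        case False
        then show ?thesis using \<zeta> S(2) that by (auto simp: cyl_def PiE_def Pi_def)
      qed
      then show "\<zeta> \<in> PiE V S" using \<zeta> by (auto simp: cyl_def PiE_def)
    qed
    then have "cyl {x \<in> V. S x \<noteq> {-1, 1}} \<eta> \<subseteq> ?U" using S(3) by (rule order_trans)
    then have "\<bar>f \<zeta> - f \<eta>\<bar> < \<epsilon> / 2" if "\<zeta> \<in> cyl {x \<in> V. S x \<noteq> {-1, 1}} \<eta>" for \<zeta>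
      using subsetD[OF _ that] by (fastforce simp: dist_real_def abs_minus_commute)
    then have "ok {x \<in> V. S x \<noteq> {-1, 1}} \<eta>"
      unfolding ok_def using S(1) by blast
    then show ?thesis ..
  qed
  then obtain A where A: "\<And>\<eta>. \<eta> \<in> configs V \<Longrightarrow> ok (A \<eta>) \<eta>" by metis
  let ?\<U> = "(\<lambda>\<eta>. cyl (A \<eta>) \<eta>) ` configs V"
  have "\<forall>U\<in>?\<U>. openin (config_topology V) U"
    using A by (auto simp: cyl_def ok_def intro!: cylinder_open)
  moreover have "topspace (config_topology V) \<subseteq> \<Union>?\<U>"
    by (auto simp: cyl_def)
  ultimately obtain \<F> where \<F>: "finite \<F>" "\<F> \<subseteq> ?\<U>" "configs V \<subseteq> \<Union>\<F>"
    using compact_configs[of V, unfolded compact_space_alt, rule_format, of ?\<U>] by auto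
  then obtain F where F: "finite F" "F \<subseteq> configs V" "\<F> = (\<lambda>\<eta>. cyl (A \<eta>) \<eta>) ` F"
    by (meson finite_subset_image)
  define D where "D = (\<Union>\<eta>\<in>F. A \<eta>)"
  have "\<forall>\<eta>\<in>F. ok (A \<eta>) \<eta>" using A F(2) by blast
  then have D: "finite D" "D \<subseteq> V" using F(1) by (auto simp: D_def ok_def)
  have close: "\<bar>f \<eta> - f \<zeta>\<bar> < \<epsilon>" if "\<eta> \<in> configs V" "\<zeta> \<in> configs V" "\<forall>x\<in>D. \<eta> x = \<zeta> x" for \<eta> \<zeta>
  proof -
    have "\<eta> \<in> \<Union>\<F>" using \<F>(3) that(1) by (rule subsetD)
    then obtain \<xi> where \<xi>: "\<xi> \<in> F" "\<eta> \<in> cyl (A \<xi>) \<xi>" by (auto simp: F(3))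
    have "A \<xi> \<subseteq> D" using \<xi> by (auto simp: D_def)
    then have "\<zeta> x = \<xi> x" if "x \<in> A \<xi>" for x
      using \<xi>(2) \<open>\<forall>x\<in>D. \<eta> x = \<zeta> x\<close> that unfolding cyl_def by (metis (mono_tags, lifting) mem_Collect_eq subsetD)
    then have "\<zeta> \<in> cyl (A \<xi>) \<xi>" using that(2) by (simp add: cyl_def)
    moreover have "ok (A \<xi>) \<xi>" using F(2) \<xi>(1) by (intro A) (rule subsetD)
    ultimately have "\<bar>f \<zeta> - f \<xi>\<bar> < \<epsilon> / 2" "\<bar>f \<eta> - f \<xi>\<bar> < \<epsilon> / 2"
      using \<xi>(2) by (auto simp: ok_def)
    then show ?thesis by linarith
  qed
  define g where "g \<eta> = f (\<lambda>x. if x \<in> D then \<eta> x else if x \<in> V then 1 else undefined)" for \<eta>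
  have cfg: "(\<lambda>x. if x \<in> D then \<eta> x else if x \<in> V then 1 else undefined) \<in> configs V"
    if "\<eta> \<in> configs V" for \<eta> :: "'a \<Rightarrow> int"
    using that D by (auto simp: PiE_def Pi_def extensional_def)
  have "g \<in> cylinder_funs V"
    unfolding cylinder_funs_def
  proof (intro CollectI exI[of _ D] conjI ballI impI D)
    fix \<eta> \<zeta> :: "'a \<Rightarrow> int" assume "\<forall>x\<in>D. \<eta> x = \<zeta> x"
    then show "g \<eta> = g \<zeta>" unfolding g_def by (intro arg_cong[of _ _ f]) auto
  qed
  then obtain \<phi> where \<phi>: "moment_comb V \<phi>" "\<forall>\<eta>\<in>configs V. g \<eta> = \<phi> (spin_prod \<eta>)"
    using cylinder_fun_moment_comb by blast
  have "\<bar>f \<eta> - g \<eta>\<bar> < \<epsilon>" if "\<eta> \<in> configs V" for \<eta>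
    unfolding g_def by (rule close[OF that cfg[OF that]]) simp
  with \<phi> show ?thesis by auto
qed

section \<open>Probability measures from their moments\<close>

text \<open>The algebra on which a measure is prescribed by its moments.\<close>

definition clopen_sets :: "'a set \<Rightarrow> ('a \<Rightarrow> int) set set" where
  "clopen_sets V = {C. C \<subseteq> configs V \<and> (indicator C :: _ \<Rightarrow> real) \<in> cylinder_funs V}"

lemma cylinder_funs_combine:
  assumes "f \<in> cylinder_funs V" "g \<in> cylinder_funs V"
  shows "(\<lambda>\<eta>. h (f \<eta>) (g \<eta>)) \<in> cylinder_funs V"
proof -
  obtain A where A: "finite A" "A \<subseteq> V"
    "\<forall>\<eta>\<in>configs V. \<forall>\<zeta>\<in>configs V. (\<forall>x\<in>A. \<eta> x = \<zeta> x) \<longrightarrow> f \<eta> = f \<zeta>"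
    using assms(1) by (auto simp: cylinder_funs_def)
  obtain B where B: "finite B" "B \<subseteq> V"
    "\<forall>\<eta>\<in>configs V. \<forall>\<zeta>\<in>configs V. (\<forall>x\<in>B. \<eta> x = \<zeta> x) \<longrightarrow> g \<eta> = g \<zeta>"
    using assms(2) by (auto simp: cylinder_funs_def)
  show ?thesis
    unfolding cylinder_funs_def
  proof (intro CollectI exI conjI ballI impI)
    show "finite (A \<union> B)" "A \<union> B \<subseteq> V" using A B by auto
    fix \<eta> \<zeta> assume "\<eta> \<in> configs V" "\<zeta> \<in> configs V" and eq: "\<forall>x\<in>A \<union> B. \<eta> x = \<zeta> x"
    then have "f \<eta> = f \<zeta>" "g \<eta> = g \<zeta>"
      by (auto intro!: A(3)[rule_format] B(3)[rule_format])
    then show "h (f \<eta>) (g \<eta>) = h (f \<zeta>) (g \<zeta>)" by simp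
  qed
qed

lemma cylinder_funs_cong:
  assumes "f \<in> cylinder_funs V" "\<And>\<eta>. \<eta> \<in> configs V \<Longrightarrow> f \<eta> = g \<eta>"
  shows "g \<in> cylinder_funs V"
  using assms unfolding cylinder_funs_def by simp

lemma cylinder_funs_const: "(\<lambda>\<eta>. c) \<in> cylinder_funs V"
  by (auto simp: cylinder_funs_def)

lemma algebra_clopen_sets: "algebra (configs V) (clopen_sets V)"
  unfolding algebra_iff_Int
proof (intro conjI ballI)
  show "clopen_sets V \<subseteq> Pow (configs V)" by (auto simp: clopen_sets_def)
  show "{} \<in> clopen_sets V"
    using cylinder_funs_const[of 0 V] by (simp add: clopen_sets_def indicator_def[abs_def])
  fix C assume C: "C \<in> clopen_sets V"
  have "(indicator (configs V - C) :: _ \<Rightarrow> real) \<in> cylinder_funs V"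
    by (rule cylinder_funs_cong[OF cylinder_funs_combine[of "indicator C" V "indicator C" "\<lambda>a b. 1 - a"]])
      (use C in \<open>auto simp: clopen_sets_def indicator_def\<close>)
  then show "configs V - C \<in> clopen_sets V" by (simp add: clopen_sets_def)
  fix D assume D: "D \<in> clopen_sets V"
  have "(indicator (C \<inter> D) :: _ \<Rightarrow> real) \<in> cylinder_funs V"
    by (rule cylinder_funs_cong[OF cylinder_funs_combine[of "indicator C" V "indicator D" "\<lambda>a b. a * b"]])
      (use C D in \<open>auto simp: clopen_sets_def indicator_def\<close>)
  then show "C \<inter> D \<in> clopen_sets V" using C by (auto simp: clopen_sets_def)
qed

lemma clopen_sets_closedin:
  assumes "C \<in> clopen_sets V"
  shows "closedin (config_topology V) C"
proof -
  have C: "C \<subseteq> configs V" "(indicator C :: _ \<Rightarrow> real) \<in> conts V"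
    using assms cylinder_fun_continuous by (auto simp: clopen_sets_def)
  from C(2) have "closedin (config_topology V) {\<eta> \<in> topspace (config_topology V). (indicator C \<eta> :: real) \<in> {1}}"
    unfolding conts_def mem_Collect_eq by (rule closedin_continuous_map_preimage) simp
  moreover have "{\<eta> \<in> topspace (config_topology V). (indicator C \<eta> :: real) \<in> {1}} = C"
    using C(1) by (auto simp: indicator_def)
  ultimately show ?thesis by simp
qed

lemma space_config_algebra [simp]: "space (config_algebra V) = configs V"
  by (simp add: config_algebra_def space_PiM)

lemma measurable_spin_prod:
  assumes "B \<in> Fpow V"
  shows "(\<lambda>\<eta>. spin_prod \<eta> B) \<in> borel_measurable (config_algebra V)"
proof -
  have "(\<lambda>\<eta>. real_of_int (\<eta> x)) \<in> borel_measurable (config_algebra V)" if "x \<in> B" for x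
  proof -
    have x: "x \<in> V" using that assms by (auto simp: Fpow_def)
    have "(\<lambda>\<eta>. \<eta> x) \<in> measurable (config_algebra V) (count_space {-1, 1})"
      unfolding config_algebra_def by (rule measurable_component_singleton[OF x])
    then show ?thesis
      by (rule measurable_compose) simp
  qed
  then show ?thesis by (simp add: spin_prod_def)
qed

lemma measurable_moment_comb:
  "moment_comb V \<phi> \<Longrightarrow> (\<lambda>\<eta>. \<phi> (spin_prod \<eta>)) \<in> borel_measurable (config_algebra V)"
  by (induction rule: moment_comb.induct)
    (auto intro!: borel_measurable_add borel_measurable_times measurable_spin_prod)

lemma sets_config_algebra: "sets (config_algebra V) = sigma_sets (configs V) (clopen_sets V)"
proof (rule equalityI)
  show "sets (config_algebra V) \<subseteq> sigma_sets (configs V) (clopen_sets V)"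
    unfolding config_algebra_def sets_PiM_single space_count_space
  proof (rule sigma_sets_mono, safe)
    fix x and A :: "int set" assume x: "x \<in> V"
    have "(indicator {f \<in> configs V. f x \<in> A} :: _ \<Rightarrow> real) \<in> cylinder_funs V"
      unfolding cylinder_funs_def
      by (intro CollectI exI[of _ "{x}"]) (use x in \<open>auto simp: indicator_def\<close>)
    then have "{f \<in> configs V. f x \<in> A} \<in> clopen_sets V" by (auto simp: clopen_sets_def)
    then show "{f \<in> configs V. f x \<in> A} \<in> sigma_sets (configs V) (clopen_sets V)" ..
  qed
next
  have "C \<in> sets (config_algebra V)" if C: "C \<in> clopen_sets V" for C
  proof -
    obtain \<phi> where \<phi>: "moment_comb V \<phi>" "\<forall>\<eta>\<in>configs V. (indicator C \<eta> :: real) = \<phi> (spin_prod \<eta>)"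
      using C cylinder_fun_moment_comb[of "indicator C" V] by (auto simp: clopen_sets_def)
    have "(indicator C :: _ \<Rightarrow> real) \<in> borel_measurable (config_algebra V)"
      using measurable_moment_comb[OF \<phi>(1)] \<phi>(2) by (subst measurable_cong) auto
    moreover have "C \<inter> configs V = C" using C by (auto simp: clopen_sets_def)
    ultimately show ?thesis by (simp add: borel_measurable_indicator_iff)
  qed
  then have "sigma_sets (space (config_algebra V)) (clopen_sets V) \<subseteq> sets (config_algebra V)"
    by (intro sets.sigma_sets_subset) auto
  then show "sigma_sets (configs V) (clopen_sets V) \<subseteq> sets (config_algebra V)" by simp
qed

lemma positive_moments_eq:
  assumes "positive_moments V M" "moment_comb V \<phi>" "moment_comb V \<psi>"
    "\<And>\<eta>. \<eta> \<in> configs V \<Longrightarrow> \<phi> (spin_prod \<eta>) = \<psi> (spin_prod \<eta>)"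
  shows "\<phi> M = \<psi> M"
proof (rule antisym)
  have "0 \<le> \<psi> M - \<phi> M"
    by (rule positive_momentsD[OF assms(1) moment_comb_diff[OF assms(3,2)]]) (simp add: assms(4))
  then show "\<phi> M \<le> \<psi> M" by simp
  have "0 \<le> \<phi> M - \<psi> M"
    by (rule positive_momentsD[OF assms(1) moment_comb_diff[OF assms(2,3)]]) (simp add: assms(4))
  then show "\<psi> M \<le> \<phi> M" by simp
qed

text \<open>A form of the Kolmogorov extension theorem. The moments determine a positive linear functional on
cylinder functions, which on indicators is a finitely additive set function on the clopen sets. It
is continuous at the empty set for a trivial reason: a decreasing sequence of clopen sets with empty
intersection is eventually empty, by compactness. So it extends to a measure.\<close>

theorem moment_measure_exists:
  assumes pos: "positive_moments V M" and one: "M {} = 1"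
  shows "\<exists>\<mu>. prob_space \<mu> \<and> sets \<mu> = sets (config_algebra V) \<and>
    (\<forall>B\<in>Fpow V. (\<integral>\<eta>. spin_prod \<eta> B \<partial>\<mu>) = M B)"
proof -
  define rep where "rep f \<phi> \<longleftrightarrow> moment_comb V \<phi> \<and> (\<forall>\<eta>\<in>configs V. f \<eta> = \<phi> (spin_prod \<eta>))"
    for f :: "('a \<Rightarrow> int) \<Rightarrow> real" and \<phi>
  define \<Lambda> where "\<Lambda> f = (SOME \<phi>. rep f \<phi>) M" for f
  have \<Lambda>: "\<Lambda> f = \<phi> M" if "rep f \<phi>" for f \<phi>
  proof -
    have "rep f (SOME \<phi>. rep f \<phi>)" by (rule someI[of "rep f", OF that])
    then obtain \<psi> where \<psi>: "\<Lambda> f = \<psi> M" "moment_comb V \<psi>" "\<And>\<eta>. \<eta> \<in> configs V \<Longrightarrow> f \<eta> = \<psi> (spin_prod \<eta>)"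
      unfolding \<Lambda>_def rep_def by blast
    have \<phi>: "moment_comb V \<phi>" "\<And>\<eta>. \<eta> \<in> configs V \<Longrightarrow> f \<eta> = \<phi> (spin_prod \<eta>)"
      using that unfolding rep_def by blast+
    show ?thesis
      unfolding \<psi>(1)
      by (rule positive_moments_eq[OF pos \<psi>(2) \<phi>(1)]) (simp only: \<psi>(3)[symmetric] \<phi>(2)[symmetric])
  qed
  have ex_rep: "\<exists>\<phi>. rep (indicator C) \<phi>" if "C \<in> clopen_sets V" for C
    using that cylinder_fun_moment_comb[of "indicator C" V] by (simp add: rep_def clopen_sets_def)
  define p where "p C = \<Lambda> (indicator C)" for C
  have p_nonneg: "0 \<le> p C" if C: "C \<in> clopen_sets V" for C
  proof -
    obtain \<phi> where rep: "rep (indicator C) \<phi>" using ex_rep[OF C] ..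
    then have \<phi>: "moment_comb V \<phi>" "\<And>\<eta>. \<eta> \<in> configs V \<Longrightarrow> indicator C \<eta> = \<phi> (spin_prod \<eta>)"
      unfolding rep_def by blast+
    have "0 \<le> \<phi> M"
      by (rule positive_momentsD[OF pos \<phi>(1)]) (simp flip: \<phi>(2))
    then show ?thesis by (simp add: p_def \<Lambda>[OF rep])
  qed
  have p_empty: "p {} = 0"
    unfolding p_def by (rule \<Lambda>) (simp add: rep_def moment_comb.zero)
  have p_add: "p (C \<union> D) = p C + p D" if CD: "C \<in> clopen_sets V" "D \<in> clopen_sets V" "C \<inter> D = {}" for C D
  proof -
    obtain \<phi> \<psi> where rep: "rep (indicator C) \<phi>" "rep (indicator D) \<psi>"
      using ex_rep[OF CD(1)] ex_rep[OF CD(2)] by blast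
    have "rep (indicator (C \<union> D)) (\<lambda>M. \<phi> M + \<psi> M)"
      unfolding rep_def
    proof (intro conjI ballI)
      show "moment_comb V (\<lambda>M. \<phi> M + \<psi> M)"
        using rep unfolding rep_def by (intro moment_comb_add) blast+
      fix \<eta> assume "\<eta> \<in> configs V"
      then have eq: "\<phi> (spin_prod \<eta>) = indicator C \<eta>" "\<psi> (spin_prod \<eta>) = indicator D \<eta>"
        using rep unfolding rep_def by force+
      show "indicator (C \<union> D) \<eta> = \<phi> (spin_prod \<eta>) + \<psi> (spin_prod \<eta>)"
        unfolding eq using CD(3) by (auto simp: indicator_def)
    qed
    from \<Lambda>[OF this] \<Lambda>[OF rep(1)] \<Lambda>[OF rep(2)] show ?thesis by (simp add: p_def)
  qed
  have p_half: "p {\<eta>\<in>configs V. spin_prod \<eta> B = 1} = (1 + M B) / 2 \<and> {\<eta>\<in>configs V. spin_prod \<eta> B = 1} \<in> clopen_sets V"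
    if B: "B \<in> Fpow V" for B
  proof -
    let ?C = "{\<eta>\<in>configs V. spin_prod \<eta> B = 1}" and ?\<phi> = "\<lambda>M. 1/2 * (1 * M {} + M B)"
    have \<phi>: "moment_comb V ?\<phi>"
      by (intro moment_comb_cmult moment_comb_add moment_comb_const moment_comb_eval B)
    have eq: "indicator ?C \<eta> = ?\<phi> (spin_prod \<eta>)" if "\<eta> \<in> configs V" for \<eta>
      using spin_prod_abs[OF that B] that by (auto simp: indicator_def abs_if split: if_splits)
    then have "rep (indicator ?C) ?\<phi>" using \<phi> by (simp add: rep_def)
    then have "p ?C = ?\<phi> M" unfolding p_def by (rule \<Lambda>)
    moreover have "(indicator ?C :: _ \<Rightarrow> real) \<in> cylinder_funs V"
      by (rule cylinder_funs_cong[OF moment_comb_cylinder[OF \<phi>]]) (simp add: eq)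
    ultimately show ?thesis using one by (auto simp: clopen_sets_def)
  qed
  interpret algebra "configs V" "clopen_sets V" by (rule algebra_clopen_sets)
  have "\<exists>\<mu>. (\<forall>C\<in>clopen_sets V. \<mu> C = ennreal (p C)) \<and>
      measure_space (configs V) (sigma_sets (configs V) (clopen_sets V)) \<mu>"
  proof (rule caratheodory_empty_continuous)
    show "positive (clopen_sets V) (\<lambda>C. ennreal (p C))" by (simp add: positive_def p_empty)
    show "additive (clopen_sets V) (\<lambda>C. ennreal (p C))"
      by (auto simp: additive_def p_add ennreal_plus p_nonneg)
    show "ennreal (p C) \<noteq> \<infinity>" for C by simp
    fix A :: "nat \<Rightarrow> ('a \<Rightarrow> int) set"
    assume A: "range A \<subseteq> clopen_sets V" "decseq A" "(\<Inter>i. A i) = {}"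
    have "\<exists>n. A n = {}"
      using compact_space_imp_nest[OF compact_configs, of V A] A clopen_sets_closedin by blast
    then obtain n where n: "A n = {}" ..
    have "A m = {}" if "m \<ge> n" for m
      using decseqD[OF A(2) that] n by simp
    then have "eventually (\<lambda>i. ennreal (p (A i)) = 0) sequentially"
      unfolding eventually_sequentially by (intro exI[of _ n]) (simp add: p_empty)
    then show "(\<lambda>i. ennreal (p (A i))) \<longlonglongrightarrow> 0" by (rule tendsto_eventually)
  qed
  then obtain m where m: "\<And>C. C \<in> clopen_sets V \<Longrightarrow> m C = ennreal (p C)"
    "measure_space (configs V) (sigma_sets (configs V) (clopen_sets V)) m" by blast
  let ?S = "sigma_sets (configs V) (clopen_sets V)"
  have sub: "clopen_sets V \<subseteq> Pow (configs V)" by (rule space_closed)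
  define \<mu> where "\<mu> = measure_of (configs V) ?S m"
  have sets: "sets \<mu> = sets (config_algebra V)"
    unfolding \<mu>_def sets_config_algebra using sigma_sets_into_sp[OF sub]
    by (subst sets_measure_of) (auto simp: sigma_sets_sigma_sets_eq[OF sub])
  have em: "emeasure \<mu> C = ennreal (p C)" if C: "C \<in> clopen_sets V" for C
  proof -
    have "sigma_algebra (configs V) ?S" "positive ?S m" "countably_additive ?S m"
      using m(2) by (auto simp: measure_space_def)
    from emeasure_measure_of_sigma[OF this sigma_sets.Basic[OF C]] show ?thesis
      by (simp add: \<mu>_def m(1)[OF C])
  qed
  have space: "space \<mu> = configs V" using sets_eq_imp_space_eq[OF sets] by simp
  have "rep (indicator (configs V)) (\<lambda>M. 1 * M {})"
    unfolding rep_def by (intro conjI moment_comb_const) simp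
  then have "p (configs V) = 1" unfolding p_def by (simp add: \<Lambda> one)
  then have prob: "prob_space \<mu>"
    by (intro prob_spaceI) (simp add: space em[OF top])
  interpret \<mu>: prob_space \<mu> by (rule prob)
  have "(\<integral>\<eta>. spin_prod \<eta> B \<partial>\<mu>) = M B" if B: "B \<in> Fpow V" for B
  proof -
    let ?C = "{\<eta>\<in>configs V. spin_prod \<eta> B = 1}"
    have C: "?C \<in> clopen_sets V" and pC: "p ?C = (1 + M B) / 2" using p_half[OF B] by auto
    have CS: "?C \<in> sets \<mu>" using C by (simp add: sets sets_config_algebra sigma_sets.Basic)
    have C_int: "integrable \<mu> (indicator ?C :: _ \<Rightarrow> real)"
      by (rule integrable_real_indicator[OF CS]) (simp add: \<mu>.emeasure_eq_measure)
    have mC: "measure \<mu> ?C = (1 + M B) / 2"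
      using em[OF C] p_nonneg[OF C] pC by (simp add: measure_def)
    have "(\<integral>\<eta>. spin_prod \<eta> B \<partial>\<mu>) = (\<integral>\<eta>. 2 * indicator ?C \<eta> - 1 \<partial>\<mu>)"
    proof (rule Bochner_Integration.integral_cong[OF refl])
      fix \<eta> assume "\<eta> \<in> space \<mu>"
      then show "spin_prod \<eta> B = 2 * indicator ?C \<eta> - 1"
        using spin_prod_abs[of \<eta> V B] B space by (auto simp: indicator_def abs_if split: if_splits)
    qed
    also have "\<dots> = 2 * measure \<mu> ?C - 1"
      using CS C_int by (subst Bochner_Integration.integral_diff) (auto simp: \<mu>.prob_space)
    finally show ?thesis unfolding mC by (simp add: add_divide_distrib)
  qed
  with prob sets show ?thesis by blast
qed

lemma conts_bounded_measurable:
  assumes "f \<in> conts V"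
  shows "f \<in> borel_measurable (config_algebra V)" "\<exists>K. \<forall>\<eta>\<in>configs V. \<bar>f \<eta>\<bar> \<le> K"
proof -
  have "\<exists>\<phi>. moment_comb V \<phi> \<and> (\<forall>\<eta>\<in>configs V. \<bar>f \<eta> - \<phi> (spin_prod \<eta>)\<bar> < 1 / real (Suc n))" for n
    by (rule conts_approx[OF assms]) simp
  from choice[OF allI[OF this]]
  obtain \<phi> where \<phi>0: "\<forall>n. moment_comb V (\<phi> n) \<and>
      (\<forall>\<eta>\<in>configs V. \<bar>f \<eta> - \<phi> n (spin_prod \<eta>)\<bar> < 1 / real (Suc n))" ..
  have \<phi>1: "moment_comb V (\<phi> n)" for n
    by (rule conjunct1[OF spec[OF \<phi>0]])
  have \<phi>2: "\<bar>f \<eta> - \<phi> n (spin_prod \<eta>)\<bar> < 1 / real (Suc n)" if "\<eta> \<in> configs V" for n \<eta>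
    by (rule bspec[OF conjunct2[OF spec[OF \<phi>0]] that])
  show "f \<in> borel_measurable (config_algebra V)"
  proof (rule borel_measurable_LIMSEQ_metric)
    show "(\<lambda>\<eta>. \<phi> n (spin_prod \<eta>)) \<in> borel_measurable (config_algebra V)" for n
      by (rule measurable_moment_comb[OF \<phi>1])
    fix \<eta> assume "\<eta> \<in> space (config_algebra V)"
    then have "\<bar>\<phi> n (spin_prod \<eta>) - f \<eta>\<bar> \<le> inverse (real (Suc n))" for n
      using \<phi>2[of \<eta> n] by (simp add: abs_minus_commute inverse_eq_divide)
    then have "(\<lambda>n. \<phi> n (spin_prod \<eta>) - f \<eta>) \<longlonglongrightarrow> 0"
      by (intro Lim_null_comparison[OF always_eventually LIMSEQ_inverse_real_of_nat]) simp
    then show "(\<lambda>n. \<phi> n (spin_prod \<eta>)) \<longlonglongrightarrow> f \<eta>" by (simp add: LIM_zero_iff)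
  qed
  have "finite ((\<lambda>\<eta>. \<bar>\<phi> 0 (spin_prod \<eta>)\<bar>) ` configs V)"
    using finite_imageI[OF moment_comb_finite_range[OF \<phi>1[of 0]], of abs] by (simp add: image_image)
  then have Max: "\<bar>\<phi> 0 (spin_prod \<eta>)\<bar> \<le> Max ((\<lambda>\<eta>. \<bar>\<phi> 0 (spin_prod \<eta>)\<bar>) ` configs V)"
    if "\<eta> \<in> configs V" for \<eta> using that by (intro Max_ge) auto
  define K where "K = Max ((\<lambda>\<eta>. \<bar>\<phi> 0 (spin_prod \<eta>)\<bar>) ` configs V)"
  have "\<bar>f \<eta>\<bar> \<le> K + 1" if "\<eta> \<in> configs V" for \<eta>
  proof -
    have "\<bar>f \<eta> - \<phi> 0 (spin_prod \<eta>)\<bar> < 1" using \<phi>2[OF that, of 0] by simp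
    with Max[OF that] show ?thesis unfolding K_def[symmetric] by linarith
  qed
  then show "\<exists>K. \<forall>\<eta>\<in>configs V. \<bar>f \<eta>\<bar> \<le> K" by (intro exI[of _ "K + 1"] ballI)
qed

lemma conts_integrable:
  assumes "prob_space \<mu>" "sets \<mu> = sets (config_algebra V)" "f \<in> conts V"
  shows "integrable \<mu> f"
proof -
  interpret prob_space \<mu> by fact
  obtain K where "\<forall>\<eta>\<in>configs V. \<bar>f \<eta>\<bar> \<le> K" using conts_bounded_measurable(2)[OF assms(3)] by blast
  moreover have "space \<mu> = configs V" using sets_eq_imp_space_eq[OF assms(2)] by simp
  moreover have "f \<in> borel_measurable \<mu>"
    using conts_bounded_measurable(1)[OF assms(3)] measurable_cong_sets[OF assms(2) refl] by blast
  ultimately have "AE \<eta> in \<mu>. norm (f \<eta>) \<le> K" and "f \<in> borel_measurable \<mu>" by auto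
  then show ?thesis by (rule integrable_const_bound)
qed

section \<open>The semigroup of the signed voter model\<close>

lemma conts_linear:
  assumes "f \<in> conts V" "g \<in> conts V"
  shows "(\<lambda>\<eta>. a * f \<eta> + b * g \<eta>) \<in> conts V"
  using assms unfolding conts_def by (simp add: continuous_map_add continuous_map_real_mult_left)

lemma conts_diff:
  assumes "f \<in> conts V" "g \<in> conts V"
  shows "(\<lambda>\<eta>. f \<eta> - g \<eta>) \<in> conts V"
  using conts_linear[OF assms, of 1 "-1"] by simp

lemma conts_const: "(\<lambda>_. c) \<in> conts V"
  unfolding conts_def by simp

context signed_graph
begin

text \<open>The distribution at time \<open>t\<close> of the process started in \<open>\<eta>\<close>.\<close>

definition law :: "real \<Rightarrow> ('a \<Rightarrow> int) \<Rightarrow> ('a \<Rightarrow> int) measure" where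
  "law t \<eta> = (SOME \<mu>. prob_space \<mu> \<and> sets \<mu> = sets (config_algebra V) \<and>
    (\<forall>B\<in>Fpow V. (\<integral>\<zeta>. spin_prod \<zeta> B \<partial>\<mu>) = flow t (spin_prod \<eta>) B))"

lemma law:
  assumes "\<eta> \<in> configs V" "0 \<le> t"
  shows "prob_space (law t \<eta>)" "sets (law t \<eta>) = sets (config_algebra V)"
    "B \<in> Fpow V \<Longrightarrow> (\<integral>\<zeta>. spin_prod \<zeta> B \<partial>law t \<eta>) = flow t (spin_prod \<eta>) B"
proof -
  have "flow t (spin_prod \<eta>) {} = 1" by (simp add: flow_empty)
  from someI_ex[OF moment_measure_exists[OF flow_positive[OF assms] this]]
  show "prob_space (law t \<eta>)" "sets (law t \<eta>) = sets (config_algebra V)"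
    "B \<in> Fpow V \<Longrightarrow> (\<integral>\<zeta>. spin_prod \<zeta> B \<partial>law t \<eta>) = flow t (spin_prod \<eta>) B"
    unfolding law_def[symmetric] by blast+
qed

definition voter_semigroup :: "real \<Rightarrow> (('a \<Rightarrow> int) \<Rightarrow> real) \<Rightarrow> ('a \<Rightarrow> int) \<Rightarrow> real" where
  "voter_semigroup t f \<eta> = (\<integral>\<zeta>. f \<zeta> \<partial>law t \<eta>)"

end

lemma expectation_moment_comb:
  assumes "prob_space \<mu>" "sets \<mu> = sets (config_algebra V)" "moment_comb V \<phi>"
    "\<And>B. B \<in> Fpow V \<Longrightarrow> (\<integral>\<zeta>. spin_prod \<zeta> B \<partial>\<mu>) = M B"
  shows "(\<integral>\<zeta>. \<phi> (spin_prod \<zeta>) \<partial>\<mu>) = \<phi> M"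
proof -
  have "integrable \<mu> (\<lambda>\<zeta>. spin_prod \<zeta> B)" if "B \<in> Fpow V" for B
    by (rule conts_integrable[OF assms(1,2) moment_comb_conts[OF moment_comb_eval[OF that]]])
  with moment_comb_integral[OF assms(3)] have "(\<integral>\<zeta>. \<phi> (spin_prod \<zeta>) \<partial>\<mu>) = \<phi> (\<lambda>B. \<integral>\<zeta>. spin_prod \<zeta> B \<partial>\<mu>)"
    by blast
  also have "\<dots> = \<phi> M" using assms(3,4) by (rule moment_comb_cong)
  finally show ?thesis .
qed

lemma expectation_close:
  assumes "prob_space \<mu>" "sets \<mu> = sets (config_algebra V)" "f \<in> conts V" "g \<in> conts V"
    "\<And>\<eta>. \<eta> \<in> configs V \<Longrightarrow> \<bar>f \<eta> - g \<eta>\<bar> \<le> e"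
  shows "\<bar>(\<integral>\<eta>. f \<eta> \<partial>\<mu>) - (\<integral>\<eta>. g \<eta> \<partial>\<mu>)\<bar> \<le> e"
proof -
  interpret prob_space \<mu> by fact
  have sp: "space \<mu> = configs V" using sets_eq_imp_space_eq[OF assms(2)] by simp
  have int: "integrable \<mu> f" "integrable \<mu> g" using conts_integrable assms by blast+
  have "(\<integral>\<eta>. f \<eta> \<partial>\<mu>) - (\<integral>\<eta>. g \<eta> \<partial>\<mu>) = (\<integral>\<eta>. f \<eta> - g \<eta> \<partial>\<mu>)" using int by simp
  also have "\<bar>\<dots>\<bar> \<le> (\<integral>\<eta>. \<bar>f \<eta> - g \<eta>\<bar> \<partial>\<mu>)" by (rule integral_abs_bound)
  also have "\<dots> \<le> (\<integral>\<eta>. e \<partial>\<mu>)"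
    by (rule integral_mono) (use int assms(5) sp in auto)
  finally show ?thesis by (simp add: prob_space)
qed

context signed_graph
begin

text \<open>The truncated power series are cylinder functions and converge uniformly over all moment functions
at once, in particular over all configurations. Properties of cylinder functions pass to the
functions evolved by the flow in this way.\<close>

lemma flow_approx:
  assumes "moment_comb V \<phi>"
  obtains \<psi> \<epsilon> where "\<And>n. moment_comb V (\<psi> n)" "\<epsilon> \<longlonglongrightarrow> (0::real)"
    "\<And>n M. unit_bounded M \<Longrightarrow> \<bar>\<phi> (flow t M) - \<psi> n M\<bar> \<le> \<epsilon> n"
proof -
  obtain C R where a: "\<forall>M. unit_bounded M \<longrightarrow> geom_bounded C R (\<lambda>k. \<phi> ((dual_gen ^^ k) M))"
    using moment_comb_geom_bounded[OF assms] by blast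
  show ?thesis
  proof (rule that)
    show "moment_comb V (\<lambda>M. \<Sum>k<n. t ^ k / fact k * \<phi> ((dual_gen ^^ k) M))" for n
      by (intro moment_comb_sum moment_comb_cmult moment_comb_dual_gen_power assms)
    show "(\<lambda>n. C * (exp (R * \<bar>t\<bar>) - (\<Sum>k<n. (R * \<bar>t\<bar>) ^ k / fact k))) \<longlonglongrightarrow> 0"
      by (rule exp_partial_sum_tendsto)
    fix n M assume M: "unit_bounded M"
    from exp_series_partial_sum[OF a[rule_format, OF M] order_refl, of t n]
    show "\<bar>\<phi> (flow t M) - (\<Sum>k<n. t ^ k / fact k * \<phi> ((dual_gen ^^ k) M))\<bar>
        \<le> C * (exp (R * \<bar>t\<bar>) - (\<Sum>k<n. (R * \<bar>t\<bar>) ^ k / fact k))"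
      by (simp add: moment_comb_flow[OF assms M] mult.commute)
  qed
qed

lemma flow_conts:
  assumes "moment_comb V \<phi>"
  shows "(\<lambda>\<eta>. \<phi> (flow t (spin_prod \<eta>))) \<in> conts V"
proof (rule conts_if_approx)
  fix e :: real assume "0 < e"
  obtain \<psi> \<epsilon> where \<psi>: "\<And>n. moment_comb V (\<psi> n)" "\<epsilon> \<longlonglongrightarrow> (0::real)"
    "\<And>n M. unit_bounded M \<Longrightarrow> \<bar>\<phi> (flow t M) - \<psi> n M\<bar> \<le> \<epsilon> n"
    using flow_approx[OF assms] by blast
  obtain n where "\<epsilon> n < e"
    using order_tendstoD(2)[OF \<psi>(2) \<open>0 < e\<close>] by (auto simp: eventually_sequentially)
  then have "\<forall>\<eta>\<in>configs V. \<bar>\<phi> (flow t (spin_prod \<eta>)) - \<psi> n (spin_prod \<eta>)\<bar> < e"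
    using \<psi>(3)[OF unit_bounded_spin_prod] by (auto intro: le_less_trans)
  with \<psi>(1) show "\<exists>\<psi>. moment_comb V \<psi> \<and> (\<forall>\<eta>\<in>configs V. \<bar>\<phi> (flow t (spin_prod \<eta>)) - \<psi> (spin_prod \<eta>)\<bar> < e)"
    by blast
qed

text \<open>Expectation and flow commute: the flow of the mean is the mean of the flow.\<close>

lemma expectation_flow:
  assumes \<mu>: "prob_space \<mu>" "sets \<mu> = sets (config_algebra V)" and \<phi>: "moment_comb V \<phi>"
    and M: "\<And>B. B \<in> Fpow V \<Longrightarrow> (\<integral>\<zeta>. spin_prod \<zeta> B \<partial>\<mu>) = M B" "unit_bounded M"
  shows "(\<integral>\<zeta>. \<phi> (flow t (spin_prod \<zeta>)) \<partial>\<mu>) = \<phi> (flow t M)"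
proof -
  obtain \<psi> \<epsilon> where \<psi>: "\<And>n. moment_comb V (\<psi> n)" "\<epsilon> \<longlonglongrightarrow> (0::real)"
    "\<And>n M. unit_bounded M \<Longrightarrow> \<bar>\<phi> (flow t M) - \<psi> n M\<bar> \<le> \<epsilon> n"
    using flow_approx[OF \<phi>] by blast
  have "\<bar>(\<integral>\<zeta>. \<phi> (flow t (spin_prod \<zeta>)) \<partial>\<mu>) - \<phi> (flow t M)\<bar> \<le> 2 * \<epsilon> n" for n
  proof -
    have "\<bar>(\<integral>\<zeta>. \<phi> (flow t (spin_prod \<zeta>)) \<partial>\<mu>) - (\<integral>\<zeta>. \<psi> n (spin_prod \<zeta>) \<partial>\<mu>)\<bar> \<le> \<epsilon> n"
      by (rule expectation_close[OF \<mu> flow_conts[OF \<phi>] moment_comb_conts[OF \<psi>(1)]])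
        (rule \<psi>(3)[OF unit_bounded_spin_prod])
    moreover have "(\<integral>\<zeta>. \<psi> n (spin_prod \<zeta>) \<partial>\<mu>) = \<psi> n M"
      by (rule expectation_moment_comb[OF \<mu> \<psi>(1) M(1)])
    ultimately show ?thesis using \<psi>(3)[OF M(2), of n] by linarith
  qed
  note bound = this
  have "(\<lambda>n. 2 * \<epsilon> n) \<longlonglongrightarrow> 2 * 0" by (intro tendsto_intros \<psi>)
  then have "\<bar>(\<integral>\<zeta>. \<phi> (flow t (spin_prod \<zeta>)) \<partial>\<mu>) - \<phi> (flow t M)\<bar> \<le> 2 * 0"
    by (rule LIMSEQ_le_const) (intro exI allI impI bound)
  then show ?thesis by simp
qed

lemma unit_bounded_positive:
  "positive_moments V M \<Longrightarrow> M {} = 1 \<Longrightarrow> unit_bounded M"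
  using positive_moments_abs[of V M] by (simp add: unit_bounded_def)

lemma semigroup_moment_comb:
  assumes "moment_comb V \<phi>" "\<eta> \<in> configs V" "0 \<le> t"
  shows "voter_semigroup t (\<lambda>\<zeta>. \<phi> (spin_prod \<zeta>)) \<eta> = \<phi> (flow t (spin_prod \<eta>))"
  unfolding voter_semigroup_def
  by (rule expectation_moment_comb[OF law(1,2)[OF assms(2,3)] assms(1) law(3)[OF assms(2,3)]])

lemma semigroup_close:
  assumes "f \<in> conts V" "g \<in> conts V" "\<And>\<eta>. \<eta> \<in> configs V \<Longrightarrow> \<bar>f \<eta> - g \<eta>\<bar> \<le> e" "\<eta> \<in> configs V" "0 \<le> t"
  shows "\<bar>voter_semigroup t f \<eta> - voter_semigroup t g \<eta>\<bar> \<le> e"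
  unfolding voter_semigroup_def by (rule expectation_close[OF law(1,2)[OF assms(4,5)] assms(1-3)])

text \<open>The reduction of statements on the semigroup to statements on the flow: since expectations are
contractions, the error of approximation by a cylinder function persists for all times.\<close>

lemma semigroup_approx:
  assumes f: "f \<in> conts V" and "0 < e"
  obtains \<phi> where "moment_comb V \<phi>" "\<And>\<eta>. \<eta> \<in> configs V \<Longrightarrow> \<bar>f \<eta> - \<phi> (spin_prod \<eta>)\<bar> < e"
    "\<And>t \<eta>. \<eta> \<in> configs V \<Longrightarrow> 0 \<le> t \<Longrightarrow> \<bar>voter_semigroup t f \<eta> - \<phi> (flow t (spin_prod \<eta>))\<bar> \<le> e"
proof -
  obtain \<phi> where \<phi>: "moment_comb V \<phi>" "\<forall>\<eta>\<in>configs V. \<bar>f \<eta> - \<phi> (spin_prod \<eta>)\<bar> < e"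
    using conts_approx[OF assms] by blast
  show ?thesis
  proof (rule that[OF \<phi>(1)])
    show c: "\<bar>f \<eta> - \<phi> (spin_prod \<eta>)\<bar> < e" if "\<eta> \<in> configs V" for \<eta> by (rule bspec[OF \<phi>(2) that])
    fix t \<eta> assume t: "\<eta> \<in> configs V" "0 \<le> (t::real)"
    show "\<bar>voter_semigroup t f \<eta> - \<phi> (flow t (spin_prod \<eta>))\<bar> \<le> e"
      using semigroup_close[OF f moment_comb_conts[OF \<phi>(1)] less_imp_le[OF c] t]
      by (simp add: semigroup_moment_comb[OF \<phi>(1) t])
  qed
qed

lemma semigroup_conts:
  assumes f: "f \<in> conts V" and t: "0 \<le> t"
  shows "voter_semigroup t f \<in> conts V"
proof (rule conts_if_approx)
  fix e :: real assume e: "0 < e"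
  then have e2: "0 < e / 2" by simp
  obtain \<phi> where \<phi>: "moment_comb V \<phi>" and "\<And>\<eta>. \<eta> \<in> configs V \<Longrightarrow> \<bar>f \<eta> - \<phi> (spin_prod \<eta>)\<bar> < e / 2"
    and \<phi>_flow: "\<And>t \<eta>. \<eta> \<in> configs V \<Longrightarrow> 0 \<le> t \<Longrightarrow> \<bar>voter_semigroup t f \<eta> - \<phi> (flow t (spin_prod \<eta>))\<bar> \<le> e / 2"
    by (rule semigroup_approx[OF f e2]) (rule that)
  obtain \<psi> where \<psi>: "moment_comb V \<psi>"
    "\<forall>\<eta>\<in>configs V. \<bar>\<phi> (flow t (spin_prod \<eta>)) - \<psi> (spin_prod \<eta>)\<bar> < e / 2"
    using conts_approx[OF flow_conts[OF \<phi>] e2] by blast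
  have "\<bar>voter_semigroup t f \<eta> - \<psi> (spin_prod \<eta>)\<bar> < e" if "\<eta> \<in> configs V" for \<eta>
    using \<phi>_flow[OF that t] bspec[OF \<psi>(2) that] by linarith
  with \<psi>(1) show "\<exists>\<psi>. moment_comb V \<psi> \<and> (\<forall>\<eta>\<in>configs V. \<bar>voter_semigroup t f \<eta> - \<psi> (spin_prod \<eta>)\<bar> < e)"
    by blast
qed

lemma eq_if_close: "(\<And>e. 0 < e \<Longrightarrow> \<bar>x - y\<bar> \<le> e) \<Longrightarrow> x = (y::real)"
  by (metis abs_le_zero_iff eq_iff_diff_eq_0 field_le_epsilon add_0)

lemma semigroup_zero:
  assumes "f \<in> conts V" "\<eta> \<in> configs V"
  shows "voter_semigroup 0 f \<eta> = f \<eta>"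
proof (rule eq_if_close)
  fix e :: real assume "0 < e"
  then have e2: "0 < e / 2" by simp
  obtain \<phi> where "moment_comb V \<phi>" and \<phi>: "\<And>\<eta>. \<eta> \<in> configs V \<Longrightarrow> \<bar>f \<eta> - \<phi> (spin_prod \<eta>)\<bar> < e / 2"
    "\<And>t \<eta>. \<eta> \<in> configs V \<Longrightarrow> 0 \<le> t \<Longrightarrow> \<bar>voter_semigroup t f \<eta> - \<phi> (flow t (spin_prod \<eta>))\<bar> \<le> e / 2"
    by (rule semigroup_approx[OF assms(1) e2]) (rule that)
  from \<phi>(1)[OF assms(2)] \<phi>(2)[OF assms(2), of 0]
  show "\<bar>voter_semigroup 0 f \<eta> - f \<eta>\<bar> \<le> e" unfolding flow_zero by linarith
qed

text \<open>On cylinder functions this is the semigroup law of the flow, in which the expectation over the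
configuration at time \<open>t\<close> is moved inside the flow.\<close>

lemma semigroup_add:
  assumes f: "f \<in> conts V" and \<eta>: "\<eta> \<in> configs V" and t: "0 \<le> t" "0 \<le> u"
  shows "voter_semigroup (t + u) f \<eta> = voter_semigroup t (voter_semigroup u f) \<eta>"
proof (rule eq_if_close)
  fix e :: real assume "0 < e"
  then have e2: "0 < e / 2" by simp
  obtain \<phi> where \<phi>: "moment_comb V \<phi>" and "\<And>\<eta>. \<eta> \<in> configs V \<Longrightarrow> \<bar>f \<eta> - \<phi> (spin_prod \<eta>)\<bar> < e / 2"
    and \<phi>_flow: "\<And>t \<eta>. \<eta> \<in> configs V \<Longrightarrow> 0 \<le> t \<Longrightarrow> \<bar>voter_semigroup t f \<eta> - \<phi> (flow t (spin_prod \<eta>))\<bar> \<le> e / 2"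
    by (rule semigroup_approx[OF f e2]) (rule that)
  have u: "unit_bounded (spin_prod \<eta>)" by (rule unit_bounded_spin_prod[OF \<eta>])
  have "voter_semigroup t (\<lambda>\<zeta>. \<phi> (flow u (spin_prod \<zeta>))) \<eta> = \<phi> (flow u (flow t (spin_prod \<eta>)))"
    unfolding voter_semigroup_def
    by (rule expectation_flow[OF law(1,2)[OF \<eta> t(1)] \<phi> law(3)[OF \<eta> t(1)]])
      (auto intro!: unit_bounded_positive flow_positive \<eta> t simp: flow_empty)
  also have "\<dots> = \<phi> (flow (t + u) (spin_prod \<eta>))"
    by (rule moment_comb_cong[OF \<phi>]) (rule flow_add[OF u])
  finally have "voter_semigroup t (\<lambda>\<zeta>. \<phi> (flow u (spin_prod \<zeta>))) \<eta> = \<phi> (flow (t + u) (spin_prod \<eta>))" .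
  moreover have "\<bar>voter_semigroup t (voter_semigroup u f) \<eta> - voter_semigroup t (\<lambda>\<zeta>. \<phi> (flow u (spin_prod \<zeta>))) \<eta>\<bar> \<le> e / 2"
    by (rule semigroup_close[OF semigroup_conts[OF f t(2)] flow_conts[OF \<phi>] \<phi>_flow[OF _ t(2)] \<eta> t(1)])
  moreover have "\<bar>voter_semigroup (t + u) f \<eta> - \<phi> (flow (t + u) (spin_prod \<eta>))\<bar> \<le> e / 2"
    using t by (intro \<phi>_flow \<eta>) simp
  ultimately show "\<bar>voter_semigroup (t + u) f \<eta> - voter_semigroup t (voter_semigroup u f) \<eta>\<bar> \<le> e"
    by linarith
qed

lemma flow_deriv:
  assumes "moment_comb V \<phi>" "unit_bounded M"
  shows "((\<lambda>t. \<phi> (flow t M)) has_real_derivative \<phi> (dual_gen (flow t M))) (at t)"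
proof -
  obtain C R where a: "geom_bounded C R (\<lambda>k. \<phi> ((dual_gen ^^ k) M))"
    using moment_comb_geom_bounded[OF assms(1)] assms(2) by blast
  have "\<phi> (dual_gen (flow t M)) = exp_series (\<lambda>k. \<phi> ((dual_gen ^^ Suc k) M)) t"
    using moment_comb_flow[OF moment_comb_dual_gen[OF assms(1)] assms(2), of t] by simp
  with exp_series_deriv[OF a, of t] show ?thesis
    by (simp add: moment_comb_flow[OF assms] fun_eq_iff)
qed

text \<open>The derivative in time is the flow of the cylinder function obtained from the generator, which is
bounded uniformly in time by its initial supremum.\<close>

lemma flow_lipschitz:
  assumes "moment_comb V \<phi>"
  shows "\<exists>K\<ge>0. \<forall>\<eta>\<in>configs V. \<forall>t u. 0 \<le> t \<longrightarrow> t \<le> u \<longrightarrow>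
    \<bar>\<phi> (flow u (spin_prod \<eta>)) - \<phi> (flow t (spin_prod \<eta>))\<bar> \<le> K * (u - t)"
proof -
  obtain K where K: "\<forall>\<eta>\<in>configs V. \<bar>\<phi> (dual_gen (spin_prod \<eta>))\<bar> \<le> K"
    using conts_bounded_measurable(2)[OF moment_comb_conts[OF moment_comb_dual_gen[OF assms]]] by blast
  have *: "\<bar>\<phi> (dual_gen (flow t (spin_prod \<eta>)))\<bar> \<le> K" if "\<eta> \<in> configs V" "0 \<le> t" for t \<eta>
    using semigroup_close[OF moment_comb_conts[OF moment_comb_dual_gen[OF assms]] conts_const[of 0] _ that, of K] K
    by (simp add: semigroup_moment_comb[OF moment_comb_dual_gen[OF assms] that])
      (simp add: voter_semigroup_def)
  have "\<bar>\<phi> (flow u (spin_prod \<eta>)) - \<phi> (flow t (spin_prod \<eta>))\<bar> \<le> K * (u - t)"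
    if tu: "\<eta> \<in> configs V" "0 \<le> t" "t \<le> u" for t u \<eta>
  proof (cases "t = u")
    case False
    with tu have "t < u" by simp
    then obtain x where x: "t < x" "x < u"
      "\<phi> (flow u (spin_prod \<eta>)) - \<phi> (flow t (spin_prod \<eta>)) = (u - t) * \<phi> (dual_gen (flow x (spin_prod \<eta>)))"
      using MVT2[of t u "\<lambda>t. \<phi> (flow t (spin_prod \<eta>))" "\<lambda>t. \<phi> (dual_gen (flow t (spin_prod \<eta>)))"]
        flow_deriv[OF assms unit_bounded_spin_prod[OF tu(1)]] by blast
    then show ?thesis
      using *[of \<eta> x] tu by (simp add: abs_mult mult.commute mult_right_mono)
  qed simp
  moreover have "0 \<le> K" using K configs_nonempty[of V] by (meson abs_ge_zero ex_in_conv order_trans)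
  ultimately show ?thesis by blast
qed

lemma semigroup_right_continuous:
  assumes f: "f \<in> conts V" and t: "0 \<le> t"
  shows "uniform_limit (configs V) (\<lambda>u. voter_semigroup u f) (voter_semigroup t f) (at_right t)"
  unfolding uniform_limit_iff
proof (intro allI impI)
  fix e :: real assume "0 < e"
  then have e4: "0 < e / 4" by simp
  obtain \<phi> where \<phi>: "moment_comb V \<phi>" and "\<And>\<eta>. \<eta> \<in> configs V \<Longrightarrow> \<bar>f \<eta> - \<phi> (spin_prod \<eta>)\<bar> < e / 4"
    and \<phi>_flow: "\<And>t \<eta>. \<eta> \<in> configs V \<Longrightarrow> 0 \<le> t \<Longrightarrow> \<bar>voter_semigroup t f \<eta> - \<phi> (flow t (spin_prod \<eta>))\<bar> \<le> e / 4"
    by (rule semigroup_approx[OF f e4]) (rule that)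
  obtain K where K: "K \<ge> 0" "\<And>\<eta> t u. \<eta> \<in> configs V \<Longrightarrow> 0 \<le> t \<Longrightarrow> t \<le> u \<Longrightarrow>
      \<bar>\<phi> (flow u (spin_prod \<eta>)) - \<phi> (flow t (spin_prod \<eta>))\<bar> \<le> K * (u - t)"
    using flow_lipschitz[OF \<phi>] by blast
  let ?d = "e / (4 * (K + 1))"
  have d: "0 < ?d" using \<open>0 < e\<close> K(1) by simp
  show "\<forall>\<^sub>F u in at_right t. \<forall>\<eta>\<in>configs V. dist (voter_semigroup u f \<eta>) (voter_semigroup t f \<eta>) < e"
    unfolding eventually_at_right_field
  proof (intro exI[of _ "t + ?d"] conjI allI impI ballI)
    show "t < t + ?d" using d by simp
    fix u \<eta> assume u: "t < u" "u < t + ?d" and \<eta>: "\<eta> \<in> configs V"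
    have "K * (u - t) \<le> (K + 1) * ?d" using K(1) u by (intro mult_mono) auto
    also have "\<dots> = e / 4" using K(1) by (simp add: field_simps)
    finally have "\<bar>\<phi> (flow u (spin_prod \<eta>)) - \<phi> (flow t (spin_prod \<eta>))\<bar> \<le> e / 4"
      using K(2)[OF \<eta> t less_imp_le[OF u(1)]] by linarith
    moreover have "0 \<le> u" using u t by simp
    ultimately show "dist (voter_semigroup u f \<eta>) (voter_semigroup t f \<eta>) < e"
      using \<phi>_flow[OF \<eta> t] \<phi>_flow[OF \<eta>, of u] \<open>0 < e\<close> unfolding dist_real_def by linarith
  qed
qed

lemma semigroup_linear:
  assumes "f \<in> conts V" "g \<in> conts V" "\<eta> \<in> configs V" "0 \<le> t"
  shows "voter_semigroup t (\<lambda>\<zeta>. a * f \<zeta> + b * g \<zeta>) \<eta> = a * voter_semigroup t f \<eta> + b * voter_semigroup t g \<eta>"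
  using conts_integrable[OF law(1,2)[OF assms(3,4)]] assms(1,2) by (simp add: voter_semigroup_def)

lemma markov_semigroup_voter: "markov_semigroup V voter_semigroup"
  unfolding markov_semigroup_def
proof (intro conjI allI impI ballI)
  show "voter_semigroup t (\<lambda>_. 1) \<eta> = 1" if "0 \<le> t" "\<eta> \<in> configs V" for t \<eta>
    using prob_space.prob_space[OF law(1)[OF that(2,1)]] by (simp add: voter_semigroup_def)
  show "0 \<le> voter_semigroup t f \<eta>" if "0 \<le> t" "\<forall>\<eta>\<in>configs V. 0 \<le> f \<eta>" "\<eta> \<in> configs V" for t f \<eta>
    unfolding voter_semigroup_def
    using sets_eq_imp_space_eq[OF law(2)[OF that(3,1)]] that(2)
    by (intro Bochner_Integration.integral_nonneg_AE AE_I2) simp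
qed (simp_all add: semigroup_conts semigroup_linear semigroup_zero semigroup_right_continuous semigroup_add)

end

section \<open>The generator\<close>

context signed_graph
begin

lemma voter_op_closure_iff:
  "(f, g) \<in> voter_op_closure V E s \<longleftrightarrow> f \<in> conts V \<and> g \<in> conts V \<and>
    (\<forall>\<epsilon>>0. \<exists>\<phi>. moment_comb V \<phi> \<and> (\<forall>\<eta>\<in>configs V.
      \<bar>\<phi> (spin_prod \<eta>) - f \<eta>\<bar> < \<epsilon> \<and> \<bar>\<phi> (dual_gen (spin_prod \<eta>)) - g \<eta>\<bar> < \<epsilon>))"
proof -
  have "(\<exists>h\<in>cylinder_funs V. \<forall>\<eta>\<in>configs V. \<bar>h \<eta> - f \<eta>\<bar> < \<epsilon> \<and> \<bar>voter_op V E s h \<eta> - g \<eta>\<bar> < \<epsilon>) \<longleftrightarrow>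
     (\<exists>\<phi>. moment_comb V \<phi> \<and> (\<forall>\<eta>\<in>configs V.
      \<bar>\<phi> (spin_prod \<eta>) - f \<eta>\<bar> < \<epsilon> \<and> \<bar>\<phi> (dual_gen (spin_prod \<eta>)) - g \<eta>\<bar> < \<epsilon>))" (is "?L \<longleftrightarrow> ?R") for \<epsilon>
  proof
    assume ?L
    then obtain h where h: "h \<in> cylinder_funs V"
      "\<forall>\<eta>\<in>configs V. \<bar>h \<eta> - f \<eta>\<bar> < \<epsilon> \<and> \<bar>voter_op V E s h \<eta> - g \<eta>\<bar> < \<epsilon>" by blast
    obtain \<phi> where \<phi>: "moment_comb V \<phi>" "\<forall>\<eta>\<in>configs V. h \<eta> = \<phi> (spin_prod \<eta>)"
      using cylinder_fun_moment_comb[OF h(1)] by blast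
    have eq: "\<phi> (spin_prod \<eta>) = h \<eta>" if "\<eta> \<in> configs V" for \<eta>
      by (rule bspec[OF \<phi>(2) that, symmetric])
    have "\<phi> (dual_gen (spin_prod \<eta>)) = voter_op V E s h \<eta>" if "\<eta> \<in> configs V" for \<eta>
      unfolding voter_op_moment_comb[OF \<phi>(1) that, symmetric] by (rule voter_op_cong[OF eq that])
    with eq h(2) \<phi>(1) show ?R by (intro exI[of _ \<phi>]) simp
  next
    assume ?R
    then obtain \<phi> where \<phi>: "moment_comb V \<phi>" "\<forall>\<eta>\<in>configs V.
      \<bar>\<phi> (spin_prod \<eta>) - f \<eta>\<bar> < \<epsilon> \<and> \<bar>\<phi> (dual_gen (spin_prod \<eta>)) - g \<eta>\<bar> < \<epsilon>" by blast
    then show ?L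
      by (intro bexI[OF _ moment_comb_cylinder[OF \<phi>(1)]]) (simp add: voter_op_moment_comb)
  qed
  then show ?thesis by (simp add: voter_op_closure_def)
qed

lemma voter_generator_iff:
  "(f, g) \<in> generator V voter_semigroup \<longleftrightarrow> f \<in> conts V \<and> g \<in> conts V \<and>
    (\<forall>\<epsilon>>0. \<exists>\<delta>>0. \<forall>t>0. t < \<delta> \<longrightarrow> (\<forall>\<eta>\<in>configs V. \<bar>(voter_semigroup t f \<eta> - f \<eta>) / t - g \<eta>\<bar> < \<epsilon>))"
  unfolding generator_def uniform_limit_iff eventually_at_right_field dist_real_def by simp

lemma voter_generatorD:
  assumes fg: "(f, g) \<in> generator V voter_semigroup" and \<epsilon>: "0 < \<epsilon>"
  obtains \<delta> where "0 < \<delta>" "\<And>t \<eta>. 0 < t \<Longrightarrow> t < \<delta> \<Longrightarrow> \<eta> \<in> configs V \<Longrightarrow>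
    \<bar>(voter_semigroup t f \<eta> - f \<eta>) / t - g \<eta>\<bar> < \<epsilon>"
proof -
  have "\<forall>\<epsilon>>0. \<exists>\<delta>>0. \<forall>t>0. t < \<delta> \<longrightarrow> (\<forall>\<eta>\<in>configs V. \<bar>(voter_semigroup t f \<eta> - f \<eta>) / t - g \<eta>\<bar> < \<epsilon>)"
    using fg unfolding voter_generator_iff by (elim conjE)
  from this[rule_format, OF \<epsilon>] obtain \<delta> where "0 < \<delta>"
    and "\<forall>t>0. t < \<delta> \<longrightarrow> (\<forall>\<eta>\<in>configs V. \<bar>(voter_semigroup t f \<eta> - f \<eta>) / t - g \<eta>\<bar> < \<epsilon>)"
    by (elim exE conjE)
  from that[OF this(1) this(2)[rule_format]] show ?thesis .
qed

lemma semigroup_mvt: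
  assumes "moment_comb V \<phi>" "\<eta> \<in> configs V" "0 < t"
  obtains r where "0 < r" "r < t" "voter_semigroup t (\<lambda>\<zeta>. \<phi> (spin_prod \<zeta>)) \<eta> - \<phi> (spin_prod \<eta>) =
    t * voter_semigroup r (\<lambda>\<zeta>. \<phi> (dual_gen (spin_prod \<zeta>))) \<eta>"
proof -
  obtain r where r: "0 < r" "r < t"
    "\<phi> (flow t (spin_prod \<eta>)) - \<phi> (flow 0 (spin_prod \<eta>)) = (t - 0) * \<phi> (dual_gen (flow r (spin_prod \<eta>)))"
    using MVT2[OF assms(3), of "\<lambda>t. \<phi> (flow t (spin_prod \<eta>))" "\<lambda>t. \<phi> (dual_gen (flow t (spin_prod \<eta>)))"]
      flow_deriv[OF assms(1) unit_bounded_spin_prod[OF assms(2)]] by blast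
  show ?thesis
    using r(3) semigroup_moment_comb[OF assms(1,2) less_imp_le[OF assms(3)]]
      semigroup_moment_comb[OF moment_comb_dual_gen[OF assms(1)] assms(2) less_imp_le[OF r(1)]]
    by (intro that[OF r(1,2)]) simp
qed

text \<open>The mean value theorem bounds the error of the difference quotient of a cylinder function by the
oscillation of its generator under the semigroup. This bound involves only the supremum distances to
\<open>f\<close> and \<open>g\<close>, so it survives the passage to the closure.\<close>

lemma closure_subset_generator:
  assumes "(f, g) \<in> voter_op_closure V E s"
  shows "(f, g) \<in> generator V voter_semigroup"
proof -
  have f: "f \<in> conts V" and g: "g \<in> conts V" using assms unfolding voter_op_closure_iff by blast+
  have approx: "\<exists>\<phi>. moment_comb V \<phi> \<and> (\<forall>\<eta>\<in>configs V.
      \<bar>\<phi> (spin_prod \<eta>) - f \<eta>\<bar> < \<epsilon> \<and> \<bar>\<phi> (dual_gen (spin_prod \<eta>)) - g \<eta>\<bar> < \<epsilon>)" if "0 < \<epsilon>" for \<epsilon>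
    using assms that unfolding voter_op_closure_iff by blast
  have "\<exists>\<delta>>0. \<forall>t>0. t < \<delta> \<longrightarrow> (\<forall>\<eta>\<in>configs V. \<bar>(voter_semigroup t f \<eta> - f \<eta>) / t - g \<eta>\<bar> < \<epsilon>)"
    if "0 < \<epsilon>" for \<epsilon>
  proof -
    have \<epsilon>2: "0 < \<epsilon> / 2" using that by simp
    obtain \<delta> where \<delta>: "0 < \<delta>" "\<And>r \<eta>. 0 < r \<Longrightarrow> r < \<delta> \<Longrightarrow> \<eta> \<in> configs V \<Longrightarrow> \<bar>voter_semigroup r g \<eta> - g \<eta>\<bar> < \<epsilon> / 2"
      using uniform_limitD[OF semigroup_right_continuous[OF g order_refl] \<epsilon>2]
      unfolding eventually_at_right_field dist_real_def by (auto simp: semigroup_zero[OF g])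
    have "\<bar>(voter_semigroup t f \<eta> - f \<eta>) / t - g \<eta>\<bar> < \<epsilon>"
      if t: "0 < t" "t < \<delta>" and \<eta>: "\<eta> \<in> configs V" for t \<eta>
    proof -
      have "\<bar>voter_semigroup t f \<eta> - f \<eta> - t * g \<eta>\<bar> \<le> t * (\<epsilon> / 2) + e" if "0 < e" for e
      proof -
        \<comment> \<open>The approximation enters twice directly and once with factor t.\<close>
        let ?e = "e / (2 + t)"
        have e: "0 < ?e" using \<open>0 < e\<close> t by simp
        obtain \<phi> where \<phi>: "moment_comb V \<phi>"
          and \<phi>_all: "\<forall>\<eta>\<in>configs V. \<bar>\<phi> (spin_prod \<eta>) - f \<eta>\<bar> < ?e \<and> \<bar>\<phi> (dual_gen (spin_prod \<eta>)) - g \<eta>\<bar> < ?e"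
          using approx[OF e] by blast
        have close: "\<bar>f \<eta> - \<phi> (spin_prod \<eta>)\<bar> \<le> ?e" "\<bar>\<phi> (dual_gen (spin_prod \<eta>)) - g \<eta>\<bar> \<le> ?e"
          if "\<eta> \<in> configs V" for \<eta>
          using bspec[OF \<phi>_all that] by (simp_all add: abs_minus_commute)
        obtain r where r: "0 < r" "r < t" and mvt:
          "voter_semigroup t (\<lambda>\<zeta>. \<phi> (spin_prod \<zeta>)) \<eta> - \<phi> (spin_prod \<eta>) =
            t * voter_semigroup r (\<lambda>\<zeta>. \<phi> (dual_gen (spin_prod \<zeta>))) \<eta>"
          by (rule semigroup_mvt[OF \<phi> \<eta> t(1)])
        have "\<bar>voter_semigroup t f \<eta> - voter_semigroup t (\<lambda>\<zeta>. \<phi> (spin_prod \<zeta>)) \<eta>\<bar> \<le> ?e"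
          by (rule semigroup_close[OF f moment_comb_conts[OF \<phi>] close(1) \<eta> less_imp_le[OF t(1)]])
        moreover have "\<bar>voter_semigroup r (\<lambda>\<zeta>. \<phi> (dual_gen (spin_prod \<zeta>))) \<eta> - voter_semigroup r g \<eta>\<bar> \<le> ?e"
          by (rule semigroup_close[OF moment_comb_conts[OF moment_comb_dual_gen[OF \<phi>]] g close(2) \<eta> less_imp_le[OF r(1)]])
        moreover have "\<bar>voter_semigroup r g \<eta> - g \<eta>\<bar> < \<epsilon> / 2" using r t by (intro \<delta>(2) \<eta>) auto
        ultimately have
          1: "\<bar>voter_semigroup r (\<lambda>\<zeta>. \<phi> (dual_gen (spin_prod \<zeta>))) \<eta> - g \<eta>\<bar> \<le> ?e + \<epsilon> / 2" and
          2: "\<bar>voter_semigroup t f \<eta> - f \<eta> - (voter_semigroup t (\<lambda>\<zeta>. \<phi> (spin_prod \<zeta>)) \<eta> - \<phi> (spin_prod \<eta>))\<bar> \<le> 2 * ?e"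
          using close(1)[OF \<eta>] by linarith+
        have 3: "\<bar>t * voter_semigroup r (\<lambda>\<zeta>. \<phi> (dual_gen (spin_prod \<zeta>))) \<eta> - t * g \<eta>\<bar> \<le> t * (?e + \<epsilon> / 2)"
          using mult_left_mono[OF 1, of t] t(1) by (simp add: abs_mult right_diff_distrib[symmetric])
        have "2 * ?e + t * (?e + \<epsilon> / 2) = t * (\<epsilon> / 2) + (2 + t) * ?e" by (simp only: distrib_right distrib_left add_ac)
        also have "(2 + t) * ?e = e" using t by simp
        finally show ?thesis using 2 3 unfolding mvt by linarith
      qed
      then have "\<bar>voter_semigroup t f \<eta> - f \<eta> - t * g \<eta>\<bar> \<le> t * (\<epsilon> / 2)"
        by (rule field_le_epsilon)
      also have "\<dots> < t * \<epsilon>" using t \<open>0 < \<epsilon>\<close> by simp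
      finally have "\<bar>voter_semigroup t f \<eta> - f \<eta> - t * g \<eta>\<bar> / t < \<epsilon>"
        using t by (simp add: pos_divide_less_eq mult.commute)
      moreover have "(voter_semigroup t f \<eta> - f \<eta>) / t - g \<eta> = (voter_semigroup t f \<eta> - f \<eta> - t * g \<eta>) / t"
        using t by (simp add: field_simps)
      ultimately show ?thesis using t by simp
    qed
    with \<delta>(1) show ?thesis by (intro exI[of _ \<delta>]) simp
  qed
  with f g show ?thesis unfolding voter_generator_iff by simp
qed

text \<open>The generator of a contraction semigroup does not shrink under \<open>1 - generator\<close>: write
\<open>(1 + t) * w\<close> as the sum of \<open>voter_semigroup t w\<close>,
\<open>t * (w - z)\<close> and an error \<open>o(t)\<close>, and compare suprema.\<close>

lemma generator_dissipative:
  assumes wz: "(w, z) \<in> generator V voter_semigroup" and K: "\<And>\<eta>. \<eta> \<in> configs V \<Longrightarrow> \<bar>w \<eta> - z \<eta>\<bar> \<le> K"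
    and \<eta>: "\<eta> \<in> configs V"
  shows "\<bar>w \<eta>\<bar> \<le> K"
proof (rule field_le_epsilon)
  fix \<epsilon> :: real assume \<epsilon>: "0 < \<epsilon>"
  have w: "w \<in> conts V" using wz unfolding voter_generator_iff by blast
  obtain \<delta> where \<delta>: "0 < \<delta>" "\<And>t \<eta>. 0 < t \<Longrightarrow> t < \<delta> \<Longrightarrow> \<eta> \<in> configs V \<Longrightarrow> \<bar>(voter_semigroup t w \<eta> - w \<eta>) / t - z \<eta>\<bar> < \<epsilon>"
    by (rule voter_generatorD[OF wz \<epsilon>]) (rule that)
  \<comment> \<open>Any single time at which the difference quotient is close to the generator will do.\<close>
  define t where "t = \<delta> / 2"
  have t: "0 < t" "t < \<delta>" using \<delta>(1) by (auto simp: t_def)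
  obtain K' where K': "\<forall>\<eta>\<in>configs V. \<bar>w \<eta>\<bar> \<le> K'" using conts_bounded_measurable(2)[OF w] by blast
  define S where "S = (SUP \<eta>\<in>configs V. \<bar>w \<eta>\<bar>)"
  have bdd: "bdd_above ((\<lambda>\<eta>. \<bar>w \<eta>\<bar>) ` configs V)" using K' by (auto simp: bdd_above_def)
  have S: "\<bar>w \<eta>\<bar> \<le> S" if "\<eta> \<in> configs V" for \<eta>
    unfolding S_def by (rule cSUP_upper[OF that bdd])
  have "\<bar>w \<zeta>\<bar> \<le> (S + t * (K + \<epsilon>)) / (1 + t)" if \<zeta>: "\<zeta> \<in> configs V" for \<zeta>
  proof -
    have "\<bar>voter_semigroup t w \<zeta>\<bar> \<le> S"
      using semigroup_close[OF w conts_const[of 0] _ \<zeta> less_imp_le[OF t(1)], of S] S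
      by (simp add: voter_semigroup_def)
    moreover have "\<bar>(w \<zeta> - z \<zeta>) - ((voter_semigroup t w \<zeta> - w \<zeta>) / t - z \<zeta>)\<bar> \<le> K + \<epsilon>"
      using K[OF \<zeta>] \<delta>(2)[OF t \<zeta>] by linarith
    then have "t * \<bar>(w \<zeta> - z \<zeta>) - ((voter_semigroup t w \<zeta> - w \<zeta>) / t - z \<zeta>)\<bar> \<le> t * (K + \<epsilon>)"
      using t by (intro mult_left_mono) auto
    moreover have "(1 + t) * w \<zeta> = voter_semigroup t w \<zeta> + t * ((w \<zeta> - z \<zeta>) - ((voter_semigroup t w \<zeta> - w \<zeta>) / t - z \<zeta>))"
      using t by (simp add: field_simps)
    then have "\<bar>(1 + t) * w \<zeta>\<bar> \<le> \<bar>voter_semigroup t w \<zeta>\<bar> + t * \<bar>(w \<zeta> - z \<zeta>) - ((voter_semigroup t w \<zeta> - w \<zeta>) / t - z \<zeta>)\<bar>"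
      using t by (metis abs_mult abs_of_pos abs_triangle_ineq)
    ultimately have "\<bar>(1 + t) * w \<zeta>\<bar> \<le> S + t * (K + \<epsilon>)" by linarith
    then show ?thesis using t by (simp add: abs_mult pos_le_divide_eq mult.commute)
  qed
  then have "S \<le> (S + t * (K + \<epsilon>)) / (1 + t)"
    unfolding S_def by (intro cSUP_least configs_nonempty)
  then have "(1 + t) * S \<le> S + t * (K + \<epsilon>)" using t by (simp add: pos_le_divide_eq mult.commute)
  then have "t * S \<le> t * (K + \<epsilon>)" by (simp add: distrib_right)
  then have "S \<le> K + \<epsilon>" using t by simp
  with S[OF \<eta>] show "\<bar>w \<eta>\<bar> \<le> K + \<epsilon>" by simp
qed

text \<open>Let \<open>A\<close> be the generator plus \<open>N\<close>, where the functional involves at most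
\<open>N\<close> walks. Then \<open>1 - generator\<close> equals \<open>(1 + N) - A\<close>, and
\<open>A\<close> has norm at most \<open>N\<close> by \<open>dual_gen_plus_bound\<close>. So the
Neumann series of the inverse converges, with ratio \<open>N / (1 + N)\<close>, and its partial sums
are cylinder functions.\<close>

lemma resolvent_range_dense:
  assumes \<phi>: "moment_comb V \<phi>" and e: "0 < e"
  shows "\<exists>\<psi>. moment_comb V \<psi> \<and>
    (\<forall>\<eta>\<in>configs V. \<bar>\<psi> (spin_prod \<eta>) - \<psi> (dual_gen (spin_prod \<eta>)) - \<phi> (spin_prod \<eta>)\<bar> < e)"
proof -
  obtain N C where C: "0 \<le> C" "\<And>M K. bounded_upto V N K M \<Longrightarrow> \<bar>\<phi> M\<bar> \<le> C * K"
    using moment_comb_bounded[OF \<phi>] by blast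
  define A where "A M = (\<lambda>B. dual_gen M B + real N * M B)" for M
  have A_bounded: "bounded_upto V N (real N ^ k) ((A ^^ k) M)" if "unit_bounded M" for k M
  proof (induction k)
    case 0
    show ?case using that by (simp add: unit_bounded_def bounded_upto_def)
  next
    case (Suc k)
    then show ?case
      using dual_gen_plus_bound[OF Suc] by (simp add: bounded_upto_def A_def)
  qed
  have A_comb: "moment_comb V (\<lambda>M. \<theta> (A M))" if "moment_comb V \<theta>" for \<theta>
  proof -
    have "\<theta> (A M) = \<theta> (dual_gen M) + real N * \<theta> M" for M
      using moment_comb_linear[OF that, of 1 "dual_gen M" "real N" M] by (simp add: A_def)
    then show ?thesis
      using moment_comb_add[OF moment_comb_dual_gen[OF that] moment_comb_cmult[OF that]] by simp
  qed
  have A_pow: "moment_comb V (\<lambda>M. \<phi> ((A ^^ k) M))" for k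
  proof (induction k)
    case (Suc k)
    from A_comb[OF this] show ?case by (simp add: funpow_swap1)
  qed (use \<phi> in simp)
  have dual: "\<theta> (dual_gen M) = \<theta> (A M) - real N * \<theta> M" if "moment_comb V \<theta>" for \<theta> M
    using moment_comb_linear[OF that, of 1 "dual_gen M" "real N" M] by (simp add: A_def)
  define q where "q = real N / (1 + real N)"
  have q: "0 \<le> q" "q < 1" by (auto simp: q_def)
  have "(\<lambda>n. C * q ^ n) \<longlonglongrightarrow> 0"
    using q by (intro tendsto_mult_right_zero LIMSEQ_realpow_zero)
  from order_tendstoD(2)[OF this e] obtain n where n: "C * q ^ n < e"
    by (auto simp: eventually_sequentially)
  define \<psi> where "\<psi> M = (\<Sum>k<n. 1 / (1 + real N) ^ Suc k * \<phi> ((A ^^ k) M))" for M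
  have \<psi>: "moment_comb V \<psi>"
    unfolding \<psi>_def[abs_def] by (intro moment_comb_sum moment_comb_cmult A_pow)
  have cancel: "c * (1 / c ^ Suc k * x) = x / c ^ k" if "c \<noteq> 0" for c x :: real and k
    using that by simp
  \<comment> \<open>The Neumann series telescopes, up to its remainder.\<close>
  have tele: "\<psi> M - \<psi> (dual_gen M) = \<phi> M - \<phi> ((A ^^ n) M) / (1 + real N) ^ n" for M
  proof -
    have "\<psi> M - \<psi> (dual_gen M) = (1 + real N) * \<psi> M - \<psi> (A M)"
      unfolding dual[OF \<psi>] by (simp add: algebra_simps)
    also have "(1 + real N) * \<psi> M = (\<Sum>k<n. \<phi> ((A ^^ k) M) / (1 + real N) ^ k)"
      unfolding \<psi>_def sum_distrib_left by (intro sum.cong refl cancel) simp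
    also have "\<psi> (A M) = (\<Sum>k<n. \<phi> ((A ^^ Suc k) M) / (1 + real N) ^ Suc k)"
      unfolding \<psi>_def by (intro sum.cong refl) (simp add: funpow_swap1)
    also have "(\<Sum>k<n. \<phi> ((A ^^ k) M) / (1 + real N) ^ k) - (\<Sum>k<n. \<phi> ((A ^^ Suc k) M) / (1 + real N) ^ Suc k)
        = \<phi> M - \<phi> ((A ^^ n) M) / (1 + real N) ^ n"
      using sum_lessThan_telescope'[of "\<lambda>k. \<phi> ((A ^^ k) M) / (1 + real N) ^ k" n]
      by (simp only: sum_subtractf) simp
    finally show ?thesis .
  qed
  have "\<bar>\<psi> (spin_prod \<eta>) - \<psi> (dual_gen (spin_prod \<eta>)) - \<phi> (spin_prod \<eta>)\<bar> < e" if "\<eta> \<in> configs V" for \<eta>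
  proof -
    have "\<bar>\<phi> ((A ^^ n) (spin_prod \<eta>))\<bar> \<le> C * real N ^ n"
      by (rule C(2)[OF A_bounded[OF unit_bounded_spin_prod[OF that]]])
    then have "\<bar>\<phi> ((A ^^ n) (spin_prod \<eta>))\<bar> / (1 + real N) ^ n \<le> C * real N ^ n / (1 + real N) ^ n"
      by (rule divide_right_mono) simp
    also have "\<dots> = C * q ^ n" by (simp add: q_def power_divide)
    finally show ?thesis using n unfolding tele by simp
  qed
  with \<psi> show ?thesis by blast
qed

text \<open>The standard core argument: solve \<open>u - generator u = f - g\<close> approximately by a cylinder
function \<open>u\<close>; dissipativity forces \<open>u\<close> to be close to \<open>f\<close>, and then
the equation forces its image to be close to \<open>g\<close>.\<close>

lemma generator_subset_closure:
  assumes fg: "(f, g) \<in> generator V voter_semigroup"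
  shows "(f, g) \<in> voter_op_closure V E s"
proof -
  have f: "f \<in> conts V" and g: "g \<in> conts V" using fg unfolding voter_generator_iff by blast+
  have "\<exists>\<psi>. moment_comb V \<psi> \<and> (\<forall>\<eta>\<in>configs V.
      \<bar>\<psi> (spin_prod \<eta>) - f \<eta>\<bar> < \<epsilon> \<and> \<bar>\<psi> (dual_gen (spin_prod \<eta>)) - g \<eta>\<bar> < \<epsilon>)" if \<epsilon>: "0 < \<epsilon>" for \<epsilon>
  proof -
    \<comment> \<open>By dissipativity u differs from f by at most two fifths; through the equation the images
      differ by at most two fifths more.\<close>
    have \<epsilon>5: "0 < \<epsilon> / 5" using \<epsilon> by simp
    obtain \<phi> where \<phi>: "moment_comb V \<phi>" and \<phi>_all: "\<forall>\<eta>\<in>configs V. \<bar>(f \<eta> - g \<eta>) - \<phi> (spin_prod \<eta>)\<bar> < \<epsilon> / 5"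
      using conts_approx[OF conts_diff[OF f g] \<epsilon>5] by blast
    obtain \<psi> where \<psi>: "moment_comb V \<psi>" and \<psi>_all: "\<forall>\<eta>\<in>configs V.
        \<bar>\<psi> (spin_prod \<eta>) - \<psi> (dual_gen (spin_prod \<eta>)) - \<phi> (spin_prod \<eta>)\<bar> < \<epsilon> / 5"
      using resolvent_range_dense[OF \<phi> \<epsilon>5] by blast
    let ?u = "\<lambda>\<eta>. \<psi> (spin_prod \<eta>)" and ?v = "\<lambda>\<eta>. \<psi> (dual_gen (spin_prod \<eta>))"
    have "(?u, ?v) \<in> voter_op_closure V E s"
      unfolding voter_op_closure_iff
      by (intro conjI moment_comb_conts moment_comb_dual_gen \<psi> allI impI exI[of _ \<psi>]) auto
    then have uv: "(?u, ?v) \<in> generator V voter_semigroup" by (rule closure_subset_generator)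
    have "(\<lambda>\<eta>. ?u \<eta> - f \<eta>, \<lambda>\<eta>. ?v \<eta> - g \<eta>) \<in> generator V voter_semigroup"
      unfolding voter_generator_iff
    proof (intro conjI allI impI)
      show "(\<lambda>\<eta>. ?u \<eta> - f \<eta>) \<in> conts V" "(\<lambda>\<eta>. ?v \<eta> - g \<eta>) \<in> conts V"
        by (intro conts_diff f g moment_comb_conts moment_comb_dual_gen \<psi>)+
      fix e :: real assume "0 < e"
      then have e2: "0 < e / 2" by simp
      obtain d1 where d1: "0 < d1" "\<And>t \<eta>. 0 < t \<Longrightarrow> t < d1 \<Longrightarrow> \<eta> \<in> configs V \<Longrightarrow>
          \<bar>(voter_semigroup t ?u \<eta> - ?u \<eta>) / t - ?v \<eta>\<bar> < e / 2"
        by (rule voter_generatorD[OF uv e2]) (rule that)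
      obtain d2 where d2: "0 < d2" "\<And>t \<eta>. 0 < t \<Longrightarrow> t < d2 \<Longrightarrow> \<eta> \<in> configs V \<Longrightarrow>
          \<bar>(voter_semigroup t f \<eta> - f \<eta>) / t - g \<eta>\<bar> < e / 2"
        by (rule voter_generatorD[OF fg e2]) (rule that)
      show "\<exists>\<delta>>0. \<forall>t>0. t < \<delta> \<longrightarrow> (\<forall>\<eta>\<in>configs V.
          \<bar>(voter_semigroup t (\<lambda>\<eta>. ?u \<eta> - f \<eta>) \<eta> - (?u \<eta> - f \<eta>)) / t - (?v \<eta> - g \<eta>)\<bar> < e)"
      proof (intro exI[of _ "min d1 d2"] conjI allI impI ballI)
        show "0 < min d1 d2" using d1 d2 by simp
        fix t \<eta> assume "0 < t" "t < min d1 d2" and \<eta>: "\<eta> \<in> configs V"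
        then have t: "0 < t" "t < d1" "t < d2" by auto
        have "voter_semigroup t (\<lambda>\<eta>. ?u \<eta> - f \<eta>) \<eta> = voter_semigroup t ?u \<eta> - voter_semigroup t f \<eta>"
          using semigroup_linear[OF moment_comb_conts[OF \<psi>] f \<eta> less_imp_le[OF t(1)], of 1 "-1"] by simp
        then have "(voter_semigroup t (\<lambda>\<eta>. ?u \<eta> - f \<eta>) \<eta> - (?u \<eta> - f \<eta>)) / t - (?v \<eta> - g \<eta>) =
            ((voter_semigroup t ?u \<eta> - ?u \<eta>) / t - ?v \<eta>) - ((voter_semigroup t f \<eta> - f \<eta>) / t - g \<eta>)"
          by (simp add: diff_divide_distrib)
        then show "\<bar>(voter_semigroup t (\<lambda>\<eta>. ?u \<eta> - f \<eta>) \<eta> - (?u \<eta> - f \<eta>)) / t - (?v \<eta> - g \<eta>)\<bar> < e"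
          using d1(2)[OF t(1,2) \<eta>] d2(2)[OF t(1,3) \<eta>] by linarith
      qed
    qed
    note diff = this
    have "\<bar>(?u \<zeta> - f \<zeta>) - (?v \<zeta> - g \<zeta>)\<bar> \<le> 2 * (\<epsilon> / 5)" if "\<zeta> \<in> configs V" for \<zeta>
      using bspec[OF \<phi>_all that] bspec[OF \<psi>_all that] by linarith
    then have u: "\<bar>?u \<eta> - f \<eta>\<bar> \<le> 2 * (\<epsilon> / 5)" if "\<eta> \<in> configs V" for \<eta>
      using that by (rule generator_dissipative[OF diff])
    have "\<bar>?u \<eta> - f \<eta>\<bar> < \<epsilon> \<and> \<bar>?v \<eta> - g \<eta>\<bar> < \<epsilon>" if "\<eta> \<in> configs V" for \<eta>
      using u[OF that] bspec[OF \<phi>_all that] bspec[OF \<psi>_all that] \<epsilon> by linarith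
    with \<psi> show ?thesis by blast
  qed
  with f g show ?thesis unfolding voter_op_closure_iff by blast
qed

theorem signed_voter_model_semigroup: "signed_voter_model V E s voter_semigroup"
proof -
  have "generator V voter_semigroup = voter_op_closure V E s"
    using closure_subset_generator generator_subset_closure by (auto simp: set_eq_iff)
  with markov_semigroup_voter show ?thesis by (simp add: signed_voter_model_def)
qed

end

section \<open>Equilibria from signed harmonic functions\<close>

text \<open>These are the moments of independent spins with means \<open>h\<close>. Starting from a
configuration, the spins are replaced by means one site at a time, and each replacement is a convex
combination of the two values of the spin.\<close>

lemma product_moments_positive:
  assumes h: "\<And>x. x \<in> V \<Longrightarrow> \<bar>h x\<bar> \<le> 1"
  shows "positive_moments V (\<lambda>B. \<Prod>x\<in>B. h x)"
  unfolding positive_moments_def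
proof (intro allI impI)
  fix \<phi> assume \<phi>: "moment_comb V \<phi>" and nonneg: "\<forall>\<eta>\<in>configs V. 0 \<le> \<phi> (spin_prod \<eta>)"
  define M where "M F \<eta> B = (\<Prod>x\<in>B \<inter> F. h x) * spin_prod \<eta> (B - F)" for F B and \<eta> :: "'a \<Rightarrow> int"
  have pos: "0 \<le> \<phi> (M F \<eta>)" if "finite F" "F \<subseteq> V" "\<eta> \<in> configs V" for F \<eta>
    using that
  proof (induction F arbitrary: \<eta> rule: finite_induct)
    case empty
    have "M {} \<eta> = spin_prod \<eta>" by (simp add: M_def fun_eq_iff)
    then show ?case using nonneg empty by simp
  next
    case (insert x F)
    then have x: "x \<in> V" "F \<subseteq> V" by auto
    have "M (insert x F) \<eta> B = (1 + h x) / 2 * M F (\<eta>(x := 1)) B + (1 - h x) / 2 * M F (\<eta>(x := -1)) B"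
      if B: "B \<in> Fpow V" for B
    proof (cases "x \<in> B")
      case True
      have fin: "finite B" using B by (simp add: Fpow_def)
      have D: "B - F = insert x (B - insert x F)" using True insert.hyps by auto
      have "spin_prod (\<eta>(x := c)) (B - F) = of_int c * spin_prod (\<eta>(x := c)) (B - insert x F)" for c
        unfolding D using fin by (simp add: spin_prod_def)
      moreover have "spin_prod (\<eta>(x := c)) (B - insert x F) = spin_prod \<eta> (B - insert x F)" for c
        by (rule spin_prod_cong) auto
      moreover have "B \<inter> insert x F = insert x (B \<inter> F)" using True by auto
      ultimately show ?thesis
        using fin insert.hyps by (simp add: M_def field_simps)
    next
      case False
      then have "spin_prod (\<eta>(x := c)) (B - F) = spin_prod \<eta> (B - F)" for c
        by (intro spin_prod_cong) auto
      moreover have "B \<inter> insert x F = B \<inter> F" "B - insert x F = B - F" using False by auto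
      ultimately show ?thesis by (simp add: M_def field_simps)
    qed
    then have "\<phi> (M (insert x F) \<eta>) =
        \<phi> (\<lambda>B. (1 + h x) / 2 * M F (\<eta>(x := 1)) B + (1 - h x) / 2 * M F (\<eta>(x := -1)) B)"
      by (rule moment_comb_cong[OF \<phi>])
    also have "\<dots> = (1 + h x) / 2 * \<phi> (M F (\<eta>(x := 1))) + (1 - h x) / 2 * \<phi> (M F (\<eta>(x := -1)))"
      by (rule moment_comb_linear[OF \<phi>])
    finally have "\<phi> (M (insert x F) \<eta>) =
        (1 + h x) / 2 * \<phi> (M F (\<eta>(x := 1))) + (1 - h x) / 2 * \<phi> (M F (\<eta>(x := -1)))" .
    moreover have "0 \<le> \<phi> (M F (\<eta>(x := 1)))" "0 \<le> \<phi> (M F (\<eta>(x := -1)))"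
      by (intro insert.IH x(2) configs_upd[OF insert.prems(2) x(1)]; simp)+
    ultimately show ?case using h[OF x(1)] by simp
  qed
  obtain A where A: "A \<in> Fpow V" "\<forall>M N. (\<forall>B\<in>Fpow A. M B = N B) \<longrightarrow> \<phi> M = \<phi> N"
    using moment_comb_finite_support[OF \<phi>] by blast
  obtain \<eta> where \<eta>: "\<eta> \<in> configs V" using configs_nonempty[of V] by (meson ex_in_conv)
  have "M A \<eta> B = (\<Prod>x\<in>B. h x)" if "B \<in> Fpow A" for B
  proof -
    have eq: "B \<inter> A = B" "B - A = {}" using that by (auto simp: Fpow_def)
    show ?thesis unfolding M_def eq by simp
  qed
  then have "\<phi> (\<lambda>B. \<Prod>x\<in>B. h x) = \<phi> (M A \<eta>)"
    by (intro A(2)[rule_format]) simp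
  then show "0 \<le> \<phi> (\<lambda>B. \<Prod>x\<in>B. h x)"
    using pos[of A \<eta>] A(1) \<eta> by (simp add: Fpow_def)
qed

lemma geom_bounded_case_nat:
  assumes "geom_bounded C R a"
  shows "geom_bounded C (R + 1) (case_nat 0 a)"
proof -
  have C: "0 \<le> C" and R: "0 \<le> R" using geom_bounded_nonneg geom_boundedD(2) assms by blast+
  have "\<bar>case_nat 0 a k\<bar> \<le> C * (R + 1) ^ k" for k
  proof (cases k)
    case (Suc m)
    have "\<bar>a m\<bar> \<le> C * R ^ m" by (rule geom_boundedD(1)[OF assms])
    also have "\<dots> \<le> C * ((R + 1) * (R + 1) ^ m)"
    proof (rule mult_left_mono[OF _ C])
      have "R ^ m \<le> 1 * (R + 1) ^ m" using R by (simp add: power_mono)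
      also have "\<dots> \<le> (R + 1) * (R + 1) ^ m" using R by (intro mult_right_mono) auto
      finally show "R ^ m \<le> (R + 1) * (R + 1) ^ m" .
    qed
    finally show ?thesis by (simp add: Suc)
  qed (use C in simp)
  then show ?thesis using R by (simp add: geom_bounded_def)
qed

lemma compact_cube: "compact {M :: 'b \<Rightarrow> real. \<forall>B. M B \<in> {-1..1}}"
proof -
  have "compactin (product_topology (\<lambda>_. euclidean) UNIV) (PiE UNIV (\<lambda>_::'b. {-1..1::real}))"
    unfolding compactin_PiE by (simp add: compactin_euclidean_iff)
  then have "compact (PiE UNIV (\<lambda>_::'b. {-1..1::real}))"
    by (simp add: euclidean_product_topology compactin_euclidean_iff)
  moreover have "PiE UNIV (\<lambda>_::'b. {-1..1::real}) = {M. \<forall>B. M B \<in> {-1..1}}"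
    by (auto simp: PiE_def Pi_def)
  ultimately show ?thesis by simp
qed

context signed_graph
begin

text \<open>The integral of the flow over \<open>[0, t]\<close>, integrated term by term.\<close>

definition flow_integral :: "real \<Rightarrow> ('a set \<Rightarrow> real) \<Rightarrow> 'a set \<Rightarrow> real" where
  "flow_integral t M B = exp_series (case_nat 0 (\<lambda>k. (dual_gen ^^ k) M B)) t"

lemma moment_comb_flow_integral:
  assumes "moment_comb V \<phi>" "unit_bounded M"
  shows "\<phi> (flow_integral t M) = exp_series (case_nat 0 (\<lambda>k. \<phi> ((dual_gen ^^ k) M))) t"
proof -
  have "(\<lambda>k. \<phi> (\<lambda>B. (case k of 0 \<Rightarrow> 0 | Suc m \<Rightarrow> t ^ k / fact k) * (dual_gen ^^ (k - 1)) M B)) sums \<phi> (flow_integral t M)"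
  proof (rule moment_comb_sums[OF assms(1)])
    fix B assume "B \<in> Fpow V"
    then obtain C R where "geom_bounded C R (\<lambda>k. (dual_gen ^^ k) M B)"
      using moment_comb_geom_bounded[OF moment_comb_eval] assms(2) by blast
    from exp_series_sums[OF geom_bounded_case_nat[OF this], of t]
    show "(\<lambda>k. (case k of 0 \<Rightarrow> 0 | Suc m \<Rightarrow> t ^ k / fact k) * (dual_gen ^^ (k - 1)) M B) sums flow_integral t M B"
      unfolding flow_integral_def by (rule sums_cong[THEN iffD1, rotated]) (auto split: nat.split)
  qed
  moreover have "\<phi> (\<lambda>B. (case k of 0 \<Rightarrow> 0 | Suc m \<Rightarrow> t ^ k / fact k) * (dual_gen ^^ (k - 1)) M B) =
      case_nat 0 (\<lambda>k. \<phi> ((dual_gen ^^ k) M)) k / fact k * t ^ k" for k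
    unfolding moment_comb_scale[OF assms(1)] by (auto split: nat.split)
  ultimately show ?thesis by (simp add: exp_series_def sums_iff)
qed

lemma flow_integral_deriv:
  assumes "moment_comb V \<phi>" "unit_bounded M"
  shows "((\<lambda>t. \<phi> (flow_integral t M)) has_real_derivative \<phi> (flow t M)) (at t)"
proof -
  obtain C R where a: "geom_bounded C R (\<lambda>k. \<phi> ((dual_gen ^^ k) M))"
    using moment_comb_geom_bounded[OF assms(1)] assms(2) by blast
  from exp_series_deriv[OF geom_bounded_case_nat[OF a], of t] show ?thesis
    by (simp add: moment_comb_flow[OF assms] moment_comb_flow_integral[OF assms] fun_eq_iff)
qed

text \<open>The generator applied to the integral telescopes to a boundary term, which stays bounded in
\<open>t\<close>. This is why time averages become stationary.\<close>

lemma dual_gen_flow_integral: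
  assumes "B \<in> Fpow V" "unit_bounded M"
  shows "dual_gen (flow_integral t M) B = flow t M B - M B"
proof -
  have ev: "moment_comb V (\<lambda>M. M B)" by (rule moment_comb_eval[OF assms(1)])
  have comb: "moment_comb V (\<lambda>M. dual_gen M B)" by (rule moment_comb_dual_gen_eval[OF assms(1)])
  obtain C R where a: "geom_bounded C R (\<lambda>k. (dual_gen ^^ k) M B)"
    using moment_comb_geom_bounded[OF ev] assms(2) by blast
  have "(\<lambda>k. (dual_gen ^^ k) M B / fact k * t ^ k) sums flow t M B"
    using exp_series_sums[OF a] by (simp add: flow_def)
  moreover have "(\<lambda>k. (if k = 0 then M B else 0)) sums M B"
    using sums_single[of 0 "\<lambda>_. M B"] by simp
  ultimately have "(\<lambda>k. (dual_gen ^^ k) M B / fact k * t ^ k - (if k = 0 then M B else 0)) sums (flow t M B - M B)"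
    by (rule sums_diff)
  moreover have "(dual_gen ^^ k) M B / fact k * t ^ k - (if k = 0 then M B else 0) =
      case_nat 0 (\<lambda>k. dual_gen ((dual_gen ^^ k) M) B) k / fact k * t ^ k" for k
    by (auto split: nat.split)
  ultimately show ?thesis
    unfolding moment_comb_flow_integral[OF comb assms(2)] exp_series_def by (simp add: sums_iff)
qed

lemma flow_positive_moments:
  assumes "positive_moments V M" "M {} = 1" "0 \<le> t"
  shows "positive_moments V (flow t M)"
  unfolding positive_moments_def
proof (intro allI impI)
  fix \<phi> assume \<phi>: "moment_comb V \<phi>" and nonneg: "\<forall>\<eta>\<in>configs V. 0 \<le> \<phi> (spin_prod \<eta>)"
  obtain \<mu> where \<mu>: "prob_space \<mu>" "sets \<mu> = sets (config_algebra V)"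
    and M: "\<forall>B\<in>Fpow V. (\<integral>\<eta>. spin_prod \<eta> B \<partial>\<mu>) = M B"
    using moment_measure_exists[OF assms(1,2)] by blast
  have "\<phi> (flow t M) = (\<integral>\<zeta>. \<phi> (flow t (spin_prod \<zeta>)) \<partial>\<mu>)"
    using M by (intro expectation_flow[symmetric, OF \<mu> \<phi>] unit_bounded_positive assms) auto
  also have "\<dots> \<ge> 0"
    using sets_eq_imp_space_eq[OF \<mu>(2)] nonneg
    by (intro Bochner_Integration.integral_nonneg_AE AE_I2 positive_momentsD[OF flow_positive \<phi>] assms) auto
  finally show "0 \<le> \<phi> (flow t M)" .
qed

lemma flow_integral_positive:
  assumes "positive_moments V M" "M {} = 1" "0 \<le> t"
  shows "positive_moments V (flow_integral t M)"
  unfolding positive_moments_def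
proof (intro allI impI)
  fix \<phi> assume \<phi>: "moment_comb V \<phi>" and nonneg: "\<forall>\<eta>\<in>configs V. 0 \<le> \<phi> (spin_prod \<eta>)"
  have u: "unit_bounded M" by (rule unit_bounded_positive[OF assms(1,2)])
  have "\<phi> (flow_integral 0 M) \<le> \<phi> (flow_integral t M)"
  proof (rule DERIV_nonneg_imp_nondecreasing[OF assms(3)])
    fix r :: real assume "0 \<le> r"
    then have "0 \<le> \<phi> (flow r M)"
      using positive_momentsD[OF flow_positive_moments[OF assms(1,2)] \<phi>] nonneg by blast
    then show "\<exists>y. ((\<lambda>t. \<phi> (flow_integral t M)) has_real_derivative y) (at r) \<and> 0 \<le> y"
      using flow_integral_deriv[OF \<phi> u] by blast
  qed
  then show "0 \<le> \<phi> (flow_integral t M)" by (simp add: moment_comb_flow_integral[OF \<phi> u])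
qed

lemma flow_integral_fixed:
  assumes "\<And>k. (dual_gen ^^ Suc k) M B = 0"
  shows "flow_integral t M B = t * M B"
proof -
  have "flow_integral t M B = (\<Sum>k\<in>{1}. case_nat 0 (\<lambda>k. (dual_gen ^^ k) M B) k / fact k * t ^ k)"
    unfolding flow_integral_def exp_series_def
  proof (rule suminf_finite)
    fix k :: nat assume "k \<notin> {1}"
    then consider "k = 0" | m where "k = Suc (Suc m)" by (metis One_nat_def insertI1 not0_implies_Suc)
    then show "case_nat 0 (\<lambda>k. (dual_gen ^^ k) M B) k / fact k * t ^ k = 0"
      using assms by cases simp_all
  qed simp
  then show ?thesis by simp
qed

lemma dual_gen_empty: "dual_gen M {} = 0"
  by (simp add: dual_gen_def)

lemma dual_gen_singleton:
  assumes "x \<in> V"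
  shows "dual_gen M {x} = (\<Sum>y\<in>nbrs E x. of_int (s {x, y}) * M {y}) / real (deg E x) - M {x}"
proof -
  have "sym_diff {x} {x, y} = {y}" if "y \<in> nbrs E x" for y
    using nbrs_D(3)[OF that] by auto
  then show ?thesis by (simp add: dual_gen_def)
qed

text \<open>A single walk remains a single walk, so the moments of order one evolve autonomously.\<close>

lemma dual_gen_power_harmonic:
  assumes "\<And>x. x \<in> V \<Longrightarrow> dual_gen M {x} = 0" "x \<in> V"
  shows "(dual_gen ^^ Suc k) M {x} = 0"
  using assms(2)
proof (induction k arbitrary: x)
  case (Suc k)
  have "(dual_gen ^^ Suc k) M {y} = 0" if "y \<in> nbrs E x" for y
    using Suc.IH nbrs_D(2)[OF that] by blast
  moreover have "(dual_gen ^^ Suc k) M {x} = 0" using Suc by blast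
  ultimately show ?case
    using dual_gen_singleton[OF Suc.prems, of "(dual_gen ^^ Suc k) M"] by simp
qed (use assms in simp)

text \<open>The Krylov--Bogolyubov argument on moment functions. The time averages lie in the compact cube of
functions with values in \<open>[-1, 1]\<close>. All properties required of the limit are closed
conditions on coordinates, so a cluster point has them.\<close>

lemma stationary_moments_exist:
  assumes M0: "positive_moments V M0" "M0 {} = 1" and harm: "\<And>x. x \<in> V \<Longrightarrow> dual_gen M0 {x} = 0"
  shows "\<exists>M. positive_moments V M \<and> M {} = 1 \<and> (\<forall>B\<in>Fpow V. dual_gen M B = 0) \<and> (\<forall>x\<in>V. M {x} = M0 {x})"
proof -
  have u: "unit_bounded M0" by (rule unit_bounded_positive[OF M0])
  define N where "N n B = (if B \<in> Fpow V then 1 / real (Suc n) * flow_integral (real (Suc n)) M0 B else 0)" for n B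
  have N_eq: "\<phi> (N n) = 1 / real (Suc n) * \<phi> (flow_integral (real (Suc n)) M0)" if "moment_comb V \<phi>" for \<phi> n
    unfolding moment_comb_scale[OF that, symmetric] by (rule moment_comb_cong[OF that]) (simp add: N_def)
  have N_pos: "positive_moments V (N n)" for n
    unfolding positive_moments_def
  proof (intro allI impI)
    fix \<phi> assume \<phi>: "moment_comb V \<phi>" and nonneg: "\<forall>\<eta>\<in>configs V. 0 \<le> \<phi> (spin_prod \<eta>)"
    have "0 \<le> \<phi> (flow_integral (real (Suc n)) M0)"
      by (rule positive_momentsD[OF flow_integral_positive[OF M0] \<phi>]) (use nonneg in auto)
    then show "0 \<le> \<phi> (N n)" unfolding N_eq[OF \<phi>] by simp
  qed
  have empty: "{} \<in> Fpow V" by (simp add: Fpow_def)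
  have fixed: "N n B = M0 B" if "B \<in> Fpow V" "\<And>k. (dual_gen ^^ Suc k) M0 B = 0" for n B
    using flow_integral_fixed[OF that(2)] that(1) by (simp add: N_def del: of_nat_Suc)
  have N_empty: "N n {} = 1" for n
    using fixed[OF empty] by (simp add: dual_gen_empty M0(2))
  have N_single: "N n {x} = M0 {x}" if "x \<in> V" for n x
    using dual_gen_power_harmonic[OF harm that] that by (intro fixed) (auto simp: Fpow_def)
  have N_dual: "\<bar>dual_gen (N n) B\<bar> \<le> 2 / real (Suc n)" if B: "B \<in> Fpow V" for n B
  proof -
    have "\<bar>flow (real (Suc n)) M0 B\<bar> \<le> 1"
      using positive_moments_abs[OF flow_positive_moments[OF M0] B] by (simp add: flow_empty M0(2))
    moreover have "\<bar>M0 B\<bar> \<le> 1" using u B by (simp add: unit_bounded_def)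
    ultimately have "\<bar>flow (real (Suc n)) M0 B - M0 B\<bar> \<le> 2" by linarith
    then show ?thesis
      unfolding N_eq[OF moment_comb_dual_gen_eval[OF B]] dual_gen_flow_integral[OF B u]
      by (simp add: abs_mult divide_right_mono)
  qed
  let ?F = "filtermap N sequentially" and ?K = "{M :: 'a set \<Rightarrow> real. \<forall>B. M B \<in> {-1..1}}"
  have ev: "eventually P ?F" if "\<And>n. P (N n)" for P
    using that by (simp add: eventually_filtermap)
  have "N n \<in> ?K" for n
  proof -
    have "\<bar>N n B\<bar> \<le> 1" for B
      using positive_moments_abs[OF N_pos, of B n] N_empty[of n] by (cases "B \<in> Fpow V") (auto simp: N_def)
    then show ?thesis by (auto simp: abs_le_iff minus_le_iff)
  qed
  then have "eventually (\<lambda>M. M \<in> ?K) ?F" by (rule ev)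
  moreover have "?F \<noteq> bot" by (simp add: filtermap_bot_iff)
  ultimately obtain M where "inf (nhds M) ?F \<noteq> bot"
    using compact_cube[where ?'b = "'a set"] unfolding compact_filter by blast
  \<comment> \<open>Along this filter the averages converge to the cluster point M.\<close>
  define G where "G = inf (nhds M) ?F"
  have G: "G \<noteq> bot" using \<open>inf (nhds M) ?F \<noteq> bot\<close> by (simp add: G_def)
  have evG: "eventually P G" if "\<And>n. P (N n)" for P
    using ev[of P, OF that] filter_leD[of G ?F P] by (simp add: G_def)
  have coord: "((\<lambda>M. M B) \<longlongrightarrow> M B) G" for B
  proof -
    have "((\<lambda>M. M B) \<longlongrightarrow> M B) (nhds M)"
    proof (rule topological_tendstoI)
      fix S :: "real set" assume "open S" "M B \<in> S"
      then show "eventually (\<lambda>M. M B \<in> S) (nhds M)"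
        unfolding eventually_nhds
        using open_vimage[OF _ continuous_on_product_coordinates[of B], of S]
        by (intro exI[of _ "(\<lambda>M. M B) -` S"]) auto
    qed
    then show ?thesis by (rule tendsto_mono[rotated]) (simp add: G_def)
  qed
  have comb: "((\<lambda>M. \<phi> M) \<longlongrightarrow> \<phi> M) G" if "moment_comb V \<phi>" for \<phi>
    by (rule moment_comb_tendsto[OF that coord])
  have "positive_moments V M"
    unfolding positive_moments_def
  proof (intro allI impI)
    fix \<phi> assume \<phi>: "moment_comb V \<phi>" and nonneg: "\<forall>\<eta>\<in>configs V. 0 \<le> \<phi> (spin_prod \<eta>)"
    have "eventually (\<lambda>M. 0 \<le> \<phi> M) G"
      by (rule evG) (use positive_momentsD[OF N_pos \<phi>] nonneg in blast)
    then show "0 \<le> \<phi> M" by (rule tendsto_lowerbound[OF comb[OF \<phi>] _ G])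
  qed
  moreover have const: "M B = c" if "\<And>n. N n B = c" for B c
  proof -
    have "eventually (\<lambda>M. M B = c) G" by (rule evG) (rule that)
    then have "((\<lambda>M. M B) \<longlongrightarrow> c) G" by (rule tendsto_eventually)
    with coord show ?thesis using G tendsto_unique by blast
  qed
  moreover have "dual_gen M B = 0" if B: "B \<in> Fpow V" for B
  proof (rule eq_if_close)
    fix e :: real assume "0 < e"
    have "(\<lambda>n. 2 * inverse (real (Suc n))) \<longlonglongrightarrow> 0"
      by (intro tendsto_mult_right_zero LIMSEQ_inverse_real_of_nat)
    from order_tendstoD(2)[OF this \<open>0 < e\<close>]
    have "eventually (\<lambda>n. \<bar>dual_gen (N n) B\<bar> \<le> e) sequentially"
      by eventually_elim (use N_dual[OF B] in \<open>fastforce simp: divide_inverse intro: order_trans less_imp_le\<close>)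
    then have "eventually (\<lambda>M. \<bar>dual_gen M B\<bar> \<le> e) ?F" by (simp add: eventually_filtermap)
    then have "eventually (\<lambda>M. \<bar>dual_gen M B\<bar> \<le> e) G"
      using filter_leD[of G ?F] by (simp add: G_def)
    then show "\<bar>dual_gen M B - 0\<bar> \<le> e"
      using tendsto_upperbound[OF tendsto_rabs[OF comb[OF moment_comb_dual_gen_eval[OF B]]] _ G] by simp
  qed
  ultimately show ?thesis using N_empty N_single by blast
qed

lemma stationary_moments_equilibrium:
  assumes M: "positive_moments V M" "M {} = 1" "\<And>B. B \<in> Fpow V \<Longrightarrow> dual_gen M B = 0"
  shows "\<exists>\<mu>. equilibrium V voter_semigroup \<mu> \<and> (\<forall>B\<in>Fpow V. (\<integral>\<eta>. spin_prod \<eta> B \<partial>\<mu>) = M B)"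
proof -
  obtain \<mu> where \<mu>: "prob_space \<mu>" "sets \<mu> = sets (config_algebra V)"
    and mom: "\<And>B. B \<in> Fpow V \<Longrightarrow> (\<integral>\<eta>. spin_prod \<eta> B \<partial>\<mu>) = M B"
    using moment_measure_exists[OF M(1,2)] by blast
  have u: "unit_bounded M" by (rule unit_bounded_positive[OF M(1,2)])
  have "(\<integral>\<eta>. voter_semigroup t f \<eta> \<partial>\<mu>) = (\<integral>\<eta>. f \<eta> \<partial>\<mu>)" if t: "0 \<le> t" and f: "f \<in> conts V" for t f
  proof (rule eq_if_close)
    fix e :: real assume "0 < e"
    then have e2: "0 < e / 2" by simp
    obtain \<phi> where \<phi>: "moment_comb V \<phi>" and close: "\<And>\<eta>. \<eta> \<in> configs V \<Longrightarrow> \<bar>f \<eta> - \<phi> (spin_prod \<eta>)\<bar> < e / 2"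
      and flow: "\<And>t \<eta>. \<eta> \<in> configs V \<Longrightarrow> 0 \<le> t \<Longrightarrow> \<bar>voter_semigroup t f \<eta> - \<phi> (flow t (spin_prod \<eta>))\<bar> \<le> e / 2"
      by (rule semigroup_approx[OF f e2]) (rule that)
    have "\<bar>(\<integral>\<eta>. voter_semigroup t f \<eta> \<partial>\<mu>) - (\<integral>\<eta>. \<phi> (flow t (spin_prod \<eta>)) \<partial>\<mu>)\<bar> \<le> e / 2"
      by (rule expectation_close[OF \<mu> semigroup_conts[OF f t] flow_conts[OF \<phi>] flow[OF _ t]])
    moreover have "\<bar>(\<integral>\<eta>. f \<eta> \<partial>\<mu>) - (\<integral>\<eta>. \<phi> (spin_prod \<eta>) \<partial>\<mu>)\<bar> \<le> e / 2"
      by (rule expectation_close[OF \<mu> f moment_comb_conts[OF \<phi>] less_imp_le[OF close]])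
    moreover have "(\<integral>\<eta>. \<phi> (flow t (spin_prod \<eta>)) \<partial>\<mu>) = (\<integral>\<eta>. \<phi> (spin_prod \<eta>) \<partial>\<mu>)"
      using expectation_flow[OF \<mu> \<phi> mom u] expectation_moment_comb[OF \<mu> \<phi> mom] flow_stationary[OF \<phi> u M(3)]
      by simp
    ultimately show "\<bar>(\<integral>\<eta>. voter_semigroup t f \<eta> \<partial>\<mu>) - (\<integral>\<eta>. f \<eta> \<partial>\<mu>)\<bar> \<le> e" by linarith
  qed
  with \<mu> mom show ?thesis unfolding equilibrium_def by blast
qed

theorem harmonic_equilibrium:
  assumes h: "\<And>x. x \<in> V \<Longrightarrow> \<bar>h x\<bar> \<le> 1"
    and harm: "\<And>x. x \<in> V \<Longrightarrow> (\<Sum>y\<in>nbrs E x. of_int (s {x, y}) * h y) = real (deg E x) * h x"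
  shows "\<exists>\<mu>. equilibrium V voter_semigroup \<mu> \<and> (\<forall>x\<in>V. (\<integral>\<eta>. spin_prod \<eta> {x} \<partial>\<mu>) = h x)"
proof -
  let ?M = "\<lambda>B. \<Prod>x\<in>B. h x"
  have "dual_gen ?M {x} = 0" if "x \<in> V" for x
    using harm[OF that] deg_pos[OF that] by (simp add: dual_gen_singleton[OF that])
  from stationary_moments_exist[OF product_moments_positive[OF h] _ this]
  obtain M where M: "positive_moments V M" "M {} = 1" "\<And>B. B \<in> Fpow V \<Longrightarrow> dual_gen M B = 0"
    and single: "\<And>x. x \<in> V \<Longrightarrow> M {x} = h x" by auto
  obtain \<mu> where \<mu>: "equilibrium V voter_semigroup \<mu>"
    and mom: "\<And>B. B \<in> Fpow V \<Longrightarrow> (\<integral>\<eta>. spin_prod \<eta> B \<partial>\<mu>) = M B"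
    using stationary_moments_equilibrium[OF M] by blast
  have "(\<integral>\<eta>. spin_prod \<eta> {x} \<partial>\<mu>) = h x" if "x \<in> V" for x
    using mom[of "{x}"] single[OF that] that by (simp add: Fpow_def)
  with \<mu> show ?thesis by blast
qed

text \<open>The two equilibria belong to \<open>h\<close> and \<open>- h\<close> and differ in the mean spin at
\<open>x\<close>.\<close>

theorem harmonic_two_equilibria:
  assumes h: "\<And>x. x \<in> V \<Longrightarrow> \<bar>h x\<bar> \<le> 1"
    and harm: "\<And>x. x \<in> V \<Longrightarrow> (\<Sum>y\<in>nbrs E x. of_int (s {x, y}) * h y) = real (deg E x) * h x"
    and nz: "x \<in> V" "h x \<noteq> 0"
  shows "\<exists>\<mu> \<nu>. equilibrium V voter_semigroup \<mu> \<and> equilibrium V voter_semigroup \<nu> \<and> \<mu> \<noteq> \<nu>"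
proof -
  obtain \<mu> where \<mu>: "equilibrium V voter_semigroup \<mu>" "\<forall>x\<in>V. (\<integral>\<eta>. spin_prod \<eta> {x} \<partial>\<mu>) = h x"
    using harmonic_equilibrium[OF h harm] by blast
  have "(\<Sum>y\<in>nbrs E x. of_int (s {x, y}) * - h y) = real (deg E x) * - h x" if "x \<in> V" for x
    using harm[OF that] by (simp add: sum_negf)
  then obtain \<nu> where \<nu>: "equilibrium V voter_semigroup \<nu>" "\<forall>x\<in>V. (\<integral>\<eta>. spin_prod \<eta> {x} \<partial>\<nu>) = - h x"
    using harmonic_equilibrium[of "\<lambda>x. - h x"] h by auto
  have "\<mu> \<noteq> \<nu>" using bspec[OF \<mu>(2) nz(1)] bspec[OF \<nu>(2) nz(1)] nz(2) by auto
  with \<mu>(1) \<nu>(1) show ?thesis by blast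
qed

end

section \<open>Walks that never leave a set\<close>

text \<open>The probability that the jump chain from \<open>x\<close> stays in \<open>W\<close> for \<open>n\<close>
steps, by its first-step recursion.\<close>

primrec stay_weight :: "'a set set \<Rightarrow> 'a set \<Rightarrow> nat \<Rightarrow> 'a \<Rightarrow> real" where
  "stay_weight E W 0 x = of_bool (x \<in> W)"
| "stay_weight E W (Suc n) x = of_bool (x \<in> W) * (\<Sum>y\<in>nbrs E x. stay_weight E W n y) / real (deg E x)"

primrec walks_in :: "'a set set \<Rightarrow> 'a set \<Rightarrow> nat \<Rightarrow> 'a \<Rightarrow> 'a list set" where
  "walks_in E W 0 x = (if x \<in> W then {[x]} else {})"
| "walks_in E W (Suc n) x = (if x \<in> W then (\<Union>y\<in>nbrs E x. (#) x ` walks_in E W n y) else {})"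

lemma walks_in_intro:
  assumes "length p = Suc n" "p ! 0 = x" "\<forall>i<n. p ! Suc i \<in> nbrs E (p ! i)" "\<forall>i\<le>n. p ! i \<in> W"
  shows "p \<in> walks_in E W n x"
  using assms
proof (induction n arbitrary: p x)
  case 0
  then show ?case by (auto simp: length_Suc_conv)
next
  case (Suc n)
  then obtain q where p: "p = x # q" "length q = Suc n" by (auto simp: length_Suc_conv)
  have "q \<in> walks_in E W n (q ! 0)"
  proof (rule Suc.IH)
    show "\<forall>i<n. q ! Suc i \<in> nbrs E (q ! i)" using Suc.prems(3) by (auto simp: p dest: spec[of _ "Suc _"])
    show "\<forall>i\<le>n. q ! i \<in> W" using Suc.prems(4) by (auto simp: p dest: spec[of _ "Suc _"])
  qed (use p in auto)
  moreover have "q ! 0 \<in> nbrs E x" using Suc.prems(3) by (auto simp: p dest: spec[of _ 0])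
  moreover have "x \<in> W" using Suc.prems(4) by (auto simp: p dest: spec[of _ 0])
  ultimately show ?case by (auto simp: p)
qed

lemma walks_in_dest:
  "p \<in> walks_in E W n x \<Longrightarrow> length p = Suc n \<and> p ! 0 = x \<and> (\<forall>i<n. p ! Suc i \<in> nbrs E (p ! i)) \<and> (\<forall>i\<le>n. p ! i \<in> W)"
proof (induction n arbitrary: p x)
  case (Suc n)
  then obtain y q where q: "x \<in> W" "y \<in> nbrs E x" "p = x # q" "q \<in> walks_in E W n y"
    by (auto split: if_splits)
  from Suc.IH[OF q(4)] q(1-3) show ?case
    by (auto simp: nth_Cons less_Suc_eq_0_disj split: nat.splits)
qed (auto split: if_splits)

definition walk_weight :: "'a set set \<Rightarrow> nat \<Rightarrow> 'a list \<Rightarrow> real" where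
  "walk_weight E n p = (\<Prod>i<n. 1 / real (deg E (p ! i)))"

context loc_finite_graph
begin

lemma finite_walks_in: "W \<subseteq> V \<Longrightarrow> finite (walks_in E W n x)"
  by (induction n arbitrary: x) (auto simp: finite_nbrs subset_iff)

text \<open>The recursion unfolds from the first step, while the jump chain is defined from the last; the sum
over trajectories mediates between the two.\<close>

lemma stay_weight_eq_sum:
  assumes W: "W \<subseteq> V"
  shows "stay_weight E W n x = (\<Sum>p\<in>walks_in E W n x. walk_weight E n p)"
proof (induction n arbitrary: x)
  case 0
  show ?case by (simp add: walk_weight_def)
next
  case (Suc n)
  show ?case
  proof (cases "x \<in> W")
    case True
    then have x: "x \<in> V" using W by auto
    have weight: "walk_weight E (Suc n) (x # q) = walk_weight E n q / real (deg E x)" for q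
      unfolding walk_weight_def prod.lessThan_Suc_shift by simp
    have "(\<Sum>p\<in>walks_in E W (Suc n) x. walk_weight E (Suc n) p) =
        (\<Sum>y\<in>nbrs E x. \<Sum>p\<in>(#) x ` walks_in E W n y. walk_weight E (Suc n) p)"
      using True x W by (simp, intro sum.UNION_disjoint)
        (auto simp: finite_nbrs finite_walks_in dest!: walks_in_dest)
    also have "\<dots> = (\<Sum>y\<in>nbrs E x. (\<Sum>q\<in>walks_in E W n y. walk_weight E n q) / real (deg E x))"
      by (simp add: sum.reindex weight sum_divide_distrib)
    also have "\<dots> = stay_weight E W (Suc n) x"
      using True by (simp add: Suc.IH sum_divide_distrib)
    finally show ?thesis by simp
  qed simp
qed

definition step_space :: "(nat \<times> 'a \<Rightarrow> 'a) measure" where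
  "step_space = PiM (UNIV \<times> V) (\<lambda>(n, v). measure_pmf (pmf_of_set (nbrs E v)))"

definition follows :: "nat \<Rightarrow> 'a list \<Rightarrow> (nat \<times> 'a \<Rightarrow> 'a) set" where
  "follows n p = {\<xi> \<in> space step_space. \<forall>i<n. \<xi> (i, p ! i) = p ! Suc i}"

lemma product_prob_space_steps: "product_prob_space (\<lambda>(n::nat, v). measure_pmf (pmf_of_set (nbrs E v)))"
  by (intro product_prob_spaceI) (auto simp: prob_space_measure_pmf split: prod.split)

lemma prob_space_step_space: "prob_space step_space"
  unfolding step_space_def by (intro prob_space_PiM) (auto simp: prob_space_measure_pmf)

text \<open>The coordinates \<open>(i, p ! i)\<close> are distinct for distinct \<open>i\<close> even if the
trajectory revisits a vertex, so the steps are independent and their probabilities multiply.\<close>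

lemma measure_follows:
  assumes p: "p \<in> walks_in E W n x" and W: "W \<subseteq> V"
  shows "follows n p \<in> sets step_space" "measure step_space (follows n p) = walk_weight E n p"
proof -
  interpret product_prob_space "\<lambda>(n::nat, v). measure_pmf (pmf_of_set (nbrs E v))" "UNIV \<times> V"
    by (rule product_prob_space_steps)
  let ?J = "(\<lambda>i. (i, p ! i)) ` {..<n}" and ?X = "\<lambda>(i, v). {p ! Suc i}"
  have pV: "p ! i \<in> V" "p ! Suc i \<in> nbrs E (p ! i)" if "i < n" for i
    using walks_in_dest[OF p] W that by (auto simp: less_imp_le)
  have J: "?J \<subseteq> UNIV \<times> V" using pV by auto
  have eq: "follows n p = emb (UNIV \<times> V) ?J (PiE ?J ?X)"
    unfolding follows_def step_space_def prod_emb_def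
    using J by (auto simp: space_PiM PiE_iff extensional_def split: prod.splits)
  show "follows n p \<in> sets step_space"
    unfolding eq step_space_def using J by (intro sets_PiM_I) auto
  have "measure step_space (follows n p) = (\<Prod>j\<in>?J. measure (case j of (n, v) \<Rightarrow> measure_pmf (pmf_of_set (nbrs E v))) (?X j))"
    unfolding eq step_space_def by (rule measure_PiM_emb[OF J]) auto
  also have "\<dots> = (\<Prod>i<n. pmf (pmf_of_set (nbrs E (p ! i))) (p ! Suc i))"
    by (subst prod.reindex) (auto simp: inj_on_def measure_pmf_single)
  also have "\<dots> = walk_weight E n p"
    unfolding walk_weight_def
  proof (intro prod.cong refl)
    fix i assume "i \<in> {..<n}"
    then have i: "p ! i \<in> V" "p ! Suc i \<in> nbrs E (p ! i)" using pV by auto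
    then show "pmf (pmf_of_set (nbrs E (p ! i))) (p ! Suc i) = 1 / real (deg E (p ! i))"
      by (subst pmf_of_set) (auto simp: finite_nbrs deg_def)
  qed
  finally show "measure step_space (follows n p) = walk_weight E n p" .
qed

lemma AE_steps: "AE \<xi> in step_space. \<forall>n. \<forall>v\<in>V. \<xi> (n, v) \<in> nbrs E v"
proof -
  interpret product_prob_space "\<lambda>(n::nat, v). measure_pmf (pmf_of_set (nbrs E v))" "UNIV \<times> V"
    by (rule product_prob_space_steps)
  have "AE \<xi> in step_space. \<xi> (n, v) \<in> nbrs E v" if "v \<in> V" for n v
  proof -
    have ne: "nbrs E v \<noteq> {}" using deg_pos[OF that] by (auto simp: deg_def)
    have "AE y in measure_pmf (pmf_of_set (nbrs E v)). y \<in> nbrs E v"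
      using set_pmf_of_set[OF ne finite_nbrs[OF that]] by (simp add: AE_measure_pmf_iff)
    then show ?thesis
      using AE_component[of "(n, v)" "\<lambda>y. y \<in> nbrs E v"] that unfolding step_space_def prod.case by blast
  qed
  moreover have "countable V" using graph by (simp add: locally_finite_graph_def)
  ultimately show ?thesis by (simp add: AE_all_countable AE_ball_countable)
qed

lemma AE_waiting_times:
  "AE \<tau> in PiM UNIV (\<lambda>_::nat. density lborel (exponential_density 1)). \<forall>n. 0 < \<tau> n"
proof -
  interpret product_prob_space "\<lambda>_::nat. density lborel (exponential_density 1)" UNIV
    by (intro product_prob_spaceI prob_space_exponential_density) simp
  have "AE x in density lborel (exponential_density 1). 0 < (x::real)"
    using AE_lborel_singleton[of 0]
    by (simp add: AE_density exponential_density_def) (auto elim!: eventually_mono)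
  then show ?thesis using AE_component by (simp add: AE_all_countable)
qed

lemma random_walk_visits_jump_chain:
  assumes "\<forall>n. 0 < fst \<omega> n"
  shows "random_walk x (\<Sum>i<n. fst \<omega> i) \<omega> = jump_chain x (snd \<omega>) n"
proof -
  have "(LEAST k. (\<Sum>i<n. fst \<omega> i) < (\<Sum>i\<le>k. fst \<omega> i)) = n"
  proof (rule Least_equality)
    show "(\<Sum>i<n. fst \<omega> i) < (\<Sum>i\<le>n. fst \<omega> i)"
      using assms by (simp add: lessThan_Suc_atMost[symmetric])
    fix k assume k: "(\<Sum>i<n. fst \<omega> i) < (\<Sum>i\<le>k. fst \<omega> i)"
    show "n \<le> k"
    proof (rule ccontr)
      assume "\<not> n \<le> k"
      then have "(\<Sum>i\<le>k. fst \<omega> i) \<le> (\<Sum>i<n. fst \<omega> i)"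
        using assms by (intro sum_mono2) (auto intro: less_imp_le)
      with k show False by simp
    qed
  qed
  then show ?thesis by (simp add: random_walk_def)
qed

text \<open>Waiting times are positive, so the continuous-time walk visits every state of its jump chain. If the
chain stays in \<open>W\<close>, it follows one of the finitely many trajectories in \<open>W\<close>,
and the union bound applies.\<close>

lemma stays_forever_prob_le_stay_weight:
  assumes W: "W \<subseteq> V" and x: "x \<in> V"
  shows "stays_forever_prob V E x W \<le> stay_weight E W n x"
proof -
  let ?T = "PiM UNIV (\<lambda>_::nat. density lborel (exponential_density (1::real)))"
  interpret T: prob_space ?T
    by (intro prob_space_PiM prob_space_exponential_density) simp
  interpret S: prob_space step_space by (rule prob_space_step_space)
  interpret TS: pair_prob_space ?T step_space ..
  have M: "walk_space V E = ?T \<Otimes>\<^sub>M step_space" by (simp add: walk_space_def step_space_def)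
  interpret M: prob_space "walk_space V E" by (rule prob_space_walk_space)
  let ?A = "\<lambda>p. {\<omega> \<in> space (walk_space V E). snd \<omega> \<in> follows n p}"
  have snd: "snd \<in> measurable (walk_space V E) step_space" and fst: "fst \<in> measurable (walk_space V E) ?T"
    unfolding M by simp_all
  have A_sets: "?A p \<in> sets (walk_space V E)" if "p \<in> walks_in E W n x" for p
    using measurable_sets[OF snd measure_follows(1)[OF that W]] by (simp add: vimage_def Int_def conj_commute)
  have distr_snd: "distr (walk_space V E) step_space snd = step_space"
  proof (rule measure_eqI)
    fix C assume "C \<in> sets (distr (walk_space V E) step_space snd)"
    then have C: "C \<in> sets step_space" by simp
    have "emeasure (distr (walk_space V E) step_space snd) C = emeasure (walk_space V E) (snd -` C \<inter> space (walk_space V E))"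
      by (rule emeasure_distr[OF snd C])
    also have "snd -` C \<inter> space (walk_space V E) = space ?T \<times> C"
      using sets.sets_into_space[OF C] unfolding M space_pair_measure by auto
    also have "emeasure (walk_space V E) (space ?T \<times> C) = emeasure step_space C"
      unfolding M by (simp add: S.emeasure_pair_measure_Times[OF sets.top C] T.emeasure_space_1)
    finally show "emeasure (distr (walk_space V E) step_space snd) C = emeasure step_space C" .
  qed simp
  have A_prob: "M.prob (?A p) = walk_weight E n p" if "p \<in> walks_in E W n x" for p
  proof -
    have "M.prob (?A p) = measure (distr (walk_space V E) step_space snd) (follows n p)"
      using measure_follows(1)[OF that W] by (subst measure_distr[OF snd]) (auto intro!: arg_cong[of _ _ M.prob])
    then show ?thesis using measure_follows(2)[OF that W] by (simp add: distr_snd)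
  qed
  have AE1: "AE \<omega> in walk_space V E. \<forall>n. 0 < fst \<omega> n"
    unfolding M by (rule AE_distrD[OF measurable_fst]) (subst S.distr_pair_fst, rule AE_waiting_times)
  have AE2: "AE \<omega> in walk_space V E. \<forall>n. \<forall>v\<in>V. snd \<omega> (n, v) \<in> nbrs E v"
    by (rule AE_distrD[OF snd]) (subst distr_snd, rule AE_steps)
  have "M.prob {\<omega> \<in> space (walk_space V E). \<forall>t\<ge>0. random_walk x t \<omega> \<in> W} \<le> M.prob (\<Union>p\<in>walks_in E W n x. ?A p)"
  proof (rule M.finite_measure_mono_AE)
    show "AE \<omega> in walk_space V E. \<omega> \<in> {\<omega> \<in> space (walk_space V E). \<forall>t\<ge>0. random_walk x t \<omega> \<in> W} \<longrightarrow>
        \<omega> \<in> (\<Union>p\<in>walks_in E W n x. ?A p)"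
      using AE1 AE2 AE_space
    proof eventually_elim
      fix \<omega> assume pos: "\<forall>n. 0 < fst \<omega> n" and nb: "\<forall>n. \<forall>v\<in>V. snd \<omega> (n, v) \<in> nbrs E v"
        and sp: "\<omega> \<in> space (walk_space V E)"
      let ?c = "jump_chain x (snd \<omega>)"
      show "\<omega> \<in> {\<omega> \<in> space (walk_space V E). \<forall>t\<ge>0. random_walk x t \<omega> \<in> W} \<longrightarrow>
        \<omega> \<in> (\<Union>p\<in>walks_in E W n x. ?A p)"
      proof
        assume stays: "\<omega> \<in> {\<omega> \<in> space (walk_space V E). \<forall>t\<ge>0. random_walk x t \<omega> \<in> W}"
        have nonneg: "0 \<le> (\<Sum>i<k. fst \<omega> i)" for k using pos by (intro sum_nonneg) (auto intro: less_imp_le)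
        have cW: "?c k \<in> W" for k
        proof -
          have "random_walk x (\<Sum>i<k. fst \<omega> i) \<omega> \<in> W" using stays nonneg[of k] by blast
          then show ?thesis by (simp only: random_walk_visits_jump_chain[OF pos])
        qed
        let ?p = "map ?c [0..<Suc n]"
        have nth: "?p ! i = ?c i" if "i \<le> n" for i using that by (simp del: upt_Suc)
        have "?p \<in> walks_in E W n x"
        proof (rule walks_in_intro)
          show "\<forall>i<n. ?p ! Suc i \<in> nbrs E (?p ! i)"
            using nb cW W by (auto simp: nth simp del: upt_Suc)
        qed (simp_all add: nth cW del: upt_Suc)
        moreover have "snd \<omega> \<in> follows n ?p"
          using sp unfolding follows_def M space_pair_measure by (auto simp: nth simp del: upt_Suc)
        ultimately show "\<omega> \<in> (\<Union>p\<in>walks_in E W n x. ?A p)" using sp by blast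
      qed
    qed
    show "(\<Union>p\<in>walks_in E W n x. ?A p) \<in> M.events"
      using A_sets finite_walks_in[OF W] by (intro sets.finite_UN) auto
  qed
  also have "\<dots> \<le> (\<Sum>p\<in>walks_in E W n x. M.prob (?A p))"
    using A_sets finite_walks_in[OF W] by (intro M.finite_measure_subadditive_finite) auto
  also have "\<dots> = stay_weight E W n x"
    by (simp add: A_prob stay_weight_eq_sum[OF W])
  finally show ?thesis by (simp add: stays_forever_prob_def)
qed

lemma stay_weight_bounds:
  assumes "W \<subseteq> V"
  shows "0 \<le> stay_weight E W n x" "stay_weight E W (Suc n) x \<le> stay_weight E W n x"
proof -
  show nonneg: "0 \<le> stay_weight E W n x" for n x
    by (induction n arbitrary: x) (auto intro!: divide_nonneg_nonneg mult_nonneg_nonneg sum_nonneg)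
  show "stay_weight E W (Suc n) x \<le> stay_weight E W n x"
  proof (induction n arbitrary: x)
    case 0
    show ?case
    proof (cases "x \<in> W")
      case True
      have "(\<Sum>y\<in>nbrs E x. of_bool (y \<in> W)) \<le> real (card (nbrs E x)) * 1"
        by (intro sum_bounded_above) auto
      then show ?thesis using deg_pos[of x] True assms by (simp add: deg_def divide_le_eq subset_iff)
    qed simp
  next
    case (Suc n)
    show ?case
      unfolding stay_weight.simps(2)[of E W "Suc n" x] stay_weight.simps(2)[of E W n x]
      by (intro divide_right_mono mult_left_mono sum_mono Suc.IH) auto
  qed
qed

text \<open>The decreasing limit of \<open>stay_weight\<close> is a bounded function that is harmonic in
\<open>W\<close> and zero outside. If there is no such function but zero, the walk cannot stay.\<close>

theorem stays_forever_prob_eq_0: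
  assumes W: "W \<subseteq> V" and x: "x \<in> V"
    and no_harm: "\<And>u. (\<And>x. 0 \<le> u x \<and> u x \<le> 1) \<Longrightarrow>
      (\<And>x. u x = of_bool (x \<in> W) * (\<Sum>y\<in>nbrs E x. u y) / real (deg E x)) \<Longrightarrow> u x = (0::real)"
  shows "stays_forever_prob V E x W = 0"
proof -
  have "\<exists>l. (\<lambda>n. stay_weight E W n y) \<longlonglongrightarrow> l" for y
  proof -
    have dec: "decseq (\<lambda>n. stay_weight E W n y)"
      by (rule decseq_SucI) (rule stay_weight_bounds(2)[OF W])
    obtain l where "(\<lambda>n. stay_weight E W n y) \<longlonglongrightarrow> l"
      by (rule decseq_convergent[OF dec, of 0]) (auto intro: stay_weight_bounds(1)[OF W])
    then show ?thesis ..
  qed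
  then obtain u where u: "\<And>y. (\<lambda>n. stay_weight E W n y) \<longlonglongrightarrow> u y" by metis
  have "u x = 0"
  proof (rule no_harm)
    fix y
    have dec: "decseq (\<lambda>n. stay_weight E W n y)"
      by (rule decseq_SucI) (rule stay_weight_bounds(2)[OF W])
    have "u y \<le> stay_weight E W 0 y" by (rule decseq_ge[OF dec u])
    also have "\<dots> \<le> 1" by simp
    finally have "u y \<le> 1" .
    moreover have "0 \<le> u y" by (rule LIMSEQ_le_const[OF u]) (auto intro: stay_weight_bounds(1)[OF W])
    ultimately show "0 \<le> u y \<and> u y \<le> 1" by simp
    have "(\<lambda>n. stay_weight E W (Suc n) y) \<longlonglongrightarrow> of_bool (y \<in> W) * (\<Sum>z\<in>nbrs E y. u z) / real (deg E y)"
      unfolding stay_weight.simps(2) divide_inverse by (intro tendsto_intros u)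
    moreover have "(\<lambda>n. stay_weight E W (Suc n) y) \<longlonglongrightarrow> u y" using u[of y] by (rule LIMSEQ_Suc)
    ultimately show "u y = of_bool (y \<in> W) * (\<Sum>z\<in>nbrs E y. u z) / real (deg E y)"
      by (rule LIMSEQ_unique[rotated])
  qed
  then have "(\<lambda>n. stay_weight E W n x) \<longlonglongrightarrow> 0" using u[of x] by simp
  then have "stays_forever_prob V E x W \<le> 0"
    by (rule LIMSEQ_le_const) (auto intro: stays_forever_prob_le_stay_weight[OF W x])
  moreover have "0 \<le> stays_forever_prob V E x W" by (simp add: stays_forever_prob_def)
  ultimately show ?thesis by simp
qed

end

section \<open>The ladder of hubs\<close>

definition hub :: "nat \<Rightarrow> nat" where "hub n = prod_encode (n, 0)"
definition mid :: "nat \<Rightarrow> nat \<Rightarrow> nat" where "mid n i = prod_encode (n, Suc i)"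
text \<open>The widths solve the equation for signed harmonic functions backwards, for the prescribed values
\<open>1 - (1/2)\<^sup>n / 3\<close> at the hubs: these were chosen bounded, positive and such that the
resulting numbers of midpoints are natural numbers.\<close>

definition width :: "nat \<Rightarrow> nat" where "width n = 48 * n * 2 ^ n + 18"

definition ladder_V :: "nat set" where
  "ladder_V = range hub \<union> (\<Union>n. mid n ` {..<width n})"

definition ladder_E :: "nat set set" where
  "ladder_E = (\<Union>n. {{hub n, hub (Suc n)}} \<union>
     (\<Union>i<width n. {{hub n, mid n i}, {mid n i, hub (Suc n)}}))"

definition ladder_sign :: "nat set \<Rightarrow> int" where
  "ladder_sign e = (if \<exists>n. e = {hub n, hub (Suc n)} then -1 else 1)"

lemma hub_mid_eq [simp]:
  "hub n = hub m \<longleftrightarrow> n = m" "mid n i = mid m j \<longleftrightarrow> n = m \<and> i = j"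
  "hub n \<noteq> mid m j" "mid m j \<noteq> hub n"
  by (auto simp: hub_def mid_def)

lemma ladder_E_cases:
  "{x, y} \<in> ladder_E \<longleftrightarrow>
    (\<exists>n. x = hub n \<and> y = hub (Suc n) \<or> x = hub (Suc n) \<and> y = hub n) \<or>
    (\<exists>n i. i < width n \<and> (x = hub n \<and> y = mid n i \<or> x = mid n i \<and> y = hub n \<or>
       x = hub (Suc n) \<and> y = mid n i \<or> x = mid n i \<and> y = hub (Suc n)))"
  unfolding ladder_E_def by (auto simp: doubleton_eq_iff)

lemma nbrs_hub_0: "nbrs ladder_E (hub 0) = insert (hub 1) (mid 0 ` {..<width 0})"
  unfolding nbrs_def ladder_E_cases by auto

lemma nbrs_hub_Suc:
  "nbrs ladder_E (hub (Suc n)) = insert (hub (Suc (Suc n))) (insert (hub n)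
     (mid (Suc n) ` {..<width (Suc n)} \<union> mid n ` {..<width n}))"
  unfolding nbrs_def ladder_E_cases by auto

lemma nbrs_mid: "i < width n \<Longrightarrow> nbrs ladder_E (mid n i) = {hub n, hub (Suc n)}"
  unfolding nbrs_def ladder_E_cases by auto

lemma sum_nbrs_hub_0:
  fixes g :: "nat \<Rightarrow> 'b::comm_monoid_add"
  shows "(\<Sum>y\<in>nbrs ladder_E (hub 0). g y) = g (hub 1) + (\<Sum>i<width 0. g (mid 0 i))"
  unfolding nbrs_hub_0 by (subst sum.insert) (auto simp: sum.reindex inj_on_def)

lemma sum_nbrs_hub_Suc:
  fixes g :: "nat \<Rightarrow> 'b::comm_monoid_add"
  shows "(\<Sum>y\<in>nbrs ladder_E (hub (Suc n)). g y) = g (hub (Suc (Suc n))) + (g (hub n) +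
    ((\<Sum>i<width (Suc n). g (mid (Suc n) i)) + (\<Sum>i<width n. g (mid n i))))"
  unfolding nbrs_hub_Suc
  by (subst sum.insert, force, force, subst sum.insert, force, force, subst sum.union_disjoint)
    (auto simp: sum.reindex inj_on_def)

lemma sum_nbrs_mid:
  fixes g :: "nat \<Rightarrow> 'b::comm_monoid_add"
  shows "i < width n \<Longrightarrow> (\<Sum>y\<in>nbrs ladder_E (mid n i). g y) = g (hub n) + g (hub (Suc n))"
  by (simp add: nbrs_mid)

lemma deg_sum: "deg E x = (\<Sum>y\<in>nbrs E x. 1)"
  by (simp add: deg_def)

lemma deg_hub_0: "deg ladder_E (hub 0) = 1 + width 0"
  unfolding deg_sum sum_nbrs_hub_0 by simp

lemma deg_hub_Suc: "deg ladder_E (hub (Suc n)) = 2 + width (Suc n) + width n"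
  unfolding deg_sum sum_nbrs_hub_Suc by simp

lemma deg_mid: "i < width n \<Longrightarrow> deg ladder_E (mid n i) = 2"
  by (simp add: deg_def nbrs_mid)

lemma ladder_V_cases:
  assumes "x \<in> ladder_V"
  obtains (hub_0) "x = hub 0" | (hub_Suc) n where "x = hub (Suc n)"
    | (mid) n i where "x = mid n i" "i < width n"
  using assms unfolding ladder_V_def by (auto) (metis not0_implies_Suc)

lemma ladder_graph: "locally_finite_graph ladder_V ladder_E"
  unfolding locally_finite_graph_def
proof (intro conjI ballI)
  show "countable ladder_V" by simp
  fix e assume "e \<in> ladder_E"
  then show "e \<subseteq> ladder_V" "card e = 2"
    by (auto simp: ladder_E_def ladder_V_def)
next
  fix x assume "x \<in> ladder_V"
  then show "finite (nbrs ladder_E x)" "deg ladder_E x \<ge> 1"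
    by (cases rule: ladder_V_cases; simp add: nbrs_hub_0 nbrs_hub_Suc nbrs_mid deg_hub_0 deg_hub_Suc deg_mid)+
qed

lemma ladder_sign_simps [simp]:
  "ladder_sign {hub n, hub (Suc n)} = -1" "ladder_sign {hub (Suc n), hub n} = -1"
  "ladder_sign {hub n, mid m i} = 1" "ladder_sign {mid m i, hub n} = 1"
  by (auto simp: ladder_sign_def doubleton_eq_iff)

lemma ladder_signed_graph: "signed_graph ladder_V ladder_E ladder_sign"
  by unfold_locales (auto simp: ladder_graph ladder_sign_def)

definition hub_harm :: "nat \<Rightarrow> real" where "hub_harm n = 1 - (1 / 2) ^ n / 3"

definition ladder_harm :: "nat \<Rightarrow> real" where
  "ladder_harm x = (case prod_decode x of (n, k) \<Rightarrow>
     if k = 0 then hub_harm n else (hub_harm n + hub_harm (Suc n)) / 2)"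

lemma ladder_harm_hub [simp]: "ladder_harm (hub n) = hub_harm n"
  and ladder_harm_mid [simp]: "ladder_harm (mid n i) = (hub_harm n + hub_harm (Suc n)) / 2"
  by (simp_all add: ladder_harm_def hub_def mid_def)

lemma hub_harm_bounds: "0 < hub_harm n" "hub_harm n \<le> 1"
proof -
  have "(1 / 2 :: real) ^ n \<le> 1" by (rule power_le_one) auto
  then show "0 < hub_harm n" by (simp add: hub_harm_def)
  show "hub_harm n \<le> 1" by (simp add: hub_harm_def)
qed

lemma ladder_harm_bound:
  assumes "x \<in> ladder_V"
  shows "\<bar>ladder_harm x\<bar> \<le> 1"
  using assms
proof (cases rule: ladder_V_cases)
  case (mid n i)
  then show ?thesis using hub_harm_bounds[of n] hub_harm_bounds[of "Suc n"] by simp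
qed (use hub_harm_bounds in \<open>auto simp: abs_of_pos\<close>)

text \<open>At a midpoint the value is the average of those at the two adjacent hubs. At a hub the negative
edges contribute four, up to a term of order \<open>(1/2)\<^sup>n\<close>, and by as much the product of
the conductance \<open>width n / 2\<close> and the increment of \<open>ladder_harm\<close> grows from
one pair of hubs to the next.\<close>

lemma ladder_harm_harmonic:
  assumes "x \<in> ladder_V"
  shows "(\<Sum>y\<in>nbrs ladder_E x. of_int (ladder_sign {x, y}) * ladder_harm y) = real (deg ladder_E x) * ladder_harm x"
  using assms
proof (cases rule: ladder_V_cases)
  case hub_0
  show ?thesis unfolding hub_0 sum_nbrs_hub_0 deg_hub_0
    using ladder_sign_simps(1)[of 0] by (simp add: hub_harm_def width_def)
next
  case (hub_Suc n)
  define q :: real where "q = (1 / 2) ^ n"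
  define p :: real where "p = 2 ^ n"
  have pq: "q * p = 1" by (simp add: p_def q_def flip: power_mult_distrib)
  have H: "hub_harm n = 1 - q / 3" "hub_harm (Suc n) = 1 - q / 6" "hub_harm (Suc (Suc n)) = 1 - q / 12"
    by (simp_all add: hub_harm_def q_def)
  have w: "real (width n) = 48 * n * p + 18" "real (width (Suc n)) = 96 * (real n + 1) * p + 18"
    by (simp_all add: width_def p_def algebra_simps)
  have "q * (real n * p) = real n" using pq by (metis mult.assoc mult.commute mult_1)
  then show ?thesis unfolding hub_Suc sum_nbrs_hub_Suc deg_hub_Suc
    using pq by (simp add: H w algebra_simps add_divide_distrib diff_divide_distrib)
next
  case (mid n i)
  then show ?thesis by (simp add: sum_nbrs_mid deg_mid)
qed

lemma ladder_triangle:
  assumes "i < width n" "hub n \<in> W" "hub (Suc n) \<in> W" "mid n i \<in> W"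
  shows "unsatisfied_cycle (induced_edges ladder_E W) ladder_sign [hub n, mid n i, hub (Suc n), hub n]"
proof -
  let ?p = "[hub n, mid n i, hub (Suc n), hub n]"
  have edges: "{hub n, mid n i} \<in> induced_edges ladder_E W" "{mid n i, hub (Suc n)} \<in> induced_edges ladder_E W"
    "{hub (Suc n), hub n} \<in> induced_edges ladder_E W"
    using assms by (auto simp: induced_edges_def ladder_E_cases)
  have lt: "Suc j < length ?p \<longleftrightarrow> j = 0 \<or> j = 1 \<or> j = 2" for j by auto
  have "{j. Suc j < length ?p \<and> ladder_sign {?p ! j, ?p ! Suc j} = - 1} = {2}"
    unfolding lt by (auto simp: numeral_2_eq_2)
  moreover have "\<forall>j. Suc j < length ?p \<longrightarrow> {?p ! j, ?p ! Suc j} \<in> induced_edges ladder_E W"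
    unfolding lt using edges by (auto simp: numeral_2_eq_2)
  ultimately show ?thesis unfolding unsatisfied_cycle_def by simp
qed

text \<open>On the hubs \<open>u\<close> is subharmonic, so its values increase along the ladder. If one of them is
positive, all later hubs belong to \<open>W\<close>, and therefore no later midpoint does, since a
triangle is an unsatisfied cycle. Then a later hub has only its two neighbouring hubs to average over
with weight at most \<open>1 / 4\<close> each, so its value is at most half of the next one: the values
at least double at every hub, against \<open>u \<le> 1\<close>.\<close>

lemma ladder_no_harmonic:
  fixes u :: "nat \<Rightarrow> real"
  assumes balanced: "\<nexists>p. unsatisfied_cycle (induced_edges ladder_E W) ladder_sign p"
    and u: "\<And>x. 0 \<le> u x \<and> u x \<le> 1"
    and harm: "\<And>x. u x = of_bool (x \<in> W) * (\<Sum>y\<in>nbrs ladder_E x. u y) / real (deg ladder_E x)"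
    and x: "x \<in> ladder_V"
  shows "u x = 0"
proof -
  define a where "a n = u (hub n)" for n
  define S where "S n = (\<Sum>i<width n. u (mid n i))" for n
  have a01: "0 \<le> a n" "a n \<le> 1" for n using u by (auto simp: a_def)
  have mid_le: "u (mid n i) \<le> (a n + a (Suc n)) / 2" if "i < width n" for n i
    using harm[of "mid n i"] a01[of n] a01[of "Suc n"] that
    by (simp add: sum_nbrs_mid deg_mid a_def)
  have S: "S n \<le> width n * ((a n + a (Suc n)) / 2)" for n
  proof -
    have "(\<Sum>i<width n. u (mid n i)) \<le> real (card {..<width n}) * ((a n + a (Suc n)) / 2)"
      by (rule sum_bounded_above, rule mid_le) simp
    then show ?thesis by (simp add: S_def)
  qed
  have S0: "0 \<le> S n" for n unfolding S_def using u by (intro sum_nonneg) auto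
  have eq0: "(1 + real (width 0)) * a 0 \<le> a 1 + S 0"
  proof -
    have "(1 + real (width 0)) * a 0 = of_bool (hub 0 \<in> W) * (a 1 + S 0)"
      using harm[of "hub 0"] unfolding sum_nbrs_hub_0 deg_hub_0 by (simp add: a_def S_def divide_eq_eq)
    then show ?thesis using a01[of 1] S0[of 0] by simp
  qed
  have eq: "(2 + real (width (Suc n)) + real (width n)) * a (Suc n) \<le> a (Suc (Suc n)) + a n + S (Suc n) + S n" for n
  proof -
    have "(2 + real (width (Suc n)) + real (width n)) * a (Suc n) = of_bool (hub (Suc n) \<in> W) * (a (Suc (Suc n)) + a n + S (Suc n) + S n)"
      using harm[of "hub (Suc n)"] unfolding sum_nbrs_hub_Suc deg_hub_Suc
      by (simp add: a_def S_def divide_eq_eq add_ac)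
    then show ?thesis using a01[of n] a01[of "Suc (Suc n)"] S0[of "Suc n"] S0[of n] by simp
  qed
  have mono: "a n \<le> a (Suc n)" for n
  proof (induction n)
    case 0
    show ?case using eq0 S[of 0] by (simp add: width_def)
  next
    case (Suc n)
    have "0 \<le> (real (width n) / 2 + 1) * (a (Suc n) - a n)" using Suc by simp
    also have "\<dots> \<le> (real (width (Suc n)) / 2 + 1) * (a (Suc (Suc n)) - a (Suc n))"
      using eq[of n] S[of n] S[of "Suc n"] by (simp add: algebra_simps add_divide_distrib diff_divide_distrib)
    finally have "0 \<le> a (Suc (Suc n)) - a (Suc n)"
      by (simp add: zero_le_mult_iff)
    then show ?case by simp
  qed
  have a_zero: "a j = 0" for j
  proof (rule ccontr)
    assume "a j \<noteq> 0"
    then have pos: "0 < a n" if "j \<le> n" for n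
      using lift_Suc_mono_le[of a, OF mono that] a01[of j] by linarith
    have hubW: "hub n \<in> W" if "j \<le> n" for n
      using harm[of "hub n"] pos[OF that] by (cases "hub n \<in> W") (auto simp: a_def)
    have S_zero: "S n = 0" if "j \<le> n" for n
      unfolding S_def
    proof (rule sum.neutral, rule ballI)
      fix i assume "i \<in> {..<width n}"
      then have "mid n i \<notin> W"
        using ladder_triangle[of i n W] hubW[of n] hubW[of "Suc n"] that balanced by auto
      then show "u (mid n i) = 0" using harm[of "mid n i"] by simp
    qed
    have double: "2 * a n \<le> a (Suc n)" if n: "Suc j \<le> n" for n
    proof -
      obtain m where m: "n = Suc m" "j \<le> m" using n by (cases n) auto
      have "4 * a n \<le> (2 + real (width (Suc m)) + real (width m)) * a n"
        using a01[of n] by (intro mult_right_mono) (auto simp: width_def)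
      also have "\<dots> \<le> a (Suc n) + a m"
        using eq[of m] S_zero[of m] S_zero[of "Suc m"] m by simp
      finally show ?thesis using mono[of m] mono[of n] m by simp
    qed
    have grow: "2 ^ k * a (Suc j) \<le> a (Suc j + k)" for k
    proof (induction k)
      case (Suc k)
      have "2 * (2 ^ k * a (Suc j)) \<le> a (Suc (Suc j + k))"
        using Suc double[of "Suc j + k"] by simp
      then show ?case by simp
    qed simp
    obtain k where "1 / a (Suc j) < 2 ^ k" using real_arch_pow[of 2 "1 / a (Suc j)"] by auto
    then have "1 < 2 ^ k * a (Suc j)" using pos[of "Suc j"] by (simp add: divide_less_eq)
    then show False using grow[of k] a01[of "Suc j + k"] by linarith
  qed
  show ?thesis
    using x
  proof (cases rule: ladder_V_cases)
    case (mid n i)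
    then show ?thesis using mid_le[of i n] a_zero u[of x] by simp
  qed (use a_zero in \<open>auto simp: a_def\<close>)
qed

theorem proposition1:
  "\<exists>(V :: nat set) (E :: nat set set) (s :: nat set \<Rightarrow> int).
     locally_finite_graph V E \<and> (\<forall>e\<in>E. s e \<in> {- 1, 1}) \<and>
     (\<exists>S. signed_voter_model V E s S \<and>
        (\<exists>\<mu> \<nu>. equilibrium V S \<mu> \<and> equilibrium V S \<nu> \<and> \<mu> \<noteq> \<nu>)) \<and>
     \<not> (\<exists>W\<subseteq>V. (\<nexists>p. unsatisfied_cycle (induced_edges E W) s p) \<and>
                (\<exists>x\<in>W. stays_forever_prob V E x W > 0))"
proof -
  interpret signed_graph ladder_V ladder_E ladder_sign by (rule ladder_signed_graph)
  have hub: "hub 0 \<in> ladder_V" by (simp add: ladder_V_def)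
  have "\<exists>\<mu> \<nu>. equilibrium ladder_V voter_semigroup \<mu> \<and> equilibrium ladder_V voter_semigroup \<nu> \<and> \<mu> \<noteq> \<nu>"
    using harmonic_two_equilibria[OF ladder_harm_bound ladder_harm_harmonic hub] hub_harm_bounds(1)[of 0] by simp
  moreover have "stays_forever_prob ladder_V ladder_E x W = 0"
    if W: "W \<subseteq> ladder_V" and balanced: "\<nexists>p. unsatisfied_cycle (induced_edges ladder_E W) ladder_sign p"
      and x: "x \<in> W" for W x
  proof -
    have xV: "x \<in> ladder_V" using W x by blast
    show ?thesis
    proof (rule stays_forever_prob_eq_0[OF W xV])
      fix u :: "nat \<Rightarrow> real"
      assume "\<And>x. 0 \<le> u x \<and> u x \<le> 1"
        and "\<And>x. u x = of_bool (x \<in> W) * (\<Sum>y\<in>nbrs ladder_E x. u y) / real (deg ladder_E x)"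
      then show "u x = 0" by (rule ladder_no_harmonic[OF balanced _ _ xV])
    qed
  qed
  then have "\<not> (\<exists>W\<subseteq>ladder_V. (\<nexists>p. unsatisfied_cycle (induced_edges ladder_E W) ladder_sign p) \<and>
      (\<exists>x\<in>W. stays_forever_prob ladder_V ladder_E x W > 0))"
    by fastforce
  ultimately show ?thesis
    using graph signs signed_voter_model_semigroup by blast
qed

end
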